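(* Let $H$ be a bialgebra over a field $k$, let $A$ be a bialgebra in ${}^H_H\mathcal{YD}$ and $B$ a bialgebra in $\mathcal{YD}^H_H$ such that $$b^2\triangleright a^2\otimes b^1\triangleleft a^1=a\otimes b\qquad\text{for all } a\in A,\ b\in B,$$ and let $A\# H\# B$ be the corresponding double biproduct bialgebra (see context). Define $D=A\otimes B$, with the tensor product algebra and tensor product coalgebra structures (in vector spaces, with the usual flip) and with actions and coactions given, for $a\in A$, $b\in B$, $h\in H$, by $$h\cdot(a\otimes b)=h\triangleright a\otimes b,\qquad (a\otimes b)\cdot h=a\otimes b\triangleleft h,$$ $$(a\otimes b)^{(-1)}\otimes(a\otimes b)^{(0)}=a^1\otimes(a^2\otimes b),\qquad (a\otimes b)^{<0>}\otimes(a\otimes b)^{<1>}=(a\otimes b^1)\otimes b^2.$$ Then $(H,D)$ is an L-R-admissible pair, and the map $$\phi:(A\otimes B)\natural H\to A\# H\# B,\qquad (a\otimes b)\natural h\mapsto a\# h\# b,$$ is an isomorphism of bialgebras, where $(A\otimes B)\natural H=D\natural H$ is the L-R-smash biproduct.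
   Context: Everything is over a field $k$, $\otimes=\otimes_k$. For a bialgebra $H$ write $\Delta(h)=h_1\otimes h_2$ and $\varepsilon_H=\varepsilon$ for its counit. **Yetter-Drinfeld categories.** ${}^H_H\mathcal{YD}$ is the (pre)braided monoidal category of left-left Yetter-Drinfeld modules: left $H$-modules and left $H$-comodules $V$ (coaction $v\mapsto v^1\otimes v^2\in H\otimes V$) with $(h_1\triangleright v)^1h_2\otimes(h_1\triangleright v)^2=h_1v^1\otimes h_2\triangleright v^2$, with diagonal actions and codiagonal coactions on tensor products, and braiding $v\otimes w\mapsto v^1\triangleright w\otimes v^2$. $\mathcal{YD}^H_H$ is the (pre)braided monoidal category of right-right Yetter-Drinfeld modules: right $H$-modules and right $H$-comodules $W$ (coaction $w\mapsto w^1\otimes w^2\in W\otimes H$) with $(w\triangleleft h_2)^1\otimes h_1(w\triangleleft h_2)^2=w^1\triangleleft h_1\otimes w^2h_2$, with diagonal actions and codiagonal coactions on tensor products, and braiding $v\otimes w\mapsto w^1\otimes v\triangleleft w^2$. **Double biproduct (with trivial pairing).** Let $A$ be a bialgebra in ${}^H_H\mathcal{YD}$ and $B$ a bialgebra in $\mathcal{YD}^H_H$, with counits $\varepsilon_A,\varepsilon_B$, comultiplications $\Delta_A(a)=a_1\otimes a_2$, $\Delta_B(b)=b_1\otimes b_2$, actions $h\otimes a\mapsto h\triangleright a$, $b\otimes h\mapsto b\triangleleft h$, and coactions $A\to H\otimes A$, $a\mapsto a^1\otimes a^2$, and $B\to B\otimes H$, $b\mapsto b^1\otimes b^2$. $A\#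 H\# B$ denotes the vector space $A\otimes H\otimes B$ (elements $a\# h\# b$) with unit $1_A\# 1_H\# 1_B$, multiplication $$(a\# h\# b)(a'\# h'\# b')=a(h_1\triangleright a')\# h_2h'_1\#(b\triangleleft h'_2)b',$$ counit $\varepsilon(a\# h\# b)=\varepsilon_A(a)\varepsilon_H(h)\varepsilon_B(b)$ and comultiplication $$\Delta(a\# h\# b)=(a_1\# a_2^1h_1\# b_1^1)\otimes(a_2^2\# h_2b_1^2\# b_2).$$ It is known that if $b^2\triangleright a^2\otimes b^1\triangleleft a^1=a\otimes b$ for all $a\in A$, $b\in B$, then $A\# H\# B$ is a bialgebra, called the double biproduct. **L-R-admissible pairs.** Let $D$ be a vector space with the following structures. (i) $D$ is an $H$-bimodule, with actions $h\otimes d\mapsto h\cdot d$ and $d\otimes h\mapsto d\cdot h$. (ii) $D$ is an (associative unital) algebra with unit $1_D$ and multiplication $c\otimes d\mapsto cd$. (iii) $D$ is an $H$-bimodule algebra: $h\cdot 1_D=\varepsilon(h)1_D$, $1_D\cdot h=\varepsilon(h)1_D$, $h\cdot(cd)=(h_1\cdot c)(h_2\cdot d)$, $(cd)\cdot h=(c\cdot h_1)(d\cdot h_2)$ for all $h\in H$, $c,d\in D$. (iv) $D$ is an $H$-bicomodule, with right coaction $\rho:D\to D\otimes H$, $\rho(d)=d^{<0>}\otimes d^{<1>}$, and left coaction $\lambda:D\to H\otimes D$, $\lambda(d)=d^{(-1)}\otimes d^{(0)}$. (v) $D$ is a (coassociative counital) coalgebra with comultiplication $\Delta_D(d)=d_1\otimes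 d_2$ and counit $\varepsilon_D$. (vi) $D$ is an $H$-bicomodule coalgebra: for all $d\in D$, $d_1^{(-1)}d_2^{(-1)}\otimes d_1^{(0)}\otimes d_2^{(0)}=d^{(-1)}\otimes(d^{(0)})_1\otimes(d^{(0)})_2$, $d^{(-1)}\varepsilon_D(d^{(0)})=\varepsilon_D(d)1_H$, $d_1^{<0>}\otimes d_2^{<0>}\otimes d_1^{<1>}d_2^{<1>}=(d^{<0>})_1\otimes(d^{<0>})_2\otimes d^{<1>}$, $\varepsilon_D(d^{<0>})d^{<1>}=\varepsilon_D(d)1_H$. $(H,D)$ is called an L-R-admissible pair if (i)–(vi) hold and moreover, for all $h\in H$ and $c,d\in D$: - $\varepsilon_D(1_D)=1$, $\varepsilon_D(cd)=\varepsilon_D(c)\varepsilon_D(d)$; - $\varepsilon_D(h\cdot d)=\varepsilon_D(d\cdot h)=\varepsilon_D(d)\varepsilon_H(h)$; - $\rho(1_D)=1_D\otimes 1_H$, $\lambda(1_D)=1_H\otimes 1_D$; - $\Delta_D(1_D)=1_D\otimes 1_D$; - $\rho(cd)=c^{<0>}d^{<0>}\otimes c^{<1>}d^{<1>}$; - $\lambda(cd)=c^{(-1)}d^{(-1)}\otimes c^{(0)}d^{(0)}$; - $\Delta_D(h\cdot d)=h_1\cdot d_1\otimes h_2\cdot d_2$; - $\Delta_D(d\cdot h)=d_1\cdot h_1\otimes d_2\cdot h_2$; - $\Delta_D(cd)=c_1(c_2^{(-1)}\cdot d_1^{<0>})\otimes(c_2^{(0)}\cdot d_1^{<1>})d_2$;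 - $(h_1\cdot d)^{(-1)}h_2\otimes(h_1\cdot d)^{(0)}=h_1d^{(-1)}\otimes h_2\cdot d^{(0)}$; - $(h\cdot d)^{<0>}\otimes(h\cdot d)^{<1>}=h\cdot d^{<0>}\otimes d^{<1>}$; - $(d\cdot h_2)^{<0>}\otimes h_1(d\cdot h_2)^{<1>}=d^{<0>}\cdot h_1\otimes d^{<1>}h_2$; - $(d\cdot h)^{(-1)}\otimes(d\cdot h)^{(0)}=d^{(-1)}\otimes d^{(0)}\cdot h$; - $c^{<0>}\cdot d^{(-1)}\otimes c^{<1>}\cdot d^{(0)}=c\otimes d$. **L-R-smash biproduct.** If $(H,D)$ is an L-R-admissible pair, the L-R-smash biproduct $D\natural H$ is the vector space $D\otimes H$ (elements $d\natural h$) with unit $1_D\natural 1_H$, multiplication $(d\natural h)(d'\natural h')=(d\cdot h'_2)(h_1\cdot d')\natural h_2h'_1$, counit $\varepsilon(d\natural h)=\varepsilon_D(d)\varepsilon_H(h)$ and comultiplication $\Delta(d\natural h)=(d_1^{<0>}\natural d_2^{(-1)}h_1)\otimes(d_2^{(0)}\natural h_2d_1^{<1>})$; it is a bialgebra. *)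

theory Defs
  imports "HOL-Algebra.Module" "HOL-Algebra.AbelCoset"
begin

section \<open>Tensor products of vector spaces\<close>

text \<open>
  A vector space over a field \<open>K\<close> is a \<^locale>\<open>module\<close> over \<open>K\<close>.  The tensor product of \<open>V\<close> and
  \<open>W\<close> is the space of finitely supported functions on \<open>carrier V \<times> carrier W\<close> modulo the
  subspace spanned by the bilinearity relations; its elements are cosets.
\<close>

type_synonym ('v, 'w, 'k) tensor = "('v \<times> 'w \<Rightarrow> 'k) set"

definition free_space :: "('k, 'm) ring_scheme \<Rightarrow> 'x set \<Rightarrow> ('k, 'x \<Rightarrow> 'k) module" where
  "free_space K X =
    \<lparr>carrier = {p. (\<forall>x. p x \<in> carrier K) \<and> {x. p x \<noteq> \<zero>\<^bsub>K\<^esub>} \<subseteq> X \<and> finite {x. p x \<noteq> \<zero>\<^bsub>K\<^esub>}},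
     mult = undefined, one = undefined,
     zero = (\<lambda>x. \<zero>\<^bsub>K\<^esub>),
     add = (\<lambda>p q x. p x \<oplus>\<^bsub>K\<^esub> q x),
     smult = (\<lambda>c p x. c \<otimes>\<^bsub>K\<^esub> p x)\<rparr>"

definition basis_vec :: "('k, 'm) ring_scheme \<Rightarrow> 'x \<Rightarrow> 'x \<Rightarrow> 'k" where
  "basis_vec K x = (\<lambda>y. if y = x then \<one>\<^bsub>K\<^esub> else \<zero>\<^bsub>K\<^esub>)"

definition tensor_rels ::
  "('k, 'm) ring_scheme \<Rightarrow> ('k, 'v, 'm1) module_scheme \<Rightarrow> ('k, 'w, 'm2) module_scheme
    \<Rightarrow> ('v, 'w, 'k) tensor" where
  "tensor_rels K V W = (let F = free_space K (carrier V \<times> carrier W); e = basis_vec K in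
      {e (v \<oplus>\<^bsub>V\<^esub> v', w) \<ominus>\<^bsub>F\<^esub> (e (v, w) \<oplus>\<^bsub>F\<^esub> e (v', w)) | v v' w.
          v \<in> carrier V \<and> v' \<in> carrier V \<and> w \<in> carrier W}
    \<union> {e (v, w \<oplus>\<^bsub>W\<^esub> w') \<ominus>\<^bsub>F\<^esub> (e (v, w) \<oplus>\<^bsub>F\<^esub> e (v, w')) | v w w'.
          v \<in> carrier V \<and> w \<in> carrier W \<and> w' \<in> carrier W}
    \<union> {e (c \<odot>\<^bsub>V\<^esub> v, w) \<ominus>\<^bsub>F\<^esub> c \<odot>\<^bsub>F\<^esub> e (v, w) | c v w.
          c \<in> carrier K \<and> v \<in> carrier V \<and> w \<in> carrier W}
    \<union> {e (v, c \<odot>\<^bsub>W\<^esub> w) \<ominus>\<^bsub>F\<^esub> c \<odot>\<^bsub>F\<^esub> e (v, w) | c v w.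
          c \<in> carrier K \<and> v \<in> carrier V \<and> w \<in> carrier W})"

definition tensor_null ::
  "('k, 'm) ring_scheme \<Rightarrow> ('k, 'v, 'm1) module_scheme \<Rightarrow> ('k, 'w, 'm2) module_scheme
    \<Rightarrow> ('v, 'w, 'k) tensor" where
  "tensor_null K V W = \<Inter> {N. submodule N K (free_space K (carrier V \<times> carrier W))
      \<and> tensor_rels K V W \<subseteq> N}"

definition tensor ::
  "('k, 'm) ring_scheme \<Rightarrow> ('k, 'v, 'm1) module_scheme \<Rightarrow> ('k, 'w, 'm2) module_scheme
    \<Rightarrow> ('k, ('v, 'w, 'k) tensor) module" where
  "tensor K V W = (let F = free_space K (carrier V \<times> carrier W); N = tensor_null K V W in
    \<lparr>carrier = a_rcosets\<^bsub>F\<^esub> N,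
     mult = undefined, one = undefined,
     zero = N,
     add = set_add F,
     smult = (\<lambda>c t. \<Union>p\<in>t. N +>\<^bsub>F\<^esub> (c \<odot>\<^bsub>F\<^esub> p))\<rparr>)"

definition tens ::
  "('k, 'm) ring_scheme \<Rightarrow> ('k, 'v, 'm1) module_scheme \<Rightarrow> ('k, 'w, 'm2) module_scheme
    \<Rightarrow> 'v \<Rightarrow> 'w \<Rightarrow> ('v, 'w, 'k) tensor" where
  "tens K V W v w =
    tensor_null K V W +>\<^bsub>free_space K (carrier V \<times> carrier W)\<^esub> basis_vec K (v, w)"

abbreviation "tensor3 K U V W \<equiv> tensor K U (tensor K V W)"

abbreviation "tens3 K U V W u v w \<equiv> tens K U (tensor K V W) u (tens K V W v w)"

text \<open>
  Sweedler notation.  If \<open>t = t\<^sub>1 \<otimes> t\<^sub>2\<close> (summation understood), then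
  \<open>\<Oplus>[K, M] x \<otimes> y \<in> t. f x y\<close> is the element \<open>f t\<^sub>1 t\<^sub>2\<close> of \<open>M\<close>: a representative
  \<open>t = (\<Sum>\<^sub>i c\<^sub>i (x\<^sub>i \<otimes> y\<^sub>i))\<close> is chosen, and the value is \<open>(\<Sum>\<^sub>i c\<^sub>i f x\<^sub>i y\<^sub>i)\<close>.  It does not
  depend on the choice as soon as \<open>f\<close> is bilinear.
\<close>

definition sweedler ::
  "('k, 'm) ring_scheme \<Rightarrow> ('k, 'u, 'm1) module_scheme \<Rightarrow> ('v, 'w, 'k) tensor
    \<Rightarrow> ('v \<Rightarrow> 'w \<Rightarrow> 'u) \<Rightarrow> 'u" where
  "sweedler K M t f = (let p = (SOME p. p \<in> t) in
    (\<Oplus>\<^bsub>M\<^esub> z \<in> {z. p z \<noteq> \<zero>\<^bsub>K\<^esub>}. p z \<odot>\<^bsub>M\<^esub> f (fst z) (snd z)))"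

syntax
  "_sweedler" :: "'a \<Rightarrow> 'b \<Rightarrow> pttrn \<Rightarrow> pttrn \<Rightarrow> 'c \<Rightarrow> 'd \<Rightarrow> 'd"
    (\<open>(3\<Oplus>[_, _] _ \<otimes> _ \<in> _./ _)\<close> [0, 0, 0, 0, 51, 10] 10)
translations
  "\<Oplus>[K, M] x \<otimes> y \<in> t. e" \<rightleftharpoons> "CONST sweedler K M t (\<lambda>x y. e)"


section \<open>Algebras, coalgebras, bialgebras\<close>

definition linear_map ::
  "('k, 'm) ring_scheme \<Rightarrow> ('k, 'v, 'm1) module_scheme \<Rightarrow> ('k, 'w, 'm2) module_scheme
    \<Rightarrow> ('v \<Rightarrow> 'w) \<Rightarrow> bool" where
  "linear_map K V W f \<longleftrightarrow> f \<in> carrier V \<rightarrow> carrier W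
    \<and> (\<forall>x\<in>carrier V. \<forall>y\<in>carrier V. f (x \<oplus>\<^bsub>V\<^esub> y) = f x \<oplus>\<^bsub>W\<^esub> f y)
    \<and> (\<forall>c\<in>carrier K. \<forall>x\<in>carrier V. f (c \<odot>\<^bsub>V\<^esub> x) = c \<odot>\<^bsub>W\<^esub> f x)"

definition bilinear_map ::
  "('k, 'm) ring_scheme \<Rightarrow> ('k, 'u, 'm1) module_scheme \<Rightarrow> ('k, 'v, 'm2) module_scheme
    \<Rightarrow> ('k, 'w, 'm3) module_scheme \<Rightarrow> ('u \<Rightarrow> 'v \<Rightarrow> 'w) \<Rightarrow> bool" where
  "bilinear_map K U V W f \<longleftrightarrow> (\<forall>u\<in>carrier U. linear_map K V W (f u))
    \<and> (\<forall>v\<in>carrier V. linear_map K U W (\<lambda>u. f u v))"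

definition base_space :: "('k, 'm) ring_scheme \<Rightarrow> ('k, 'k) module" where
  "base_space K = \<lparr>carrier = carrier K, mult = mult K, one = one K, zero = zero K, add = add K,
    smult = mult K\<rparr>"

text \<open>The library's locale \<^locale>\<open>algebra\<close> covers commutative algebras only.\<close>

locale assoc_algebra = K?: field K + A?: module K A + A?: ring A
  for K (structure) and A (structure) +
  assumes smult_mult_left: "\<lbrakk>c \<in> carrier K; x \<in> carrier A; y \<in> carrier A\<rbrakk>
      \<Longrightarrow> (c \<odot>\<^bsub>A\<^esub> x) \<otimes>\<^bsub>A\<^esub> y = c \<odot>\<^bsub>A\<^esub> (x \<otimes>\<^bsub>A\<^esub> y)"
    and smult_mult_right: "\<lbrakk>c \<in> carrier K; x \<in> carrier A; y \<in> carrier A\<rbrakk>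
      \<Longrightarrow> x \<otimes>\<^bsub>A\<^esub> (c \<odot>\<^bsub>A\<^esub> y) = c \<odot>\<^bsub>A\<^esub> (x \<otimes>\<^bsub>A\<^esub> y)"

record ('k, 'v) coalg = "('k, 'v) module" +
  comult :: "'v \<Rightarrow> ('v, 'v, 'k) tensor"
  counit :: "'v \<Rightarrow> 'k"

locale coalgebra = K?: field K + C?: module K C
  for K (structure) and C :: "('k, 'c, 'm) coalg_scheme" (structure) +
  assumes comult_linear: "linear_map K C (tensor K C C) (comult C)"
    and counit_linear: "linear_map K C (base_space K) (counit C)"
    and coassoc: "c \<in> carrier C \<Longrightarrow>
      (\<Oplus>[K, tensor3 K C C C] x \<otimes> y \<in> comult C c.
        \<Oplus>[K, tensor3 K C C C] x1 \<otimes> x2 \<in> comult C x. tens3 K C C C x1 x2 y)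
      = (\<Oplus>[K, tensor3 K C C C] x \<otimes> y \<in> comult C c.
        \<Oplus>[K, tensor3 K C C C] y1 \<otimes> y2 \<in> comult C y. tens3 K C C C x y1 y2)"
    and counit_left: "c \<in> carrier C \<Longrightarrow> (\<Oplus>[K, C] x \<otimes> y \<in> comult C c. counit C x \<odot>\<^bsub>C\<^esub> y) = c"
    and counit_right: "c \<in> carrier C \<Longrightarrow> (\<Oplus>[K, C] x \<otimes> y \<in> comult C c. counit C y \<odot>\<^bsub>C\<^esub> x) = c"

definition tensor_coalg ::
  "('k, 'm) ring_scheme \<Rightarrow> ('k, 'v, 'm1) coalg_scheme \<Rightarrow> ('k, 'w, 'm2) coalg_scheme
    \<Rightarrow> ('k, ('v, 'w, 'k) tensor) coalg" where
  "tensor_coalg K V W = (let T = tensor K V W in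
    \<lparr>carrier = carrier T,
     mult = (\<lambda>s t. \<Oplus>[K, T] v \<otimes> w \<in> s. \<Oplus>[K, T] v' \<otimes> w' \<in> t.
              tens K V W (v \<otimes>\<^bsub>V\<^esub> v') (w \<otimes>\<^bsub>W\<^esub> w')),
     one = tens K V W \<one>\<^bsub>V\<^esub> \<one>\<^bsub>W\<^esub>,
     zero = zero T, add = add T, smult = smult T,
     comult = (\<lambda>t. \<Oplus>[K, tensor K T T] v \<otimes> w \<in> t.
              \<Oplus>[K, tensor K T T] v1 \<otimes> v2 \<in> comult V v. \<Oplus>[K, tensor K T T] w1 \<otimes> w2 \<in> comult W w.
                tens K T T (tens K V W v1 w1) (tens K V W v2 w2)),
     counit = (\<lambda>t. \<Oplus>[K, base_space K] v \<otimes> w \<in> t. counit V v \<otimes>\<^bsub>K\<^esub> counit W w)\<rparr>)"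

locale bialgebra = assoc_algebra K H + coalgebra K H
  for K (structure) and H (structure) +
  assumes comult_one: "comult H \<one>\<^bsub>H\<^esub> = \<one>\<^bsub>tensor_coalg K H H\<^esub>"
    and comult_mult: "\<lbrakk>x \<in> carrier H; y \<in> carrier H\<rbrakk>
      \<Longrightarrow> comult H (x \<otimes>\<^bsub>H\<^esub> y) = comult H x \<otimes>\<^bsub>tensor_coalg K H H\<^esub> comult H y"
    and counit_one: "counit H \<one>\<^bsub>H\<^esub> = \<one>\<^bsub>K\<^esub>"
    and counit_mult: "\<lbrakk>x \<in> carrier H; y \<in> carrier H\<rbrakk>
      \<Longrightarrow> counit H (x \<otimes>\<^bsub>H\<^esub> y) = counit H x \<otimes>\<^bsub>K\<^esub> counit H y"

definition bialgebra_iso ::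
  "('k, 'm) ring_scheme \<Rightarrow> ('k, 'v, 'm1) coalg_scheme \<Rightarrow> ('k, 'w, 'm2) coalg_scheme
    \<Rightarrow> ('v \<Rightarrow> 'w) \<Rightarrow> bool" where
  "bialgebra_iso K X Y f \<longleftrightarrow> bialgebra K X \<and> bialgebra K Y
    \<and> linear_map K X Y f \<and> bij_betw f (carrier X) (carrier Y)
    \<and> f \<one>\<^bsub>X\<^esub> = \<one>\<^bsub>Y\<^esub>
    \<and> (\<forall>x\<in>carrier X. \<forall>y\<in>carrier X. f (x \<otimes>\<^bsub>X\<^esub> y) = f x \<otimes>\<^bsub>Y\<^esub> f y)
    \<and> (\<forall>x\<in>carrier X. comult Y (f x)
          = (\<Oplus>[K, tensor K Y Y] x1 \<otimes> x2 \<in> comult X x. tens K Y Y (f x1) (f x2)))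
    \<and> (\<forall>x\<in>carrier X. counit Y (f x) = counit X x)"


section \<open>Modules and comodules over a bialgebra\<close>

locale left_module = H?: bialgebra K H + V: module K V
  for K (structure) and H (structure) and V (structure) and act :: "'h \<Rightarrow> 'v \<Rightarrow> 'v" +
  assumes act_bilinear: "bilinear_map K H V V act"
    and act_one: "v \<in> carrier V \<Longrightarrow> act \<one>\<^bsub>H\<^esub> v = v"
    and act_mult: "\<lbrakk>g \<in> carrier H; h \<in> carrier H; v \<in> carrier V\<rbrakk>
      \<Longrightarrow> act (g \<otimes>\<^bsub>H\<^esub> h) v = act g (act h v)"

locale right_module = H?: bialgebra K H + V: module K V
  for K (structure) and H (structure) and V (structure) and act :: "'v \<Rightarrow> 'h \<Rightarrow> 'v" +
  assumes act_bilinear: "bilinear_map K V H V act"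
    and act_one: "v \<in> carrier V \<Longrightarrow> act v \<one>\<^bsub>H\<^esub> = v"
    and act_mult: "\<lbrakk>g \<in> carrier H; h \<in> carrier H; v \<in> carrier V\<rbrakk>
      \<Longrightarrow> act v (g \<otimes>\<^bsub>H\<^esub> h) = act (act v g) h"

locale left_comodule = H?: bialgebra K H + V: module K V
  for K (structure) and H (structure) and V (structure)
    and coact :: "'v \<Rightarrow> ('h, 'v, 'k) tensor" +
  assumes coact_linear: "linear_map K V (tensor K H V) coact"
    and coact_coassoc: "v \<in> carrier V \<Longrightarrow>
      (\<Oplus>[K, tensor3 K H H V] h \<otimes> v' \<in> coact v.
        \<Oplus>[K, tensor3 K H H V] h1 \<otimes> h2 \<in> comult H h. tens3 K H H V h1 h2 v')
      = (\<Oplus>[K, tensor3 K H H V] h \<otimes> v' \<in> coact v.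
        \<Oplus>[K, tensor3 K H H V] g \<otimes> v'' \<in> coact v'. tens3 K H H V h g v'')"
    and coact_counit: "v \<in> carrier V \<Longrightarrow>
      (\<Oplus>[K, V] h \<otimes> v' \<in> coact v. counit H h \<odot>\<^bsub>V\<^esub> v') = v"

locale right_comodule = H?: bialgebra K H + V: module K V
  for K (structure) and H (structure) and V (structure)
    and coact :: "'v \<Rightarrow> ('v, 'h, 'k) tensor" +
  assumes coact_linear: "linear_map K V (tensor K V H) coact"
    and coact_coassoc: "v \<in> carrier V \<Longrightarrow>
      (\<Oplus>[K, tensor3 K V H H] v' \<otimes> h \<in> coact v.
        \<Oplus>[K, tensor3 K V H H] v'' \<otimes> g \<in> coact v'. tens3 K V H H v'' g h)
      = (\<Oplus>[K, tensor3 K V H H] v' \<otimes> h \<in> coact v.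
        \<Oplus>[K, tensor3 K V H H] h1 \<otimes> h2 \<in> comult H h. tens3 K V H H v' h1 h2)"
    and coact_counit: "v \<in> carrier V \<Longrightarrow>
      (\<Oplus>[K, V] v' \<otimes> h \<in> coact v. counit H h \<odot>\<^bsub>V\<^esub> v') = v"


section \<open>Left-left Yetter-Drinfeld modules\<close>

locale ll_yd_module = left_module K H V act + left_comodule K H V coact
  for K (structure) and H (structure) and V (structure) and act and coact +
  assumes yd_condition: "\<lbrakk>h \<in> carrier H; v \<in> carrier V\<rbrakk> \<Longrightarrow>
      (\<Oplus>[K, tensor K H V] h1 \<otimes> h2 \<in> comult H h.
        \<Oplus>[K, tensor K H V] g \<otimes> v' \<in> coact (act h1 v). tens K H V (g \<otimes>\<^bsub>H\<^esub> h2) v')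
      = (\<Oplus>[K, tensor K H V] h1 \<otimes> h2 \<in> comult H h.
        \<Oplus>[K, tensor K H V] g \<otimes> v' \<in> coact v. tens K H V (h1 \<otimes>\<^bsub>H\<^esub> g) (act h2 v'))"

definition ll_hom ::
  "('k, 'm) ring_scheme \<Rightarrow> ('k, 'h, 'm1) coalg_scheme
    \<Rightarrow> ('k, 'v, 'm2) module_scheme \<Rightarrow> ('h \<Rightarrow> 'v \<Rightarrow> 'v) \<Rightarrow> ('v \<Rightarrow> ('h, 'v, 'k) tensor)
    \<Rightarrow> ('k, 'w, 'm3) module_scheme \<Rightarrow> ('h \<Rightarrow> 'w \<Rightarrow> 'w) \<Rightarrow> ('w \<Rightarrow> ('h, 'w, 'k) tensor)
    \<Rightarrow> ('v \<Rightarrow> 'w) \<Rightarrow> bool" where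
  "ll_hom K H V actV coactV W actW coactW f \<longleftrightarrow> linear_map K V W f
    \<and> (\<forall>h\<in>carrier H. \<forall>v\<in>carrier V. f (actV h v) = actW h (f v))
    \<and> (\<forall>v\<in>carrier V. coactW (f v)
          = (\<Oplus>[K, tensor K H W] h \<otimes> v' \<in> coactV v. tens K H W h (f v')))"

definition ll_tensor_act where
  "ll_tensor_act K H V actV W actW h t =
    (\<Oplus>[K, tensor K V W] h1 \<otimes> h2 \<in> comult H h. \<Oplus>[K, tensor K V W] v \<otimes> w \<in> t.
      tens K V W (actV h1 v) (actW h2 w))"

definition ll_tensor_coact where
  "ll_tensor_coact K H V coactV W coactW t =
    (\<Oplus>[K, tensor3 K H V W] v \<otimes> w \<in> t.
      \<Oplus>[K, tensor3 K H V W] g \<otimes> v' \<in> coactV v. \<Oplus>[K, tensor3 K H V W] h \<otimes> w' \<in> coactW w.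
        tens3 K H V W (g \<otimes>\<^bsub>H\<^esub> h) v' w')"

definition ll_unit_act where
  "ll_unit_act K H h c = counit H h \<otimes>\<^bsub>K\<^esub> c"

definition ll_unit_coact where
  "ll_unit_coact K H c = tens K H (base_space K) \<one>\<^bsub>H\<^esub> c"

definition ll_braiding where
  "ll_braiding K V coactV W actW v w =
    (\<Oplus>[K, tensor K W V] h \<otimes> v' \<in> coactV v. tens K W V (actW h w) v')"

text \<open>
  Multiplication of \<open>A \<otimes> A\<close> in the braided category: multiply after exchanging the two inner
  tensor factors by the braiding.
\<close>

definition ll_braided_mult where
  "ll_braided_mult K A act coact s t = (let T = tensor K A A in
    (\<Oplus>[K, T] x \<otimes> y \<in> s. \<Oplus>[K, T] x' \<otimes> y' \<in> t.
      \<Oplus>[K, T] u \<otimes> v \<in> ll_braiding K A coact A act y x'.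
        tens K A A (x \<otimes>\<^bsub>A\<^esub> u) (v \<otimes>\<^bsub>A\<^esub> y')))"

locale ll_yd_bialgebra =
  ll_yd_module K H A act coact + A: assoc_algebra K A + A: coalgebra K A
  for K (structure) and H (structure) and A (structure) and act and coact +
  assumes mult_hom: "ll_hom K H
        (tensor K A A) (ll_tensor_act K H A act A act) (ll_tensor_coact K H A coact A coact)
        A act coact (\<lambda>t. \<Oplus>[K, A] a \<otimes> b \<in> t. a \<otimes>\<^bsub>A\<^esub> b)"
    and unit_hom: "ll_hom K H (base_space K) (ll_unit_act K H) (ll_unit_coact K H)
        A act coact (\<lambda>c. c \<odot>\<^bsub>A\<^esub> \<one>\<^bsub>A\<^esub>)"
    and comult_hom: "ll_hom K H A act coact
        (tensor K A A) (ll_tensor_act K H A act A act) (ll_tensor_coact K H A coact A coact)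
        (comult A)"
    and counit_hom: "ll_hom K H A act coact
        (base_space K) (ll_unit_act K H) (ll_unit_coact K H) (counit A)"
    and braided_comult_one: "comult A \<one>\<^bsub>A\<^esub> = tens K A A \<one>\<^bsub>A\<^esub> \<one>\<^bsub>A\<^esub>"
    and braided_comult_mult: "\<lbrakk>a \<in> carrier A; b \<in> carrier A\<rbrakk> \<Longrightarrow>
        comult A (a \<otimes>\<^bsub>A\<^esub> b) = ll_braided_mult K A act coact (comult A a) (comult A b)"
    and braided_counit_one: "counit A \<one>\<^bsub>A\<^esub> = \<one>\<^bsub>K\<^esub>"
    and braided_counit_mult: "\<lbrakk>a \<in> carrier A; b \<in> carrier A\<rbrakk> \<Longrightarrow>
        counit A (a \<otimes>\<^bsub>A\<^esub> b) = counit A a \<otimes>\<^bsub>K\<^esub> counit A b"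


section \<open>Right-right Yetter-Drinfeld modules\<close>

locale rr_yd_module = right_module K H V act + right_comodule K H V coact
  for K (structure) and H (structure) and V (structure) and act and coact +
  assumes yd_condition: "\<lbrakk>h \<in> carrier H; w \<in> carrier V\<rbrakk> \<Longrightarrow>
      (\<Oplus>[K, tensor K V H] h1 \<otimes> h2 \<in> comult H h.
        \<Oplus>[K, tensor K V H] w' \<otimes> g \<in> coact (act w h2). tens K V H w' (h1 \<otimes>\<^bsub>H\<^esub> g))
      = (\<Oplus>[K, tensor K V H] h1 \<otimes> h2 \<in> comult H h.
        \<Oplus>[K, tensor K V H] w' \<otimes> g \<in> coact w. tens K V H (act w' h1) (g \<otimes>\<^bsub>H\<^esub> h2))"

definition rr_hom ::
  "('k, 'm) ring_scheme \<Rightarrow> ('k, 'h, 'm1) coalg_scheme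
    \<Rightarrow> ('k, 'v, 'm2) module_scheme \<Rightarrow> ('v \<Rightarrow> 'h \<Rightarrow> 'v) \<Rightarrow> ('v \<Rightarrow> ('v, 'h, 'k) tensor)
    \<Rightarrow> ('k, 'w, 'm3) module_scheme \<Rightarrow> ('w \<Rightarrow> 'h \<Rightarrow> 'w) \<Rightarrow> ('w \<Rightarrow> ('w, 'h, 'k) tensor)
    \<Rightarrow> ('v \<Rightarrow> 'w) \<Rightarrow> bool" where
  "rr_hom K H V actV coactV W actW coactW f \<longleftrightarrow> linear_map K V W f
    \<and> (\<forall>h\<in>carrier H. \<forall>v\<in>carrier V. f (actV v h) = actW (f v) h)
    \<and> (\<forall>v\<in>carrier V. coactW (f v)
          = (\<Oplus>[K, tensor K W H] v' \<otimes> h \<in> coactV v. tens K W H (f v') h))"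

definition rr_tensor_act where
  "rr_tensor_act K H V actV W actW t h =
    (\<Oplus>[K, tensor K V W] v \<otimes> w \<in> t. \<Oplus>[K, tensor K V W] h1 \<otimes> h2 \<in> comult H h.
      tens K V W (actV v h1) (actW w h2))"

text \<open>Values in \<open>(V \<otimes> W) \<otimes> H\<close>, so that this is a right coaction on \<open>V \<otimes> W\<close>.\<close>

definition rr_tensor_coact where
  "rr_tensor_coact K H V coactV W coactW t = (let T = tensor K V W in
    (\<Oplus>[K, tensor K T H] v \<otimes> w \<in> t.
      \<Oplus>[K, tensor K T H] v' \<otimes> g \<in> coactV v. \<Oplus>[K, tensor K T H] w' \<otimes> h \<in> coactW w.
        tens K T H (tens K V W v' w') (g \<otimes>\<^bsub>H\<^esub> h)))"

definition rr_unit_act where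
  "rr_unit_act K H c h = c \<otimes>\<^bsub>K\<^esub> counit H h"

definition rr_unit_coact where
  "rr_unit_coact K H c = tens K (base_space K) H c \<one>\<^bsub>H\<^esub>"

definition rr_braiding where
  "rr_braiding K V actV W coactW v w =
    (\<Oplus>[K, tensor K W V] w' \<otimes> h \<in> coactW w. tens K W V w' (actV v h))"

definition rr_braided_mult where
  "rr_braided_mult K B act coact s t = (let T = tensor K B B in
    (\<Oplus>[K, T] x \<otimes> y \<in> s. \<Oplus>[K, T] x' \<otimes> y' \<in> t.
      \<Oplus>[K, T] u \<otimes> v \<in> rr_braiding K B act B coact y x'.
        tens K B B (x \<otimes>\<^bsub>B\<^esub> u) (v \<otimes>\<^bsub>B\<^esub> y')))"

locale rr_yd_bialgebra =
  rr_yd_module K H B act coact + B: assoc_algebra K B + B: coalgebra K B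
  for K (structure) and H (structure) and B (structure) and act and coact +
  assumes mult_hom: "rr_hom K H
        (tensor K B B) (rr_tensor_act K H B act B act) (rr_tensor_coact K H B coact B coact)
        B act coact (\<lambda>t. \<Oplus>[K, B] a \<otimes> b \<in> t. a \<otimes>\<^bsub>B\<^esub> b)"
    and unit_hom: "rr_hom K H (base_space K) (rr_unit_act K H) (rr_unit_coact K H)
        B act coact (\<lambda>c. c \<odot>\<^bsub>B\<^esub> \<one>\<^bsub>B\<^esub>)"
    and comult_hom: "rr_hom K H B act coact
        (tensor K B B) (rr_tensor_act K H B act B act) (rr_tensor_coact K H B coact B coact)
        (comult B)"
    and counit_hom: "rr_hom K H B act coact
        (base_space K) (rr_unit_act K H) (rr_unit_coact K H) (counit B)"
    and braided_comult_one: "comult B \<one>\<^bsub>B\<^esub> = tens K B B \<one>\<^bsub>B\<^esub> \<one>\<^bsub>B\<^esub>"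
    and braided_comult_mult: "\<lbrakk>a \<in> carrier B; b \<in> carrier B\<rbrakk> \<Longrightarrow>
        comult B (a \<otimes>\<^bsub>B\<^esub> b) = rr_braided_mult K B act coact (comult B a) (comult B b)"
    and braided_counit_one: "counit B \<one>\<^bsub>B\<^esub> = \<one>\<^bsub>K\<^esub>"
    and braided_counit_mult: "\<lbrakk>a \<in> carrier B; b \<in> carrier B\<rbrakk> \<Longrightarrow>
        counit B (a \<otimes>\<^bsub>B\<^esub> b) = counit B a \<otimes>\<^bsub>K\<^esub> counit B b"


section \<open>The double biproduct\<close>

text \<open>The underlying space of \<open>A # H # B\<close> is \<open>A \<otimes> (H \<otimes> B)\<close>.\<close>

definition double_biproduct ::
  "('k, 'm) ring_scheme \<Rightarrow> ('k, 'h, 'm1) coalg_scheme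
    \<Rightarrow> ('k, 'a, 'm2) coalg_scheme \<Rightarrow> ('h \<Rightarrow> 'a \<Rightarrow> 'a) \<Rightarrow> ('a \<Rightarrow> ('h, 'a, 'k) tensor)
    \<Rightarrow> ('k, 'b, 'm3) coalg_scheme \<Rightarrow> ('b \<Rightarrow> 'h \<Rightarrow> 'b) \<Rightarrow> ('b \<Rightarrow> ('b, 'h, 'k) tensor)
    \<Rightarrow> ('k, ('a, ('h, 'b, 'k) tensor, 'k) tensor) coalg" where
  "double_biproduct K H A actA coactA B actB coactB =
    (let T = tensor3 K A H B; TT = tensor K T T in
    \<lparr>carrier = carrier T,
     mult = (\<lambda>s t. \<Oplus>[K, T] a \<otimes> u \<in> s. \<Oplus>[K, T] h \<otimes> b \<in> u.
              \<Oplus>[K, T] a' \<otimes> u' \<in> t. \<Oplus>[K, T] h' \<otimes> b' \<in> u'.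
              \<Oplus>[K, T] h1 \<otimes> h2 \<in> comult H h. \<Oplus>[K, T] h1' \<otimes> h2' \<in> comult H h'.
                tens3 K A H B (a \<otimes>\<^bsub>A\<^esub> actA h1 a') (h2 \<otimes>\<^bsub>H\<^esub> h1') (actB b h2' \<otimes>\<^bsub>B\<^esub> b')),
     one = tens3 K A H B \<one>\<^bsub>A\<^esub> \<one>\<^bsub>H\<^esub> \<one>\<^bsub>B\<^esub>,
     zero = zero T, add = add T, smult = smult T,
     comult = (\<lambda>t. \<Oplus>[K, TT] a \<otimes> u \<in> t. \<Oplus>[K, TT] h \<otimes> b \<in> u.
              \<Oplus>[K, TT] a1 \<otimes> a2 \<in> comult A a. \<Oplus>[K, TT] h1 \<otimes> h2 \<in> comult H h.
              \<Oplus>[K, TT] b1 \<otimes> b2 \<in> comult B b.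
              \<Oplus>[K, TT] a21 \<otimes> a22 \<in> coactA a2. \<Oplus>[K, TT] b11 \<otimes> b12 \<in> coactB b1.
                tens K T T (tens3 K A H B a1 (a21 \<otimes>\<^bsub>H\<^esub> h1) b11)
                           (tens3 K A H B a22 (h2 \<otimes>\<^bsub>H\<^esub> b12) b2)),
     counit = (\<lambda>t. \<Oplus>[K, base_space K] a \<otimes> u \<in> t. \<Oplus>[K, base_space K] h \<otimes> b \<in> u.
                counit A a \<otimes>\<^bsub>K\<^esub> counit H h \<otimes>\<^bsub>K\<^esub> counit B b)\<rparr>)"


section \<open>L-R-admissible pairs and the L-R-smash biproduct\<close>

locale lr_admissible =
  H?: bialgebra K H +
  D: assoc_algebra K D + D: coalgebra K D +
  lmod: left_module K H D lact + rmod: right_module K H D ract +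
  lcomod: left_comodule K H D lcoact + rcomod: right_comodule K H D rcoact
  for K (structure) and H (structure) and D (structure)
    and lact :: "'h \<Rightarrow> 'd \<Rightarrow> 'd" (infixr \<open>\<cdot>\<^sub>l\<close> 75)
    and ract :: "'d \<Rightarrow> 'h \<Rightarrow> 'd" (infixl \<open>\<cdot>\<^sub>r\<close> 75)
    and lcoact :: "'d \<Rightarrow> ('h, 'd, 'k) tensor"
    and rcoact :: "'d \<Rightarrow> ('d, 'h, 'k) tensor" +
  assumes bimodule: "\<lbrakk>g \<in> carrier H; h \<in> carrier H; d \<in> carrier D\<rbrakk>
      \<Longrightarrow> (g \<cdot>\<^sub>l d) \<cdot>\<^sub>r h = g \<cdot>\<^sub>l (d \<cdot>\<^sub>r h)"
    and lact_unit: "h \<in> carrier H \<Longrightarrow> h \<cdot>\<^sub>l \<one>\<^bsub>D\<^esub> = counit H h \<odot>\<^bsub>D\<^esub> \<one>\<^bsub>D\<^esub>"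
    and ract_unit: "h \<in> carrier H \<Longrightarrow> \<one>\<^bsub>D\<^esub> \<cdot>\<^sub>r h = counit H h \<odot>\<^bsub>D\<^esub> \<one>\<^bsub>D\<^esub>"
    and lact_prod: "\<lbrakk>h \<in> carrier H; c \<in> carrier D; d \<in> carrier D\<rbrakk> \<Longrightarrow>
      h \<cdot>\<^sub>l (c \<otimes>\<^bsub>D\<^esub> d) = (\<Oplus>[K, D] h1 \<otimes> h2 \<in> comult H h. (h1 \<cdot>\<^sub>l c) \<otimes>\<^bsub>D\<^esub> (h2 \<cdot>\<^sub>l d))"
    and ract_prod: "\<lbrakk>h \<in> carrier H; c \<in> carrier D; d \<in> carrier D\<rbrakk> \<Longrightarrow>
      (c \<otimes>\<^bsub>D\<^esub> d) \<cdot>\<^sub>r h = (\<Oplus>[K, D] h1 \<otimes> h2 \<in> comult H h. (c \<cdot>\<^sub>r h1) \<otimes>\<^bsub>D\<^esub> (d \<cdot>\<^sub>r h2))"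
    and bicomodule: "d \<in> carrier D \<Longrightarrow>
      (\<Oplus>[K, tensor3 K H D H] d' \<otimes> h \<in> rcoact d.
        \<Oplus>[K, tensor3 K H D H] g \<otimes> d'' \<in> lcoact d'. tens3 K H D H g d'' h)
      = (\<Oplus>[K, tensor3 K H D H] g \<otimes> d' \<in> lcoact d.
        \<Oplus>[K, tensor3 K H D H] d'' \<otimes> h \<in> rcoact d'. tens3 K H D H g d'' h)"
    and lcoact_comult: "d \<in> carrier D \<Longrightarrow>
      (\<Oplus>[K, tensor3 K H D D] d1 \<otimes> d2 \<in> comult D d.
        \<Oplus>[K, tensor3 K H D D] g \<otimes> d1' \<in> lcoact d1. \<Oplus>[K, tensor3 K H D D] h \<otimes> d2' \<in> lcoact d2.
          tens3 K H D D (g \<otimes>\<^bsub>H\<^esub> h) d1' d2')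
      = (\<Oplus>[K, tensor3 K H D D] h \<otimes> d' \<in> lcoact d.
        \<Oplus>[K, tensor3 K H D D] d1 \<otimes> d2 \<in> comult D d'. tens3 K H D D h d1 d2)"
    and lcoact_counit: "d \<in> carrier D \<Longrightarrow>
      (\<Oplus>[K, H] h \<otimes> d' \<in> lcoact d. counit D d' \<odot>\<^bsub>H\<^esub> h) = counit D d \<odot>\<^bsub>H\<^esub> \<one>\<^bsub>H\<^esub>"
    and rcoact_comult: "d \<in> carrier D \<Longrightarrow>
      (\<Oplus>[K, tensor3 K D D H] d1 \<otimes> d2 \<in> comult D d.
        \<Oplus>[K, tensor3 K D D H] d1' \<otimes> g \<in> rcoact d1. \<Oplus>[K, tensor3 K D D H] d2' \<otimes> h \<in> rcoact d2.
          tens3 K D D H d1' d2' (g \<otimes>\<^bsub>H\<^esub> h))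
      = (\<Oplus>[K, tensor3 K D D H] d' \<otimes> h \<in> rcoact d.
        \<Oplus>[K, tensor3 K D D H] d1 \<otimes> d2 \<in> comult D d'. tens3 K D D H d1 d2 h)"
    and rcoact_counit: "d \<in> carrier D \<Longrightarrow>
      (\<Oplus>[K, H] d' \<otimes> h \<in> rcoact d. counit D d' \<odot>\<^bsub>H\<^esub> h) = counit D d \<odot>\<^bsub>H\<^esub> \<one>\<^bsub>H\<^esub>"
    and counit_D_one: "counit D \<one>\<^bsub>D\<^esub> = \<one>\<^bsub>K\<^esub>"
    and counit_D_mult: "\<lbrakk>c \<in> carrier D; d \<in> carrier D\<rbrakk>
      \<Longrightarrow> counit D (c \<otimes>\<^bsub>D\<^esub> d) = counit D c \<otimes>\<^bsub>K\<^esub> counit D d"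
    and counit_D_lact: "\<lbrakk>h \<in> carrier H; d \<in> carrier D\<rbrakk>
      \<Longrightarrow> counit D (h \<cdot>\<^sub>l d) = counit D d \<otimes>\<^bsub>K\<^esub> counit H h"
    and counit_D_ract: "\<lbrakk>h \<in> carrier H; d \<in> carrier D\<rbrakk>
      \<Longrightarrow> counit D (d \<cdot>\<^sub>r h) = counit D d \<otimes>\<^bsub>K\<^esub> counit H h"
    and rcoact_one: "rcoact \<one>\<^bsub>D\<^esub> = tens K D H \<one>\<^bsub>D\<^esub> \<one>\<^bsub>H\<^esub>"
    and lcoact_one: "lcoact \<one>\<^bsub>D\<^esub> = tens K H D \<one>\<^bsub>H\<^esub> \<one>\<^bsub>D\<^esub>"
    and comult_D_one: "comult D \<one>\<^bsub>D\<^esub> = tens K D D \<one>\<^bsub>D\<^esub> \<one>\<^bsub>D\<^esub>"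
    and rcoact_mult: "\<lbrakk>c \<in> carrier D; d \<in> carrier D\<rbrakk> \<Longrightarrow>
      rcoact (c \<otimes>\<^bsub>D\<^esub> d)
      = (\<Oplus>[K, tensor K D H] c' \<otimes> g \<in> rcoact c. \<Oplus>[K, tensor K D H] d' \<otimes> h \<in> rcoact d.
          tens K D H (c' \<otimes>\<^bsub>D\<^esub> d') (g \<otimes>\<^bsub>H\<^esub> h))"
    and lcoact_mult: "\<lbrakk>c \<in> carrier D; d \<in> carrier D\<rbrakk> \<Longrightarrow>
      lcoact (c \<otimes>\<^bsub>D\<^esub> d)
      = (\<Oplus>[K, tensor K H D] g \<otimes> c' \<in> lcoact c. \<Oplus>[K, tensor K H D] h \<otimes> d' \<in> lcoact d.
          tens K H D (g \<otimes>\<^bsub>H\<^esub> h) (c' \<otimes>\<^bsub>D\<^esub> d'))"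
    and comult_D_lact: "\<lbrakk>h \<in> carrier H; d \<in> carrier D\<rbrakk> \<Longrightarrow>
      comult D (h \<cdot>\<^sub>l d)
      = (\<Oplus>[K, tensor K D D] h1 \<otimes> h2 \<in> comult H h. \<Oplus>[K, tensor K D D] d1 \<otimes> d2 \<in> comult D d.
          tens K D D (h1 \<cdot>\<^sub>l d1) (h2 \<cdot>\<^sub>l d2))"
    and comult_D_ract: "\<lbrakk>h \<in> carrier H; d \<in> carrier D\<rbrakk> \<Longrightarrow>
      comult D (d \<cdot>\<^sub>r h)
      = (\<Oplus>[K, tensor K D D] d1 \<otimes> d2 \<in> comult D d. \<Oplus>[K, tensor K D D] h1 \<otimes> h2 \<in> comult H h.
          tens K D D (d1 \<cdot>\<^sub>r h1) (d2 \<cdot>\<^sub>r h2))"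
    and comult_D_mult: "\<lbrakk>c \<in> carrier D; d \<in> carrier D\<rbrakk> \<Longrightarrow>
      comult D (c \<otimes>\<^bsub>D\<^esub> d)
      = (\<Oplus>[K, tensor K D D] c1 \<otimes> c2 \<in> comult D c. \<Oplus>[K, tensor K D D] d1 \<otimes> d2 \<in> comult D d.
          \<Oplus>[K, tensor K D D] g \<otimes> c2' \<in> lcoact c2. \<Oplus>[K, tensor K D D] d1' \<otimes> h \<in> rcoact d1.
            tens K D D (c1 \<otimes>\<^bsub>D\<^esub> (g \<cdot>\<^sub>l d1')) ((c2' \<cdot>\<^sub>r h) \<otimes>\<^bsub>D\<^esub> d2))"
    and lcoact_lact: "\<lbrakk>h \<in> carrier H; d \<in> carrier D\<rbrakk> \<Longrightarrow>
      (\<Oplus>[K, tensor K H D] h1 \<otimes> h2 \<in> comult H h. \<Oplus>[K, tensor K H D] g \<otimes> d' \<in> lcoact (h1 \<cdot>\<^sub>l d).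
        tens K H D (g \<otimes>\<^bsub>H\<^esub> h2) d')
      = (\<Oplus>[K, tensor K H D] h1 \<otimes> h2 \<in> comult H h. \<Oplus>[K, tensor K H D] g \<otimes> d' \<in> lcoact d.
        tens K H D (h1 \<otimes>\<^bsub>H\<^esub> g) (h2 \<cdot>\<^sub>l d'))"
    and rcoact_lact: "\<lbrakk>h \<in> carrier H; d \<in> carrier D\<rbrakk> \<Longrightarrow>
      rcoact (h \<cdot>\<^sub>l d) = (\<Oplus>[K, tensor K D H] d' \<otimes> g \<in> rcoact d. tens K D H (h \<cdot>\<^sub>l d') g)"
    and rcoact_ract: "\<lbrakk>h \<in> carrier H; d \<in> carrier D\<rbrakk> \<Longrightarrow>
      (\<Oplus>[K, tensor K D H] h1 \<otimes> h2 \<in> comult H h. \<Oplus>[K, tensor K D H] d' \<otimes> g \<in> rcoact (d \<cdot>\<^sub>r h2).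
        tens K D H d' (h1 \<otimes>\<^bsub>H\<^esub> g))
      = (\<Oplus>[K, tensor K D H] h1 \<otimes> h2 \<in> comult H h. \<Oplus>[K, tensor K D H] d' \<otimes> g \<in> rcoact d.
        tens K D H (d' \<cdot>\<^sub>r h1) (g \<otimes>\<^bsub>H\<^esub> h2))"
    and lcoact_ract: "\<lbrakk>h \<in> carrier H; d \<in> carrier D\<rbrakk> \<Longrightarrow>
      lcoact (d \<cdot>\<^sub>r h) = (\<Oplus>[K, tensor K H D] g \<otimes> d' \<in> lcoact d. tens K H D g (d' \<cdot>\<^sub>r h))"
    and trivial_exchange: "\<lbrakk>c \<in> carrier D; d \<in> carrier D\<rbrakk> \<Longrightarrow>
      (\<Oplus>[K, tensor K D D] c' \<otimes> h \<in> rcoact c. \<Oplus>[K, tensor K D D] g \<otimes> d' \<in> lcoact d.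
        tens K D D (c' \<cdot>\<^sub>r g) (h \<cdot>\<^sub>l d'))
      = tens K D D c d"

definition lr_smash_biproduct ::
  "('k, 'm) ring_scheme \<Rightarrow> ('k, 'h, 'm1) coalg_scheme \<Rightarrow> ('k, 'd, 'm2) coalg_scheme
    \<Rightarrow> ('h \<Rightarrow> 'd \<Rightarrow> 'd) \<Rightarrow> ('d \<Rightarrow> 'h \<Rightarrow> 'd)
    \<Rightarrow> ('d \<Rightarrow> ('h, 'd, 'k) tensor) \<Rightarrow> ('d \<Rightarrow> ('d, 'h, 'k) tensor)
    \<Rightarrow> ('k, ('d, 'h, 'k) tensor) coalg" where
  "lr_smash_biproduct K H D lact ract lcoact rcoact =
    (let T = tensor K D H; TT = tensor K T T in
    \<lparr>carrier = carrier T,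
     mult = (\<lambda>s t. \<Oplus>[K, T] d \<otimes> h \<in> s. \<Oplus>[K, T] d' \<otimes> h' \<in> t.
              \<Oplus>[K, T] h1 \<otimes> h2 \<in> comult H h. \<Oplus>[K, T] h1' \<otimes> h2' \<in> comult H h'.
                tens K D H (ract d h2' \<otimes>\<^bsub>D\<^esub> lact h1 d') (h2 \<otimes>\<^bsub>H\<^esub> h1')),
     one = tens K D H \<one>\<^bsub>D\<^esub> \<one>\<^bsub>H\<^esub>,
     zero = zero T, add = add T, smult = smult T,
     comult = (\<lambda>t. \<Oplus>[K, TT] d \<otimes> h \<in> t.
              \<Oplus>[K, TT] d1 \<otimes> d2 \<in> comult D d. \<Oplus>[K, TT] h1 \<otimes> h2 \<in> comult H h.
              \<Oplus>[K, TT] d1' \<otimes> g \<in> rcoact d1. \<Oplus>[K, TT] g' \<otimes> d2' \<in> lcoact d2.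
                tens K T T (tens K D H d1' (g' \<otimes>\<^bsub>H\<^esub> h1)) (tens K D H d2' (h2 \<otimes>\<^bsub>H\<^esub> g))),
     counit = (\<lambda>t. \<Oplus>[K, base_space K] d \<otimes> h \<in> t. counit D d \<otimes>\<^bsub>K\<^esub> counit H h)\<rparr>)"


section \<open>Actions and coactions on \<open>A \<otimes> B\<close>\<close>

definition prod_lact where
  "prod_lact K A actA B h d = (\<Oplus>[K, tensor K A B] a \<otimes> b \<in> d. tens K A B (actA h a) b)"

definition prod_ract where
  "prod_ract K A B actB d h = (\<Oplus>[K, tensor K A B] a \<otimes> b \<in> d. tens K A B a (actB b h))"

definition prod_lcoact where
  "prod_lcoact K H A coactA B d = (let D = tensor K A B in
    (\<Oplus>[K, tensor K H D] a \<otimes> b \<in> d. \<Oplus>[K, tensor K H D] h \<otimes> a' \<in> coactA a.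
      tens K H D h (tens K A B a' b)))"

definition prod_rcoact where
  "prod_rcoact K H A B coactB d = (let D = tensor K A B in
    (\<Oplus>[K, tensor K D H] a \<otimes> b \<in> d. \<Oplus>[K, tensor K D H] b' \<otimes> h \<in> coactB b.
      tens K D H (tens K A B a b') h))"

definition smash_to_double where
  "smash_to_double K H A B t =
    (\<Oplus>[K, tensor3 K A H B] d \<otimes> h \<in> t. \<Oplus>[K, tensor3 K A H B] a \<otimes> b \<in> d. tens3 K A H B a h b)"

end

theory Submission
  imports Defs
begin

text \<open>
  The two biproducts live on the same space up to the reordering \<open>\<phi>\<close> of the tensor factors, and
  \<open>\<phi>\<close> matches their structure maps on pure tensors; so it is enough to prove that \<open>A # H # B\<close> is a
  bialgebra and to transport this along \<open>\<phi>\<close>.  An identity between tensors is used as the family of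
  identities between the sums \<open>\<Sum> F (t\<^sub>1, t\<^sub>2, \<dots>)\<close> for all multilinear \<open>F\<close>; such identities can be
  applied inside larger sums, and sums over independent tensors commute.  In this form,
  \<open>\<Delta> (x y) = \<Delta> x \<Delta> y\<close> on \<open>A # H # B\<close> splits into an identity about \<open>A\<close> and \<open>H\<close> (braided
  multiplicativity, then the Yetter-Drinfeld condition), its mirror image for \<open>B\<close> and \<open>H\<close>, and one
  use of the triviality of the pairing to uncross the middle factors.  Coassociativity splits in the
  same way, and the axioms of an L-R-admissible pair for \<open>A \<otimes> B\<close> reduce on pure tensors to
  axioms for \<open>A\<close> and \<open>B\<close>.
\<close>

section \<open>The tensor product of modules\<close>

text \<open>A tensor is a coset, and \<open>sweedler\<close> evaluates its body at a representative
  picked by choice; it is well behaved only when the body is bilinear and all arguments lie in the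
  carriers. Under a dozen nested sums, checking this by hand at every step would swamp the algebra.
  Three devices keep it out of sight: sums that are total outside the carriers, closure and
  linearity facts in the simp set that match the shape of the body, and a congruence rule that
  passes carrier membership of the legs into the body. Exchange of independent sums would loop as a
  rewrite rule; numeric keys orient it. A long computation therefore alternates between a form with
  keys, which fixes the order wanted next, and a step that applies one structural law to an adjacent
  block of sums. The bialgebra axioms are checked on A # H # B because there the legs of a, h and b
  are separate sums from the outset, while in the L-R-smash biproduct every leg of D would have to
  be split into its A- and B-parts.\<close>

lemma linear_mapI:
  assumes "\<And>x. x \<in> carrier V \<Longrightarrow> f x \<in> carrier W"
    and "\<And>x y. \<lbrakk>x \<in> carrier V; y \<in> carrier V\<rbrakk> \<Longrightarrow> f (x \<oplus>\<^bsub>V\<^esub> y) = f x \<oplus>\<^bsub>W\<^esub> f y"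
    and "\<And>c x. \<lbrakk>c \<in> carrier K; x \<in> carrier V\<rbrakk> \<Longrightarrow> f (c \<odot>\<^bsub>V\<^esub> x) = c \<odot>\<^bsub>W\<^esub> f x"
  shows "linear_map K V W f"
  using assms by (auto simp: linear_map_def)

lemma linear_mapD:
  assumes "linear_map K V W f"
  shows linear_map_closed: "x \<in> carrier V \<Longrightarrow> f x \<in> carrier W"
    and linear_map_add: "\<lbrakk>x \<in> carrier V; y \<in> carrier V\<rbrakk> \<Longrightarrow> f (x \<oplus>\<^bsub>V\<^esub> y) = f x \<oplus>\<^bsub>W\<^esub> f y"
    and linear_map_smult: "\<lbrakk>c \<in> carrier K; x \<in> carrier V\<rbrakk> \<Longrightarrow> f (c \<odot>\<^bsub>V\<^esub> x) = c \<odot>\<^bsub>W\<^esub> f x"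
  using assms by (auto simp: linear_map_def)

lemma linear_map_comp:
  assumes "linear_map K V W g" and "linear_map K U V f"
  shows "linear_map K U W (\<lambda>x. g (f x))"
  using assms by (auto simp: linear_map_def Pi_iff)

lemma linear_map_zero:
  assumes "module K V" "module K W" "linear_map K V W f"
  shows "f \<zero>\<^bsub>V\<^esub> = \<zero>\<^bsub>W\<^esub>"
proof -
  interpret V: module K V by fact
  interpret W: module K W by fact
  have "f (\<zero>\<^bsub>K\<^esub> \<odot>\<^bsub>V\<^esub> \<zero>\<^bsub>V\<^esub>) = \<zero>\<^bsub>K\<^esub> \<odot>\<^bsub>W\<^esub> f \<zero>\<^bsub>V\<^esub>"
    by (rule linear_map_smult[OF assms(3)]) auto
  then show ?thesis
    using linear_map_closed[OF assms(3), of "\<zero>\<^bsub>V\<^esub>"] by simp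
qed

lemma bilinear_map_closed:
  "\<lbrakk>bilinear_map K U V W f; u \<in> carrier U; v \<in> carrier V\<rbrakk> \<Longrightarrow> f u v \<in> carrier W"
  using linear_map_closed[of K V W "f u"] by (simp add: bilinear_map_def)

lemma linear_map_finsum:
  assumes "module K V" "module K W" "linear_map K V W g"
    and "finite S" "f \<in> S \<rightarrow> carrier V"
  shows "g (finsum V f S) = (\<Oplus>\<^bsub>W\<^esub> x \<in> S. g (f x))"
proof -
  interpret V: module K V by fact
  interpret W: module K W by fact
  note g = linear_mapD[OF assms(3)]
  from assms(4,5) show ?thesis
    by (induction S rule: finite_induct)
      (auto simp: linear_map_zero[OF assms(1-3)] g Pi_iff)
qed

subsection \<open>Free spaces\<close>

lemma free_space_simps [simp]:
  "zero (free_space K X) = (\<lambda>x. \<zero>\<^bsub>K\<^esub>)"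
  "add (free_space K X) p q = (\<lambda>x. p x \<oplus>\<^bsub>K\<^esub> q x)"
  "smult (free_space K X) c p = (\<lambda>x. c \<otimes>\<^bsub>K\<^esub> p x)"
  by (simp_all add: free_space_def)

lemma mem_free_space:
  "p \<in> carrier (free_space K X) \<longleftrightarrow>
    (\<forall>x. p x \<in> carrier K) \<and> {x. p x \<noteq> \<zero>\<^bsub>K\<^esub>} \<subseteq> X \<and> finite {x. p x \<noteq> \<zero>\<^bsub>K\<^esub>}"
  by (simp add: free_space_def)

lemma (in cring) free_space_closed:
  assumes "p \<in> carrier (free_space R X)" "\<And>x. q x \<in> carrier R" "\<And>x. p x = \<zero> \<Longrightarrow> q x = \<zero>"
  shows "q \<in> carrier (free_space R X)"
proof -
  have "{x. q x \<noteq> \<zero>} \<subseteq> {x. p x \<noteq> \<zero>}" using assms(3) by auto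
  with assms(1,2) show ?thesis by (auto simp: mem_free_space intro: finite_subset)
qed

lemma (in cring) module_free_space: "module R (free_space R X)"
proof (rule moduleI)
  show "cring R" by (rule is_cring)
  show "abelian_group (free_space R X)"
  proof (rule abelian_groupI)
    fix p q assume pq: "p \<in> carrier (free_space R X)" "q \<in> carrier (free_space R X)"
    have "{x. p x \<oplus> q x \<noteq> \<zero>} \<subseteq> {x. p x \<noteq> \<zero>} \<union> {x. q x \<noteq> \<zero>}" by auto
    with pq show "p \<oplus>\<^bsub>free_space R X\<^esub> q \<in> carrier (free_space R X)"
      by (auto simp: mem_free_space intro: finite_subset)
  next
    fix p assume p: "p \<in> carrier (free_space R X)"
    have "(\<lambda>x. \<ominus> p x) \<in> carrier (free_space R X)"
      by (rule free_space_closed[OF p]) (use p in \<open>auto simp: mem_free_space\<close>)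
    then show "\<exists>q\<in>carrier (free_space R X). q \<oplus>\<^bsub>free_space R X\<^esub> p = \<zero>\<^bsub>free_space R X\<^esub>"
      using p by (intro bexI[of _ "\<lambda>x. \<ominus> p x"]) (auto simp: mem_free_space l_neg)
  qed (auto simp: mem_free_space a_ac)
  fix c p assume cp: "c \<in> carrier R" "p \<in> carrier (free_space R X)"
  then show "c \<odot>\<^bsub>free_space R X\<^esub> p \<in> carrier (free_space R X)"
    by (intro free_space_closed[OF cp(2)]) (auto simp: mem_free_space)
qed (auto simp: mem_free_space l_distr r_distr m_assoc)

lemma (in cring) basis_vec_closed: "x \<in> X \<Longrightarrow> basis_vec R x \<in> carrier (free_space R X)"
proof -
  assume "x \<in> X"
  moreover have "{y. basis_vec R x y \<noteq> \<zero>} \<subseteq> {x}" by (auto simp: basis_vec_def)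
  ultimately show ?thesis by (auto simp: mem_free_space basis_vec_def intro: finite_subset)
qed

text \<open>Basis vectors span. The induction runs over an arbitrary finite set S containing the
  support of p, so that erasing the value at one point leads to the smaller set even when that value
  was already zero.\<close>

lemma (in cring) free_space_linear_eq:
  assumes M: "module R M"
    and f: "linear_map R (free_space R X) M f" and g: "linear_map R (free_space R X) M g"
    and eq: "\<And>x. x \<in> X \<Longrightarrow> f (basis_vec R x) = g (basis_vec R x)"
    and p: "p \<in> carrier (free_space R X)"
  shows "f p = g p"
proof -
  have "p \<in> carrier (free_space R X) \<Longrightarrow> {x. p x \<noteq> \<zero>} \<subseteq> S \<Longrightarrow> f p = g p" if "finite S" for S p
    using that
  proof (induction S arbitrary: p rule: finite_induct)
    case empty
    then have "p = \<zero>\<^bsub>free_space R X\<^esub>" by auto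
    then show ?case
      using linear_map_zero[OF module_free_space M f] linear_map_zero[OF module_free_space M g] by simp
  next
    case (insert z S)
    show ?case
    proof (cases "p z = \<zero>")
      case True
      then show ?thesis using insert.prems by (intro insert.IH) auto
    next
      case False
      then have z: "z \<in> X" and pz: "p z \<in> carrier R" using insert.prems by (auto simp: mem_free_space)
      let ?q = "p(z := \<zero>)"
      have q: "?q \<in> carrier (free_space R X)"
        by (rule free_space_closed[OF insert.prems(1)]) (use insert.prems in \<open>auto simp: mem_free_space\<close>)
      have eqq: "f ?q = g ?q" using insert.prems by (intro insert.IH q) auto
      have dec: "p = ?q \<oplus>\<^bsub>free_space R X\<^esub> (p z \<odot>\<^bsub>free_space R X\<^esub> basis_vec R z)"
        using insert.prems by (auto simp: mem_free_space basis_vec_def fun_eq_iff)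
      have e: "basis_vec R z \<in> carrier (free_space R X)" by (rule basis_vec_closed[OF z])
      interpret F: module R "free_space R X" by (rule module_free_space)
      have "h p = h ?q \<oplus>\<^bsub>M\<^esub> p z \<odot>\<^bsub>M\<^esub> h (basis_vec R z)" if h: "linear_map R (free_space R X) M h" for h
        by (subst dec, subst linear_map_add[OF h q], rule F.smult_closed[OF pz e],
            subst linear_map_smult[OF h pz e], rule refl)
      from this[OF f] this[OF g] eqq eq[OF z] show ?thesis by simp
    qed
  qed
  with p show ?thesis by (auto simp: mem_free_space)
qed

text \<open>The linear extension of f from the basis. The body is the sum inside
  \<open>sweedler\<close> for an arbitrary p in place of the chosen representative, so that facts
  about \<open>sweedler\<close> reduce to facts about this map.\<close>

definition free_ext ::
  "('k, 'm) ring_scheme \<Rightarrow> ('k, 'u, 'm1) module_scheme \<Rightarrow> ('x \<Rightarrow> 'u) \<Rightarrow> ('x \<Rightarrow> 'k) \<Rightarrow> 'u" where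
  "free_ext K M f p = (\<Oplus>\<^bsub>M\<^esub> z \<in> {z. p z \<noteq> \<zero>\<^bsub>K\<^esub>}. p z \<odot>\<^bsub>M\<^esub> f z)"

context module
begin

text \<open>The supports of p, q and their sum differ; a common finite index set makes the three
  sums comparable term by term.\<close>

lemma free_ext_superset:
  assumes "p \<in> carrier (free_space R X)" "f \<in> X \<rightarrow> carrier M"
    and "finite S" "{z. p z \<noteq> \<zero>} \<subseteq> S" "S \<subseteq> X"
  shows "free_ext R M f p = (\<Oplus>\<^bsub>M\<^esub> z \<in> S. p z \<odot>\<^bsub>M\<^esub> f z)"
  unfolding free_ext_def using assms
  by (intro M.add.finprod_mono_neutral_cong_left) (auto simp: mem_free_space Pi_iff subset_eq)

lemma free_ext_closed:
  assumes "p \<in> carrier (free_space R X)" "f \<in> X \<rightarrow> carrier M"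
  shows "free_ext R M f p \<in> carrier M"
  unfolding free_ext_def using assms by (intro M.finsum_closed) (auto simp: mem_free_space Pi_iff)

lemma free_ext_linear:
  assumes f: "f \<in> X \<rightarrow> carrier M"
  shows "linear_map R (free_space R X) M (free_ext R M f)"
proof (rule linear_mapI)
  interpret F: module R "free_space R X" by (rule R.module_free_space)
  fix p assume p: "p \<in> carrier (free_space R X)"
  then show "free_ext R M f p \<in> carrier M" using f by (rule free_ext_closed)
  { fix q assume q: "q \<in> carrier (free_space R X)"
    let ?S = "{z. p z \<noteq> \<zero>} \<union> {z. q z \<noteq> \<zero>}"
    have S: "finite ?S" "?S \<subseteq> X" using p q by (auto simp: mem_free_space)
    note ext = free_ext_superset[OF _ f S(1) _ S(2)]
    have "free_ext R M f (p \<oplus>\<^bsub>free_space R X\<^esub> q) = (\<Oplus>\<^bsub>M\<^esub> z \<in> ?S. (p z \<oplus> q z) \<odot>\<^bsub>M\<^esub> f z)"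
      by (subst ext[OF F.add.m_closed[OF p q]]) auto
    also have "\<dots> = (\<Oplus>\<^bsub>M\<^esub> z \<in> ?S. p z \<odot>\<^bsub>M\<^esub> f z \<oplus>\<^bsub>M\<^esub> q z \<odot>\<^bsub>M\<^esub> f z)"
      using p q f S by (intro M.finsum_cong') (auto simp: mem_free_space Pi_iff smult_l_distr subset_eq)
    also have "\<dots> = free_ext R M f p \<oplus>\<^bsub>M\<^esub> free_ext R M f q"
      using p q f S
      by (subst ext[OF p] ext[OF q], blast)+
        (subst M.finsum_addf[symmetric], auto simp: mem_free_space Pi_iff subset_eq)
    finally show "free_ext R M f (p \<oplus>\<^bsub>free_space R X\<^esub> q) = free_ext R M f p \<oplus>\<^bsub>M\<^esub> free_ext R M f q" . }
  fix c assume c: "c \<in> carrier R"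
  let ?S = "{z. p z \<noteq> \<zero>}"
  have S: "finite ?S" "?S \<subseteq> X" using p by (auto simp: mem_free_space)
  note ext = free_ext_superset[OF _ f S(1) _ S(2)]
  have "free_ext R M f (c \<odot>\<^bsub>free_space R X\<^esub> p) = (\<Oplus>\<^bsub>M\<^esub> z \<in> ?S. (c \<otimes> p z) \<odot>\<^bsub>M\<^esub> f z)"
    using c by (subst ext[OF F.smult_closed[OF c p]]) auto
  also have "\<dots> = (\<Oplus>\<^bsub>M\<^esub> z \<in> ?S. c \<odot>\<^bsub>M\<^esub> (p z \<odot>\<^bsub>M\<^esub> f z))"
    using p c f S by (intro M.finsum_cong') (auto simp: mem_free_space Pi_iff smult_assoc1 subset_eq)
  also have "\<dots> = c \<odot>\<^bsub>M\<^esub> free_ext R M f p"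
    using p c f S unfolding free_ext_def
    by (subst finsum_smult_ldistr) (auto simp: mem_free_space Pi_iff subset_eq)
  finally show "free_ext R M f (c \<odot>\<^bsub>free_space R X\<^esub> p) = c \<odot>\<^bsub>M\<^esub> free_ext R M f p" .
qed

lemma free_ext_basis_vec:
  assumes "f \<in> X \<rightarrow> carrier M" "x \<in> X"
  shows "free_ext R M f (basis_vec R x) = f x"
proof -
  have "{z. basis_vec R x z \<noteq> \<zero>} \<subseteq> {x}" by (auto simp: basis_vec_def)
  then show ?thesis
    using assms free_ext_superset[OF R.basis_vec_closed[OF assms(2)] assms(1), of "{x}"]
    by (auto simp: basis_vec_def Pi_iff)
qed

end

subsection \<open>The quotient\<close>

lemma tensor_simps:
  "carrier (tensor K V W) = a_rcosets\<^bsub>free_space K (carrier V \<times> carrier W)\<^esub> (tensor_null K V W)"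
  "zero (tensor K V W) = tensor_null K V W"
  "add (tensor K V W) = set_add (free_space K (carrier V \<times> carrier W))"
  "smult (tensor K V W) = (\<lambda>c t. \<Union>p\<in>t.
      a_r_coset (free_space K (carrier V \<times> carrier W)) (tensor_null K V W)
      (c \<odot>\<^bsub>free_space K (carrier V \<times> carrier W)\<^esub> p))"
  by (simp_all add: tensor_def Let_def)

locale tensor_pair = V: module K V + W: module K W for K (structure) and V and W
begin

abbreviation "F \<equiv> free_space K (carrier V \<times> carrier W)"
abbreviation "N \<equiv> tensor_null K V W"

sublocale F: module K F by (rule V.R.module_free_space)

lemma basis_vec_closed: "v \<in> carrier V \<Longrightarrow> w \<in> carrier W \<Longrightarrow> basis_vec K (v, w) \<in> carrier F"
  by (rule V.R.basis_vec_closed) auto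

lemma tensor_rels_closed: "tensor_rels K V W \<subseteq> carrier F"
  unfolding tensor_rels_def Let_def
  by (intro Un_least subsetI; elim CollectE exE conjE; simp only:)
    (intro F.M.minus_closed F.M.add.m_closed F.smult_closed basis_vec_closed V.M.add.m_closed
      W.M.add.m_closed V.smult_closed W.smult_closed; assumption)+

lemma tensor_null_least:
  assumes "submodule S K F" "tensor_rels K V W \<subseteq> S"
  shows "N \<subseteq> S"
  using assms unfolding tensor_null_def by auto

lemma submodule_tensor_null: "submodule N K F"
proof (rule F.submoduleI)
  note E = F.submoduleE
  \<comment> \<open>The whole free space belongs to the family that is intersected, so the
    intersection lies inside it.\<close>
  show "N \<subseteq> carrier F" by (rule tensor_null_least[OF F.carrier_is_submodule tensor_rels_closed])
  show "\<zero>\<^bsub>F\<^esub> \<in> N"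
    unfolding tensor_null_def
    using subgroup.one_closed[OF submodule.axioms(1)] by fastforce
  fix a assume a: "a \<in> N"
  then show "\<ominus>\<^bsub>F\<^esub> a \<in> N" unfolding tensor_null_def using E(3) by blast
  { fix b assume "b \<in> N" with a show "a \<oplus>\<^bsub>F\<^esub> b \<in> N" unfolding tensor_null_def using E(5) by blast }
  { fix c assume "c \<in> carrier K" with a show "c \<odot>\<^bsub>F\<^esub> a \<in> N" unfolding tensor_null_def using E(4) by blast }
qed

sublocale N: abelian_subgroup N F
  by (rule abelian_subgroupI3[OF additive_subgroupI F.M.abelian_group_axioms])
    (rule submodule.axioms(1)[OF submodule_tensor_null])

definition \<pi> where "\<pi> p = N +>\<^bsub>F\<^esub> p"

lemma carrier_tensor: "carrier (tensor K V W) = \<pi> ` carrier F"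
  by (auto simp: tensor_simps A_RCOSETS_def' \<pi>_def)

lemma \<pi>_add: "\<lbrakk>p \<in> carrier F; q \<in> carrier F\<rbrakk> \<Longrightarrow> \<pi> p \<oplus>\<^bsub>tensor K V W\<^esub> \<pi> q = \<pi> (p \<oplus>\<^bsub>F\<^esub> q)"
  unfolding \<pi>_def tensor_simps by (rule N.a_rcos_sum)

lemma \<pi>_mem: "p \<in> carrier F \<Longrightarrow> p \<in> \<pi> p"
  unfolding \<pi>_def by (rule N.a_rcos_self)

lemma mem_\<pi>_iff: "\<lbrakk>p \<in> carrier F; q \<in> carrier F\<rbrakk> \<Longrightarrow> q \<in> \<pi> p \<longleftrightarrow> q \<ominus>\<^bsub>F\<^esub> p \<in> N"
  unfolding \<pi>_def using N.a_rcos_module_rev N.a_rcos_module_imp by (auto simp: a_minus_def)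

lemma \<pi>_subset: "p \<in> carrier F \<Longrightarrow> \<pi> p \<subseteq> carrier F"
  unfolding \<pi>_def by (rule F.M.a_r_coset_subset_G[OF N.a_subset])

lemma \<pi>_eqI: "\<lbrakk>p \<in> carrier F; q \<in> carrier F; q \<ominus>\<^bsub>F\<^esub> p \<in> N\<rbrakk> \<Longrightarrow> \<pi> p = \<pi> q"
  using N.a_subgroup F.M.a_repr_independence[of q N p] mem_\<pi>_iff[of p q] by (simp add: \<pi>_def)

text \<open>The scalar multiple of a coset is a union over all its representatives. Since N is
  closed under scalars, every representative yields the same coset, and the union collapses to
  it.\<close>

lemma \<pi>_smult:
  assumes c: "c \<in> carrier K" and p: "p \<in> carrier F"
  shows "c \<odot>\<^bsub>tensor K V W\<^esub> \<pi> p = \<pi> (c \<odot>\<^bsub>F\<^esub> p)"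
proof -
  have "\<pi> (c \<odot>\<^bsub>F\<^esub> q) = \<pi> (c \<odot>\<^bsub>F\<^esub> p)" if q: "q \<in> \<pi> p" for q
  proof -
    have qF: "q \<in> carrier F" using \<pi>_subset[OF p] q by blast
    then have "c \<odot>\<^bsub>F\<^esub> (q \<ominus>\<^bsub>F\<^esub> p) \<in> N"
      using submodule.smult_closed[OF submodule_tensor_null c] mem_\<pi>_iff[OF p qF] q by blast
    also have "c \<odot>\<^bsub>F\<^esub> (q \<ominus>\<^bsub>F\<^esub> p) = c \<odot>\<^bsub>F\<^esub> q \<ominus>\<^bsub>F\<^esub> c \<odot>\<^bsub>F\<^esub> p"
      by (simp only: a_minus_def F.smult_r_distr[OF c qF F.M.a_inv_closed[OF p]] F.smult_r_minus[OF c p])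
    finally show ?thesis
      by (intro \<pi>_eqI[symmetric] F.smult_closed c p qF)
  qed
  then have "(\<Union>q\<in>\<pi> p. \<pi> (c \<odot>\<^bsub>F\<^esub> q)) = \<pi> (c \<odot>\<^bsub>F\<^esub> p)" using \<pi>_mem[OF p] by blast
  then show ?thesis by (simp only: tensor_simps \<pi>_def)
qed

lemma \<pi>_closed: "p \<in> carrier F \<Longrightarrow> \<pi> p \<in> carrier (tensor K V W)"
  by (simp add: carrier_tensor)

lemma \<pi>_linear: "linear_map K F (tensor K V W) \<pi>"
  by (rule linear_mapI) (simp_all only: \<pi>_closed \<pi>_add \<pi>_smult)

lemma tens_eq: "tens K V W v w = \<pi> (basis_vec K (v, w))"
  by (simp add: tens_def \<pi>_def)

lemma module_tensor: "module K (tensor K V W)"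
proof (rule moduleI)
  let ?T = "tensor K V W"
  show "cring K" by (rule V.R.is_cring)
  show "abelian_group ?T"
  proof (rule abelian_groupI)
    show "\<zero>\<^bsub>?T\<^esub> \<in> carrier ?T"
      using \<pi>_closed[OF F.M.zero_closed] N.a_subset by (simp only: tensor_simps(2) \<pi>_def F.M.a_coset_add_zero)
    fix s assume "s \<in> carrier ?T"
    then obtain p where p: "p \<in> carrier F" "s = \<pi> p" by (auto simp: carrier_tensor)
    have z: "\<zero>\<^bsub>?T\<^esub> = \<pi> \<zero>\<^bsub>F\<^esub>" using N.a_subset by (simp only: tensor_simps(2) \<pi>_def F.M.a_coset_add_zero)
    show "\<zero>\<^bsub>?T\<^esub> \<oplus>\<^bsub>?T\<^esub> s = s"
      by (simp only: z p \<pi>_add F.M.zero_closed F.M.l_zero)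
    show "\<exists>t\<in>carrier ?T. t \<oplus>\<^bsub>?T\<^esub> s = \<zero>\<^bsub>?T\<^esub>"
      by (rule bexI[of _ "\<pi> (\<ominus>\<^bsub>F\<^esub> p)"]) (simp_all only: z p \<pi>_add \<pi>_closed F.M.a_inv_closed F.M.l_neg)
    fix t assume "t \<in> carrier ?T"
    then obtain q where q: "q \<in> carrier F" "t = \<pi> q" by (auto simp: carrier_tensor)
    show "s \<oplus>\<^bsub>?T\<^esub> t \<in> carrier ?T" by (simp only: p q \<pi>_add \<pi>_closed F.M.add.m_closed)
    show "s \<oplus>\<^bsub>?T\<^esub> t = t \<oplus>\<^bsub>?T\<^esub> s" by (simp only: p q \<pi>_add F.M.a_comm)
    fix u assume "u \<in> carrier ?T"
    then obtain r where r: "r \<in> carrier F" "u = \<pi> r" by (auto simp: carrier_tensor)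
    show "s \<oplus>\<^bsub>?T\<^esub> t \<oplus>\<^bsub>?T\<^esub> u = s \<oplus>\<^bsub>?T\<^esub> (t \<oplus>\<^bsub>?T\<^esub> u)"
      by (simp only: p q r \<pi>_add F.M.add.m_closed F.M.a_assoc)
  qed
  fix s assume "s \<in> carrier ?T"
  then show "\<one> \<odot>\<^bsub>?T\<^esub> s = s"
    by (auto simp only: carrier_tensor \<pi>_smult V.R.one_closed F.smult_one)
next
  let ?T = "tensor K V W"
  fix c s assume c: "c \<in> carrier K" and "s \<in> carrier ?T"
  then obtain p where p: "p \<in> carrier F" "s = \<pi> p" by (auto simp: carrier_tensor)
  show "c \<odot>\<^bsub>?T\<^esub> s \<in> carrier ?T" using c by (simp only: p \<pi>_smult \<pi>_closed F.smult_closed)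
  have cl: "c \<odot>\<^bsub>F\<^esub> p \<in> carrier F" if "c \<in> carrier K" "p \<in> carrier F" for c p
    using that by (rule F.smult_closed)
  { fix d assume d: "d \<in> carrier K"
    show "(c \<oplus> d) \<odot>\<^bsub>?T\<^esub> s = c \<odot>\<^bsub>?T\<^esub> s \<oplus>\<^bsub>?T\<^esub> d \<odot>\<^bsub>?T\<^esub> s"
      using c d by (simp only: p \<pi>_smult \<pi>_add V.R.add.m_closed cl F.smult_l_distr)
    show "(c \<otimes> d) \<odot>\<^bsub>?T\<^esub> s = c \<odot>\<^bsub>?T\<^esub> (d \<odot>\<^bsub>?T\<^esub> s)"
      using c d by (simp only: p \<pi>_smult V.R.m_closed cl F.smult_assoc1) }
  fix t assume "t \<in> carrier ?T"
  then obtain q where q: "q \<in> carrier F" "t = \<pi> q" by (auto simp: carrier_tensor)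
  show "c \<odot>\<^bsub>?T\<^esub> (s \<oplus>\<^bsub>?T\<^esub> t) = c \<odot>\<^bsub>?T\<^esub> s \<oplus>\<^bsub>?T\<^esub> c \<odot>\<^bsub>?T\<^esub> t"
    using c by (simp only: p q \<pi>_smult \<pi>_add F.M.add.m_closed cl F.smult_r_distr)
qed

lemma tens_closed: "\<lbrakk>v \<in> carrier V; w \<in> carrier W\<rbrakk> \<Longrightarrow> tens K V W v w \<in> carrier (tensor K V W)"
  by (simp add: tens_eq \<pi>_closed basis_vec_closed)

text \<open>All four families of relations have the form of a basis vector minus some q, so each
  bilinearity law of \<open>tens\<close> is one instance.\<close>

lemma tensor_rels_eq:
  assumes "basis_vec K (v, w) \<ominus>\<^bsub>F\<^esub> q \<in> tensor_rels K V W"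
    and "v \<in> carrier V" "w \<in> carrier W" "q \<in> carrier F"
  shows "tens K V W v w = \<pi> q"
proof -
  have "tensor_rels K V W \<subseteq> N" by (auto simp: tensor_null_def)
  with assms show ?thesis
    unfolding tens_eq by (intro \<pi>_eqI[symmetric] basis_vec_closed) auto
qed

lemma tens_linear_left: "w \<in> carrier W \<Longrightarrow> linear_map K V (tensor K V W) (\<lambda>v. tens K V W v w)"
proof (rule linear_mapI)
  assume w: "w \<in> carrier W"
  fix v assume v: "v \<in> carrier V"
  show "tens K V W v w \<in> carrier (tensor K V W)" using v w by (rule tens_closed)
  { fix v' assume v': "v' \<in> carrier V"
    have "tens K V W (v \<oplus>\<^bsub>V\<^esub> v') w = \<pi> (basis_vec K (v, w) \<oplus>\<^bsub>F\<^esub> basis_vec K (v', w))"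
      by (rule tensor_rels_eq)
        (use v v' w in \<open>auto simp: tensor_rels_def Let_def basis_vec_closed F.M.add.m_closed
            simp del: free_space_simps\<close>)
    with v v' w show "tens K V W (v \<oplus>\<^bsub>V\<^esub> v') w = tens K V W v w \<oplus>\<^bsub>tensor K V W\<^esub> tens K V W v' w"
      by (simp only: tens_eq \<pi>_add basis_vec_closed) }
  fix c assume c: "c \<in> carrier K"
  have "tens K V W (c \<odot>\<^bsub>V\<^esub> v) w = \<pi> (c \<odot>\<^bsub>F\<^esub> basis_vec K (v, w))"
    by (rule tensor_rels_eq)
      (use v c w in \<open>auto simp: tensor_rels_def Let_def basis_vec_closed simp del: free_space_simps
          intro!: F.smult_closed\<close>)
  with v c w show "tens K V W (c \<odot>\<^bsub>V\<^esub> v) w = c \<odot>\<^bsub>tensor K V W\<^esub> tens K V W v w"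
    by (simp only: tens_eq \<pi>_smult basis_vec_closed)
qed

lemma tens_linear_right: "v \<in> carrier V \<Longrightarrow> linear_map K W (tensor K V W) (tens K V W v)"
proof (rule linear_mapI)
  assume v: "v \<in> carrier V"
  fix w assume w: "w \<in> carrier W"
  show "tens K V W v w \<in> carrier (tensor K V W)" using v w by (rule tens_closed)
  { fix w' assume w': "w' \<in> carrier W"
    have "tens K V W v (w \<oplus>\<^bsub>W\<^esub> w') = \<pi> (basis_vec K (v, w) \<oplus>\<^bsub>F\<^esub> basis_vec K (v, w'))"
      by (rule tensor_rels_eq)
        (use v w' w in \<open>auto simp: tensor_rels_def Let_def basis_vec_closed F.M.add.m_closed
            simp del: free_space_simps\<close>)
    with v w' w show "tens K V W v (w \<oplus>\<^bsub>W\<^esub> w') = tens K V W v w \<oplus>\<^bsub>tensor K V W\<^esub> tens K V W v w'"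
      by (simp only: tens_eq \<pi>_add basis_vec_closed) }
  fix c assume c: "c \<in> carrier K"
  have "tens K V W v (c \<odot>\<^bsub>W\<^esub> w) = \<pi> (c \<odot>\<^bsub>F\<^esub> basis_vec K (v, w))"
    by (rule tensor_rels_eq)
      (use v c w in \<open>auto simp: tensor_rels_def Let_def basis_vec_closed simp del: free_space_simps
          intro!: F.smult_closed\<close>)
  with v c w show "tens K V W v (c \<odot>\<^bsub>W\<^esub> w) = c \<odot>\<^bsub>tensor K V W\<^esub> tens K V W v w"
    by (simp only: tens_eq \<pi>_smult basis_vec_closed)
qed

lemma tensor_linear_eq:
  assumes M: "module K M"
    and f: "linear_map K (tensor K V W) M f" and g: "linear_map K (tensor K V W) M g"
    and eq: "\<And>v w. \<lbrakk>v \<in> carrier V; w \<in> carrier W\<rbrakk> \<Longrightarrow> f (tens K V W v w) = g (tens K V W v w)"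
    and t: "t \<in> carrier (tensor K V W)"
  shows "f t = g t"
proof -
  obtain p where p: "p \<in> carrier F" "t = \<pi> p" using t by (auto simp: carrier_tensor)
  have "f (\<pi> p) = g (\<pi> p)"
    by (rule V.R.free_space_linear_eq[OF M linear_map_comp[OF f \<pi>_linear]
          linear_map_comp[OF g \<pi>_linear] _ p(1)])
      (auto simp: eq tens_eq[symmetric])
  with p show ?thesis by simp
qed

text \<open>Independence of the choice: the kernel of the linear extension of a bilinear f is a
  submodule that contains the bilinearity relations, hence contains N, and the chosen representative
  differs from p by an element of N.\<close>

lemma sweedler_\<pi>:
  assumes M: "module K M" and f: "bilinear_map K V W M f" and p: "p \<in> carrier F"
  shows "sweedler K M (\<pi> p) f = free_ext K M (\<lambda>z. f (fst z) (snd z)) p"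
proof -
  interpret M: module K M by fact
  let ?f = "\<lambda>z. f (fst z) (snd z)"
  note fl = linear_mapD[of K W M "f v" for v] linear_mapD[of K V M "\<lambda>v. f v w" for w]
  have fc: "?f \<in> carrier V \<times> carrier W \<rightarrow> carrier M"
    using f by (auto intro: bilinear_map_closed)
  note lin = M.free_ext_linear[OF fc]
  note ext = linear_mapD[OF lin]
  let ?S = "{q \<in> carrier F. free_ext K M ?f q = \<zero>\<^bsub>M\<^esub>}"
  have neg: "free_ext K M ?f (\<ominus>\<^bsub>F\<^esub> q) = \<ominus>\<^bsub>M\<^esub> free_ext K M ?f q" if q: "q \<in> carrier F" for q
    using q ext(3)[OF V.R.a_inv_closed[OF V.R.one_closed] q]
      F.smult_l_minus[OF V.R.one_closed q] M.smult_l_minus[OF V.R.one_closed ext(1)[OF q]]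
    by (simp add: F.smult_one[OF q] M.smult_one[OF ext(1)[OF q]] del: free_space_simps)
  have minus: "free_ext K M ?f (q \<ominus>\<^bsub>F\<^esub> r) = free_ext K M ?f q \<ominus>\<^bsub>M\<^esub> free_ext K M ?f r"
    if "q \<in> carrier F" "r \<in> carrier F" for q r
    using that neg ext(2)[of q "\<ominus>\<^bsub>F\<^esub> r"] by (simp add: a_minus_def F.M.a_inv_closed del: free_space_simps)
  have "N \<subseteq> ?S"
  proof (rule tensor_null_least)
    show "submodule ?S K F"
      by (rule F.submoduleI)
        (auto simp: ext neg F.M.a_inv_closed F.M.zero_closed F.M.add.m_closed F.smult_closed
          linear_map_zero[OF F.module_axioms M lin] simp del: free_space_simps)
    have fb: "free_ext K M ?f (basis_vec K (v, w)) = f v w" if "v \<in> carrier V" "w \<in> carrier W" for v w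
      using that M.free_ext_basis_vec[OF fc] by auto
    note E = fb minus ext V.M.add.m_closed W.M.add.m_closed V.smult_closed W.smult_closed basis_vec_closed
      F.M.add.m_closed F.smult_closed
    have fcl: "f v w \<in> carrier M" if "v \<in> carrier V" "w \<in> carrier W" for v w
      using fc that by (auto simp: Pi_iff)
    have fr: "\<lbrakk>v \<in> carrier V; v' \<in> carrier V; w \<in> carrier W\<rbrakk> \<Longrightarrow> f (v \<oplus>\<^bsub>V\<^esub> v') w = f v w \<oplus>\<^bsub>M\<^esub> f v' w"
      "\<lbrakk>v \<in> carrier V; w \<in> carrier W; w' \<in> carrier W\<rbrakk> \<Longrightarrow> f v (w \<oplus>\<^bsub>W\<^esub> w') = f v w \<oplus>\<^bsub>M\<^esub> f v w'"
      "\<lbrakk>c \<in> carrier K; v \<in> carrier V; w \<in> carrier W\<rbrakk> \<Longrightarrow> f (c \<odot>\<^bsub>V\<^esub> v) w = c \<odot>\<^bsub>M\<^esub> f v w"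
      "\<lbrakk>c \<in> carrier K; v \<in> carrier V; w \<in> carrier W\<rbrakk> \<Longrightarrow> f v (c \<odot>\<^bsub>W\<^esub> w) = c \<odot>\<^bsub>M\<^esub> f v w" for c v v' w w'
      using f fl by (auto simp: bilinear_map_def)
    have "free_ext K M ?f q = \<zero>\<^bsub>M\<^esub>" if "q \<in> tensor_rels K V W" for q
      using that unfolding tensor_rels_def Let_def
      by (elim UnE CollectE exE conjE)
        (simp_all add: E fcl fr M.M.r_neg a_minus_def[of M] del: free_space_simps)
    with tensor_rels_closed show "tensor_rels K V W \<subseteq> ?S" by blast
  qed
  moreover define q where "q = (SOME q. q \<in> \<pi> p)"
  then have q: "q \<in> \<pi> p" using \<pi>_mem[OF p] by (simp add: someI[of "\<lambda>q. q \<in> \<pi> p"])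
  moreover have qF: "q \<in> carrier F" using q \<pi>_subset[OF p] by blast
  ultimately have "free_ext K M ?f (q \<ominus>\<^bsub>F\<^esub> p) = \<zero>\<^bsub>M\<^esub>" using mem_\<pi>_iff[OF p qF] by blast
  then have "free_ext K M ?f q = free_ext K M ?f p"
    using minus[OF qF p] ext(1)[OF p] ext(1)[OF qF]
      M.M.minus_equality[of "free_ext K M ?f q" "\<ominus>\<^bsub>M\<^esub> free_ext K M ?f p"]
    by (simp add: M.M.minus_eq)
  then show ?thesis by (simp add: sweedler_def Let_def q_def free_ext_def)
qed

lemma sweedler_linear:
  assumes M: "module K M" and f: "bilinear_map K V W M f"
  shows "linear_map K (tensor K V W) M (\<lambda>t. sweedler K M t f)"
proof (rule linear_mapI)
  interpret M: module K M by fact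
  have fc: "(\<lambda>z. f (fst z) (snd z)) \<in> carrier V \<times> carrier W \<rightarrow> carrier M"
    using f by (auto intro: bilinear_map_closed)
  note ext = linear_mapD[OF M.free_ext_linear[OF fc]]
  note s = sweedler_\<pi>[OF M f]
  fix t assume "t \<in> carrier (tensor K V W)"
  then obtain p where p: "p \<in> carrier F" "t = \<pi> p" by (auto simp: carrier_tensor)
  then show "sweedler K M t f \<in> carrier M" by (simp add: s ext)
  { fix u assume "u \<in> carrier (tensor K V W)"
    then obtain q where q: "q \<in> carrier F" "u = \<pi> q" by (auto simp: carrier_tensor)
    show "sweedler K M (t \<oplus>\<^bsub>tensor K V W\<^esub> u) f = sweedler K M t f \<oplus>\<^bsub>M\<^esub> sweedler K M u f"
      using p q by (simp only: s ext \<pi>_add F.M.add.m_closed) }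
  fix c assume "c \<in> carrier K"
  then show "sweedler K M (c \<odot>\<^bsub>tensor K V W\<^esub> t) f = c \<odot>\<^bsub>M\<^esub> sweedler K M t f"
    using p by (simp only: s ext \<pi>_smult F.smult_closed)
qed

lemma sweedler_tens:
  assumes M: "module K M" and f: "bilinear_map K V W M f" and vw: "v \<in> carrier V" "w \<in> carrier W"
  shows "sweedler K M (tens K V W v w) f = f v w"
proof -
  interpret M: module K M by fact
  have fc: "(\<lambda>z. f (fst z) (snd z)) \<in> carrier V \<times> carrier W \<rightarrow> carrier M"
    using f by (auto intro: bilinear_map_closed)
  show ?thesis unfolding tens_eq
    by (subst sweedler_\<pi>[OF M f basis_vec_closed[OF vw]], subst M.free_ext_basis_vec[OF fc]) (use vw in auto)
qed

lemma representative:
  assumes "t \<in> carrier (tensor K V W)"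
  shows "(SOME p. p \<in> t) \<in> carrier F"
proof -
  obtain p where p: "p \<in> carrier F" "t = \<pi> p" using assms by (auto simp: carrier_tensor)
  then show ?thesis using \<pi>_subset[OF p(1)] \<pi>_mem[OF p(1)] someI[of "\<lambda>q. q \<in> \<pi> p" p] by blast
qed

end

section \<open>A calculus of iterated Sweedler sums\<close>

text \<open>
  Unlike \<^const>\<open>sweedler\<close>, the sum \<open>sw\<close> knows the factors \<open>V\<close> and \<open>W\<close> of \<open>t\<close>, and terms outside
  \<open>M\<close> count as zero, so that closure, congruence and exchange of sums need no assumption on \<open>f\<close>.  The
  number \<open>n\<close> has no meaning: it is a sorting key for \<open>sw_sort\<close>.
\<close>

definition sw ::
  "('k, 'm) ring_scheme \<Rightarrow> nat \<Rightarrow> ('k, 'v, 'm1) module_scheme \<Rightarrow> ('k, 'w, 'm2) module_scheme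
    \<Rightarrow> ('k, 'u, 'm3) module_scheme \<Rightarrow> ('v, 'w, 'k) tensor \<Rightarrow> ('v \<Rightarrow> 'w \<Rightarrow> 'u) \<Rightarrow> 'u" where
  "sw K n V W M t f =
    (if module K V \<and> module K W \<and> t \<in> carrier (tensor K V W)
     then sweedler K M t (\<lambda>x y.
       if x \<in> carrier V \<and> y \<in> carrier W \<and> f x y \<in> carrier M then f x y else \<zero>\<^bsub>M\<^esub>)
     else \<zero>\<^bsub>M\<^esub>)"

text \<open>The representative chosen by \<open>sweedler\<close>, with the zero function as default,
  so that sums over it vanish in exactly the cases where \<open>sw\<close> is zero by its side
  condition.\<close>

definition tensor_rep :: "('k, 'm) ring_scheme \<Rightarrow> ('k, 'v, 'm1) module_scheme
    \<Rightarrow> ('k, 'w, 'm2) module_scheme \<Rightarrow> ('v, 'w, 'k) tensor \<Rightarrow> 'v \<times> 'w \<Rightarrow> 'k" where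
  "tensor_rep K V W t = (if module K V \<and> module K W \<and> t \<in> carrier (tensor K V W)
     then SOME p. p \<in> t else (\<lambda>z. \<zero>\<^bsub>K\<^esub>))"

lemma tensor_rep_closed:
  assumes "module K M"
  shows "tensor_rep K V W t \<in> carrier (free_space K (carrier V \<times> carrier W))"
proof -
  interpret M: module K M by fact
  show ?thesis
  proof (cases "module K V \<and> module K W \<and> t \<in> carrier (tensor K V W)")
    case True
    then interpret tensor_pair K V W by (simp add: tensor_pair_def)
    show ?thesis using True by (simp add: tensor_rep_def representative)
  next
    case False
    then show ?thesis by (auto simp: tensor_rep_def mem_free_space)
  qed
qed

lemma tensor_rep_props:
  assumes "module K M"
  shows "tensor_rep K V W t z \<in> carrier K"
    and "tensor_rep K V W t z \<noteq> \<zero>\<^bsub>K\<^esub> \<Longrightarrow> fst z \<in> carrier V"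
    and "tensor_rep K V W t z \<noteq> \<zero>\<^bsub>K\<^esub> \<Longrightarrow> snd z \<in> carrier W"
    and "finite {z. tensor_rep K V W t z \<noteq> \<zero>\<^bsub>K\<^esub>}"
  using tensor_rep_closed[OF assms, of V W t] by (cases z; auto simp: mem_free_space)+

definition tot :: "('k, 'u, 'm3) module_scheme \<Rightarrow> 'u \<Rightarrow> 'u" where
  "tot M x = (if x \<in> carrier M then x else \<zero>\<^bsub>M\<^esub>)"

lemma (in module) tot [simp]: "tot M x \<in> carrier M" "x \<in> carrier M \<Longrightarrow> tot M x = x"
  by (auto simp: tot_def)

text \<open>After this, \<open>sw\<close> is an ordinary finite sum over a fixed support, and its
  laws of congruence, linearity and exchange are laws of finite sums.\<close>

lemma sw_eq_free_ext:
  assumes "module K M"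
  shows "sw K n V W M t f = free_ext K M (\<lambda>z. tot M (f (fst z) (snd z))) (tensor_rep K V W t)"
proof -
  interpret M: module K M by fact
  show ?thesis
  proof (cases "module K V \<and> module K W \<and> t \<in> carrier (tensor K V W)")
    case True
    then have "sw K n V W M t f = (\<Oplus>\<^bsub>M\<^esub> z \<in> {z. tensor_rep K V W t z \<noteq> \<zero>\<^bsub>K\<^esub>}. tensor_rep K V W t z \<odot>\<^bsub>M\<^esub>
       (if fst z \<in> carrier V \<and> snd z \<in> carrier W \<and> f (fst z) (snd z) \<in> carrier M
         then f (fst z) (snd z) else \<zero>\<^bsub>M\<^esub>))"
      by (simp add: sw_def sweedler_def tensor_rep_def Let_def)
    also have "\<dots> = free_ext K M (\<lambda>z. tot M (f (fst z) (snd z))) (tensor_rep K V W t)"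
      unfolding free_ext_def
      by (rule M.finsum_cong')
        (use tensor_rep_props[OF assms, of V W t] in \<open>auto simp: tot_def\<close>)
    finally show ?thesis .
  next
    case False
    then have "sw K n V W M t f = \<zero>\<^bsub>M\<^esub>" unfolding sw_def by (rule if_not_P)
    moreover have "tensor_rep K V W t = (\<lambda>z. \<zero>\<^bsub>K\<^esub>)" using False unfolding tensor_rep_def by (rule if_not_P)
    ultimately show ?thesis by (simp add: free_ext_def)
  qed
qed

lemma sw_closed [simp]: "module K M \<Longrightarrow> sw K n V W M t f \<in> carrier M"
proof -
  assume M: "module K M"
  interpret M: module K M by fact
  show ?thesis
    unfolding sw_eq_free_ext[OF M] by (rule M.free_ext_closed[OF tensor_rep_closed[OF M]]) auto
qed

text \<open>As a congruence rule this hands the simplifier the carrier memberships of the bound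
  legs; it is sound because \<open>sw\<close> discards the body at arguments outside the
  carriers.\<close>

lemma sw_cong [cong]:
  assumes "t = t'" "\<And>x y. \<lbrakk>x \<in> carrier V; y \<in> carrier W\<rbrakk> \<Longrightarrow> f x y = f' x y"
  shows "sw K n V W M t f = sw K n V W M t' f'"
  using assms(2) unfolding sw_def assms(1)
  by (intro if_cong refl arg_cong[of _ _ "sweedler K M t'"] ext) auto

text \<open>Erases the keys once sorting is done. The premise \<open>0 < n\<close> keeps the rule
  from rewriting key 0 to itself forever.\<close>

lemma sw_relabel0: "0 < n \<Longrightarrow> sw K n V W M t f = sw K 0 V W M t f"
  by (simp add: sw_def)

lemma linear_map_sw:
  assumes M: "module K M" and N: "module K N" and g: "linear_map K M N g"
    and f: "\<And>x y. \<lbrakk>x \<in> carrier V; y \<in> carrier W\<rbrakk> \<Longrightarrow> f x y \<in> carrier M"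
  shows "g (sw K n V W M t f) = sw K n V W N t (\<lambda>x y. g (f x y))"
proof -
  interpret M: module K M by fact
  interpret N: module K N by fact
  let ?p = "tensor_rep K V W t"
  note p = tensor_rep_props[OF M, of V W t]
  then have c: "?p z \<in> carrier K" "?p (x, y) \<noteq> \<zero>\<^bsub>K\<^esub> \<Longrightarrow> f x y \<in> carrier M"
    and fin: "finite {z. ?p z \<noteq> \<zero>\<^bsub>K\<^esub>}" for x y z
    using p(2,3)[of "(x, y)"] by (auto simp: f)
  note gD = linear_mapD[OF g]
  show ?thesis unfolding sw_eq_free_ext[OF M] sw_eq_free_ext[OF N] free_ext_def
    by (subst linear_map_finsum[OF M N g fin])
      (auto simp: c gD intro!: N.finsum_cong')
qed

text \<open>Covers a parameter x that occurs in the body only: t, hence its representative, stays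
  fixed while x varies. A parameter that occurs in the tensor is the subject of
  \<open>linear_sw\<close>.\<close>

lemma linear_sw_body [simp]:
  assumes M: "module K M"
    and f: "\<And>u v. \<lbrakk>u \<in> carrier V; v \<in> carrier W\<rbrakk> \<Longrightarrow> linear_map K X M (\<lambda>x. f x u v)"
    and X: "module K X"
  shows "linear_map K X M (\<lambda>x. sw K n V W M t (f x))"
proof (rule linear_mapI)
  interpret M: module K M by fact
  interpret X: module K X by fact
  let ?p = "tensor_rep K V W t"
  let ?S = "{z. ?p z \<noteq> \<zero>\<^bsub>K\<^esub>}"
  note c = tensor_rep_props(1-3)[OF M, of V W t] and fin = tensor_rep_props(4)[OF M, of V W t]
  have fD: "f x (fst z) (snd z) \<in> carrier M"
     "f (x \<oplus>\<^bsub>X\<^esub> y) (fst z) (snd z) = f x (fst z) (snd z) \<oplus>\<^bsub>M\<^esub> f y (fst z) (snd z)"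
     "a \<in> carrier K \<Longrightarrow> f (a \<odot>\<^bsub>X\<^esub> x) (fst z) (snd z) = a \<odot>\<^bsub>M\<^esub> f x (fst z) (snd z)"
    if "z \<in> ?S" "x \<in> carrier X" "y \<in> carrier X" for z x y a
    using linear_mapD[OF f[of "fst z" "snd z"]] c that by auto
  show "sw K n V W M t (f x) \<in> carrier M" if "x \<in> carrier X" for x using M by simp
  note e = sw_eq_free_ext[OF M] free_ext_def
  show "sw K n V W M t (f (x \<oplus>\<^bsub>X\<^esub> y)) = sw K n V W M t (f x) \<oplus>\<^bsub>M\<^esub> sw K n V W M t (f y)"
    if "x \<in> carrier X" "y \<in> carrier X" for x y
    unfolding e using that
    by (subst M.finsum_addf[symmetric])
      (auto simp: fD[OF _ that, of "(a, b)" for a b, simplified]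
          fD(1)[OF _ that(2,1), of "(a, b)" for a b, simplified] c M.smult_r_distr
        simp del: M.finsum_addf intro!: M.finsum_cong')
  show "sw K n V W M t (f (a \<odot>\<^bsub>X\<^esub> x)) = a \<odot>\<^bsub>M\<^esub> sw K n V W M t (f x)"
    if "x \<in> carrier X" "a \<in> carrier K" for x a
    unfolding e using that fin
    by (subst M.finsum_smult_ldistr)
      (auto simp: fD[OF _ that(1) that(1), of "(a, b)" for a b, simplified] that(2) c
        M.smult_assoc1[symmetric] M.R.m_comm intro!: M.finsum_cong')
qed

text \<open>Both tensors are represented once and for all, so this is an exchange of two finite
  sums. That the tensors are independent is expressed by s not mentioning x, y and t not mentioning
  u, v.\<close>

lemma sw_swap:
  fixes M :: "('k, 'u, 'm3) module_scheme" and V :: "('k, 'v, 'm1) module_scheme"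
    and W :: "('k, 'w, 'm2) module_scheme" and P :: "('k, 'p, 'm4) module_scheme"
    and Q :: "('k, 'q, 'm5) module_scheme"
  assumes M: "module K M"
  shows "sw K n V W M t (\<lambda>x y. sw K m P Q M s (\<lambda>u v. f x y u v))
    = sw K m P Q M s (\<lambda>u v. sw K n V W M t (\<lambda>x y. f x y u v))"
proof -
  interpret M: module K M by fact
  let ?p = "tensor_rep K V W t" and ?q = "tensor_rep K P Q s"
  note c = tensor_rep_props(1)[OF M, of V W t] tensor_rep_props(1)[OF M, of P Q s]
    and fin = tensor_rep_props(4)[OF M, of V W t] tensor_rep_props(4)[OF M, of P Q s]
  have swap: "(\<Oplus>\<^bsub>M\<^esub> x \<in> S. \<Oplus>\<^bsub>M\<^esub> y \<in> T. g x y) = (\<Oplus>\<^bsub>M\<^esub> y \<in> T. \<Oplus>\<^bsub>M\<^esub> x \<in> S. g x y)"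
    if "finite S" "finite T" "\<And>x y. g x y \<in> carrier M"
    for S :: "('v \<times> 'w) set" and T :: "('p \<times> 'q) set" and g
    using that(1,2) by (induction S rule: finite_induct) (simp_all add: that(3) M.finsum_addf)
  have t: "tot M (sw K n V W M t f) = sw K n V W M t f" for n t f and V :: "('k, 'x, 'y) module_scheme"
     and W :: "('k, 'z, 'zz) module_scheme"
    by (simp add: M)
  show ?thesis
    unfolding sw_eq_free_ext[OF M, where t = t and f = "\<lambda>x y. sw K m P Q M s (f x y)"]
      sw_eq_free_ext[OF M, where t = s and f = "\<lambda>u v. sw K n V W M t (\<lambda>x y. f x y u v)"] t
    unfolding sw_eq_free_ext[OF M]
    unfolding free_ext_def
    by (subst M.finsum_smult_ldistr[OF fin(2) c(1)], simp add: c,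
      subst M.finsum_smult_ldistr[OF fin(1) c(2)], simp add: c,
      subst swap[OF fin], simp add: c)
      (auto simp: c M.smult_assoc1[symmetric] M.R.m_comm intro!: M.finsum_cong')
qed

text \<open>As a conditional rewrite rule this sorts nested sums by increasing key and terminates. A
  sum over the tensor of a leg bound further out cannot pass its binder, so keys must increase along
  dependencies.\<close>

lemma sw_sort:
  assumes "m < n" "module K M"
  shows "sw K n V W M t (\<lambda>x y. sw K m P Q M s (\<lambda>u v. f x y u v))
    = sw K m P Q M s (\<lambda>u v. sw K n V W M t (\<lambda>x y. f x y u v))"
  using assms(2) by (rule sw_swap)

section \<open>Evaluation of sums at tensors over two fixed factors\<close>

context
  fixes K :: "('k, 'm) ring_scheme" and V :: "('k, 'v, 'm1) module_scheme"
    and W :: "('k, 'w, 'm2) module_scheme"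
  assumes V: "module K V" and W: "module K W"
begin

interpretation tensor_pair K V W using V W by (simp add: tensor_pair_def)

text \<open>The entry into the calculus: both sides use the same representative, so the two sums
  agree term by term as soon as the values of f lie in M.\<close>

lemma sweedler_eq_sw:
  assumes M: "module K M" and t: "t \<in> carrier (tensor K V W)"
    and f: "\<And>x y. \<lbrakk>x \<in> carrier V; y \<in> carrier W\<rbrakk> \<Longrightarrow> f x y \<in> carrier M"
  shows "sweedler K M t f = sw K n V W M t f"
proof -
  interpret M: module K M by fact
  have "tensor_rep K V W t = (SOME p. p \<in> t)" using V W t by (simp add: tensor_rep_def)
  then have "sweedler K M t f = free_ext K M (\<lambda>z. f (fst z) (snd z)) (tensor_rep K V W t)"
    by (simp add: sweedler_def free_ext_def Let_def)
  also have "\<dots> = sw K n V W M t f"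
    unfolding sw_eq_free_ext[OF M] free_ext_def
    by (rule M.finsum_cong')
      (use tensor_rep_props[OF M, of V W t] in \<open>auto simp: f\<close>)
  finally show ?thesis .
qed

lemma sw_eq_sweedler:
  assumes M: "module K M" and t: "t \<in> carrier (tensor K V W)" and f: "bilinear_map K V W M f"
  shows "sw K n V W M t f = sweedler K M t f"
  by (rule sweedler_eq_sw[OF M t, symmetric]) (rule bilinear_map_closed[OF f])

lemma linear_sw_tensor:
  assumes M: "module K M" and f: "bilinear_map K V W M f"
  shows "linear_map K (tensor K V W) M (\<lambda>t. sw K n V W M t f)"
  using sweedler_linear[OF M f] sw_eq_sweedler[OF M _ f]
  by (simp add: linear_map_def Pi_iff module_tensor[THEN module.axioms(2)] abelian_groupE
      module.smult_closed[OF module_tensor])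

lemma sw_tens [simp]:
  assumes M: "module K M" and f: "bilinear_map K V W M f" and vw: "v \<in> carrier V" "w \<in> carrier W"
  shows "sw K n V W M (tens K V W v w) f = f v w"
  by (simp add: sw_eq_sweedler[OF M tens_closed f] sweedler_tens[OF M f] vw)

lemma linear_sw [simp]:
  assumes "module K M" "bilinear_map K V W M f" and t: "linear_map K X (tensor K V W) t"
  shows "linear_map K X M (\<lambda>x. sw K n V W M (t x) f)"
  by (rule linear_map_comp[OF linear_sw_tensor[OF assms(1,2)] t])

lemma sw_tot: "module K M \<Longrightarrow> sw K n P Q M t (\<lambda>x y. tot M (f x y)) = sw K n P Q M t f"
  by (simp add: sw_eq_free_ext tot_def if_distrib cong: if_cong)

text \<open>The substitution rule: a tensor that is itself a sum can be fed to any bilinear f, and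
  its sum moves to the front. This is what allows an identity of tensors to be used inside larger
  sums.\<close>

lemma sw_sw [simp]:
  assumes M: "module K M" and f: "bilinear_map K V W M f"
  shows "sw K n V W M (sw K m P Q (tensor K V W) t g) f
    = sw K m P Q M t (\<lambda>p q. sw K n V W M (g p q) f)"
proof -
  interpret T: module K "tensor K V W" by (rule module_tensor)
  have z: "sw K n V W M \<zero>\<^bsub>tensor K V W\<^esub> f = \<zero>\<^bsub>M\<^esub>"
    by (rule linear_map_zero[OF module_tensor M linear_sw_tensor[OF M f]])
  have "sw K n V W M (sw K m P Q (tensor K V W) t g) f
    = sw K n V W M (sw K m P Q (tensor K V W) t (\<lambda>p q. tot (tensor K V W) (g p q))) f"
    by (simp only: sw_tot[OF module_tensor])
  also have "\<dots> = sw K m P Q M t (\<lambda>p q. sw K n V W M (tot (tensor K V W) (g p q)) f)"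
    by (rule linear_map_sw[OF module_tensor M linear_sw_tensor[OF M f]]) simp
  also have "\<dots> = sw K m P Q M t (\<lambda>p q. sw K n V W M (g p q) f)"
  proof -
    \<comment> \<open>Outside the carrier both sides vanish: the left by linearity, at the zero
      tensor that \<open>tot\<close> supplies, the right by the default value in
      \<open>sw\<close>.\<close>
    have "sw K n V W M (tot (tensor K V W) s) f = sw K n V W M s f" for s
      using z by (simp add: tot_def sw_def[where t = s])
    then show ?thesis by simp
  qed
  finally show ?thesis .
qed

lemmas module_tensor' [simp] = module_tensor
lemmas tens_closed' [simp] = tens_closed

lemma linear_tens_left [simp]:
  assumes "linear_map K X V f" "w \<in> carrier W"
  shows "linear_map K X (tensor K V W) (\<lambda>x. tens K V W (f x) w)"
  by (rule linear_map_comp[OF tens_linear_left[OF assms(2)] assms(1)])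

lemma linear_tens_right [simp]:
  assumes "linear_map K X W f" "v \<in> carrier V"
  shows "linear_map K X (tensor K V W) (\<lambda>x. tens K V W v (f x))"
  by (rule linear_map_comp[OF tens_linear_right[OF assms(2)] assms(1)])

lemmas tensor_ext = tensor_linear_eq

text \<open>Taking \<open>tens\<close> as the body turns an identity stated for all bilinear F back
  into an identity of tensors.\<close>

lemma sw_tens_id [simp]:
  assumes "t \<in> carrier (tensor K V W)"
  shows "sw K n V W (tensor K V W) t (tens K V W) = t"
  by (rule tensor_ext[OF module_tensor, where g = "\<lambda>x. x", OF _ _ _ assms])
    (auto simp: linear_sw_tensor module_tensor sw_tens bilinear_map_def tens_linear_left tens_linear_right
       linear_mapI tens_closed)

end

lemma linear_id [simp]: "linear_map K V V (\<lambda>x. x)"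
  by (simp add: linear_map_def)

text \<open>
  The carriers are equated with fresh variables because the simplifier, when it solves a premise,
  does not normalise the assumptions of that premise.
\<close>

lemma bilinear_mapI [simp]:
  assumes "carrier U = CU" "carrier V = CV"
    and "\<And>u. u \<in> CU \<Longrightarrow> linear_map K V M (f u)" "\<And>v. v \<in> CV \<Longrightarrow> linear_map K U M (\<lambda>u. f u v)"
  shows "bilinear_map K U V M f"
  using assms by (simp add: bilinear_map_def)

text \<open>Multilinearity is defined by recursion on the number of arguments, so that the
  simplifier can peel off one argument at a time. Five arguments suffice: that many are needed for
  one strand of coassociativity in A # H # B.\<close>

definition trilinear_map where
  "trilinear_map K U V W M f \<longleftrightarrow> (\<forall>u\<in>carrier U. bilinear_map K V W M (f u))
    \<and> (\<forall>v\<in>carrier V. \<forall>w\<in>carrier W. linear_map K U M (\<lambda>u. f u v w))"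

definition quadrilinear_map where
  "quadrilinear_map K T U V W M f \<longleftrightarrow> (\<forall>t\<in>carrier T. trilinear_map K U V W M (f t))
    \<and> (\<forall>u\<in>carrier U. \<forall>v\<in>carrier V. \<forall>w\<in>carrier W. linear_map K T M (\<lambda>t. f t u v w))"

definition quinquelinear_map where
  "quinquelinear_map K S T U V W M f \<longleftrightarrow> (\<forall>s\<in>carrier S. quadrilinear_map K T U V W M (f s))
    \<and> (\<forall>t\<in>carrier T. \<forall>u\<in>carrier U. \<forall>v\<in>carrier V. \<forall>w\<in>carrier W. linear_map K S M (\<lambda>s. f s t u v w))"

lemma multilinear_mapI [simp]:
  "\<lbrakk>carrier U = CU; carrier V = CV; carrier W = CW;
    \<And>u. u \<in> CU \<Longrightarrow> bilinear_map K V W M (f3 u);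
    \<And>v w. \<lbrakk>v \<in> CV; w \<in> CW\<rbrakk> \<Longrightarrow> linear_map K U M (\<lambda>u. f3 u v w)\<rbrakk>
    \<Longrightarrow> trilinear_map K U V W M f3"
  "\<lbrakk>carrier T = CT; carrier U = CU; carrier V = CV; carrier W = CW;
    \<And>t. t \<in> CT \<Longrightarrow> trilinear_map K U V W M (f4 t);
    \<And>u v w. \<lbrakk>u \<in> CU; v \<in> CV; w \<in> CW\<rbrakk> \<Longrightarrow> linear_map K T M (\<lambda>t. f4 t u v w)\<rbrakk>
    \<Longrightarrow> quadrilinear_map K T U V W M f4"
  "\<lbrakk>carrier S = CS; carrier T = CT; carrier U = CU; carrier V = CV; carrier W = CW;
    \<And>s. s \<in> CS \<Longrightarrow> quadrilinear_map K T U V W M (f5 s);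
    \<And>t u v w. \<lbrakk>t \<in> CT; u \<in> CU; v \<in> CV; w \<in> CW\<rbrakk>
      \<Longrightarrow> linear_map K S M (\<lambda>s. f5 s t u v w)\<rbrakk>
    \<Longrightarrow> quinquelinear_map K S T U V W M f5"
  by (simp_all add: trilinear_map_def quadrilinear_map_def quinquelinear_map_def)

text \<open>The linearity clauses are stated for compositions with linear maps. Added to the simp
  set for a fixed F, they prove linearity of terms in which F is applied to compound
  arguments.\<close>

lemma bilinear_rules:
  assumes "bilinear_map K U V M f"
  shows "\<lbrakk>u \<in> carrier U; v \<in> carrier V\<rbrakk> \<Longrightarrow> f u v \<in> carrier M"
    and "\<lbrakk>linear_map K X1 U g1; v \<in> carrier V\<rbrakk> \<Longrightarrow> linear_map K X1 M (\<lambda>x. f (g1 x) v)"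
    and "\<lbrakk>linear_map K X2 V g2; u \<in> carrier U\<rbrakk> \<Longrightarrow> linear_map K X2 M (\<lambda>x. f u (g2 x))"
    and "\<lbrakk>c \<in> carrier K; u \<in> carrier U; v \<in> carrier V\<rbrakk> \<Longrightarrow> f (c \<odot>\<^bsub>U\<^esub> u) v = c \<odot>\<^bsub>M\<^esub> f u v"
    and "\<lbrakk>c \<in> carrier K; u \<in> carrier U; v \<in> carrier V\<rbrakk> \<Longrightarrow> f u (c \<odot>\<^bsub>V\<^esub> v) = c \<odot>\<^bsub>M\<^esub> f u v"
  using assms by (auto simp: bilinear_map_def dest: linear_map_closed linear_map_smult
      intro: linear_map_comp[of K V M "f u"] linear_map_comp[of K U M "\<lambda>u. f u v"])

lemma trilinear_rules:
  assumes "trilinear_map K U V W M f"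
  shows "\<lbrakk>u \<in> carrier U; v \<in> carrier V; w \<in> carrier W\<rbrakk> \<Longrightarrow> f u v w \<in> carrier M"
    and "\<lbrakk>linear_map K X1 U g1; v \<in> carrier V; w \<in> carrier W\<rbrakk> \<Longrightarrow> linear_map K X1 M (\<lambda>x. f (g1 x) v w)"
    and "\<lbrakk>linear_map K X2 V g2; u \<in> carrier U; w \<in> carrier W\<rbrakk> \<Longrightarrow> linear_map K X2 M (\<lambda>x. f u (g2 x) w)"
    and "\<lbrakk>linear_map K X3 W g3; u \<in> carrier U; v \<in> carrier V\<rbrakk> \<Longrightarrow> linear_map K X3 M (\<lambda>x. f u v (g3 x))"
  using assms bilinear_rules(1-3)[of K V W M "f u"]
  by (auto simp: trilinear_map_def intro: linear_map_comp[of K U M "\<lambda>u. f u v w"])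

lemma quadrilinear_rules:
  assumes "quadrilinear_map K T U V W M f"
  shows "\<lbrakk>t \<in> carrier T; u \<in> carrier U; v \<in> carrier V; w \<in> carrier W\<rbrakk> \<Longrightarrow> f t u v w \<in> carrier M"
    and "\<lbrakk>linear_map K X1 T g1; u \<in> carrier U; v \<in> carrier V; w \<in> carrier W\<rbrakk>
      \<Longrightarrow> linear_map K X1 M (\<lambda>x. f (g1 x) u v w)"
    and "\<lbrakk>linear_map K X2 U g2; t \<in> carrier T; v \<in> carrier V; w \<in> carrier W\<rbrakk>
      \<Longrightarrow> linear_map K X2 M (\<lambda>x. f t (g2 x) v w)"
    and "\<lbrakk>linear_map K X3 V g3; t \<in> carrier T; u \<in> carrier U; w \<in> carrier W\<rbrakk>
      \<Longrightarrow> linear_map K X3 M (\<lambda>x. f t u (g3 x) w)"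
    and "\<lbrakk>linear_map K X4 W g4; t \<in> carrier T; u \<in> carrier U; v \<in> carrier V\<rbrakk>
      \<Longrightarrow> linear_map K X4 M (\<lambda>x. f t u v (g4 x))"
  using assms trilinear_rules[of K U V W M "f t"]
  by (auto simp: quadrilinear_map_def intro: linear_map_comp[of K T M "\<lambda>t. f t u v w"])

lemma quinquelinear_rules:
  assumes "quinquelinear_map K S T U V W M f"
  shows "\<lbrakk>s \<in> carrier S; t \<in> carrier T; u \<in> carrier U; v \<in> carrier V; w \<in> carrier W\<rbrakk>
      \<Longrightarrow> f s t u v w \<in> carrier M"
    and "\<lbrakk>linear_map K X1 S g1; t \<in> carrier T; u \<in> carrier U; v \<in> carrier V; w \<in> carrier W\<rbrakk>
      \<Longrightarrow> linear_map K X1 M (\<lambda>x. f (g1 x) t u v w)"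
    and "\<lbrakk>linear_map K X2 T g2; s \<in> carrier S; u \<in> carrier U; v \<in> carrier V; w \<in> carrier W\<rbrakk>
      \<Longrightarrow> linear_map K X2 M (\<lambda>x. f s (g2 x) u v w)"
    and "\<lbrakk>linear_map K X3 U g3; s \<in> carrier S; t \<in> carrier T; v \<in> carrier V; w \<in> carrier W\<rbrakk>
      \<Longrightarrow> linear_map K X3 M (\<lambda>x. f s t (g3 x) v w)"
    and "\<lbrakk>linear_map K X4 V g4; s \<in> carrier S; t \<in> carrier T; u \<in> carrier U; w \<in> carrier W\<rbrakk>
      \<Longrightarrow> linear_map K X4 M (\<lambda>x. f s t u (g4 x) w)"
    and "\<lbrakk>linear_map K X5 W g5; s \<in> carrier S; t \<in> carrier T; u \<in> carrier U; v \<in> carrier V\<rbrakk>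
      \<Longrightarrow> linear_map K X5 M (\<lambda>x. f s t u v (g5 x))"
  using assms quadrilinear_rules[of K T U V W M "f s"]
  by (auto simp: quinquelinear_map_def intro: linear_map_comp[of K S M "\<lambda>s. f s t u v w"])

text \<open>Linearity is proved by matching on the shape of the map, which must not be rewritten.\<close>

lemma linear_map_weak_cong [cong]: "V = V' \<Longrightarrow> linear_map K V W f = linear_map K V' W f"
  by simp

lemma bilinear_map_weak_cong [cong]: "V = V' \<Longrightarrow> bilinear_map K U V W f = bilinear_map K U V' W f"
  by simp

lemma multilinear_map_weak_cong [cong]:
  "V = V' \<Longrightarrow> trilinear_map K U V W M f3 = trilinear_map K U V' W M f3"
  "V = V' \<Longrightarrow> quadrilinear_map K T U V W M f4 = quadrilinear_map K T U V' W M f4"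
  "V = V' \<Longrightarrow> quinquelinear_map K S T U V W M f5 = quinquelinear_map K S T U V' W M f5"
  by simp_all

subsection \<open>Scalars\<close>

lemma base_space_simps [simp]:
  "carrier (base_space K) = carrier K" "zero (base_space K) = zero K" "add (base_space K) = add K"
  "smult (base_space K) = mult K" "mult (base_space K) = mult K" "one (base_space K) = one K"
  by (simp_all add: base_space_def)

lemma (in cring) module_base_space [simp]: "module R (base_space R)"
proof (rule moduleI)
  show "abelian_group (base_space R)"
    by (rule abelian_groupI) (auto simp: a_ac intro: bexI[of _ "\<ominus> x" for x] l_neg)
qed (auto simp: l_distr r_distr m_assoc is_cring)

lemma (in cring) sw_base_closed [simp]: "sw R n V W (base_space R) t f \<in> carrier R"
  using sw_closed[OF module_base_space] by simp

lemma linear_smult_left [simp]: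
  assumes "module K V" "linear_map K X (base_space K) c" "v \<in> carrier V"
  shows "linear_map K X V (\<lambda>x. c x \<odot>\<^bsub>V\<^esub> v)"
proof -
  interpret V: module K V by fact
  show ?thesis using assms(2,3) by (auto simp: linear_map_def Pi_iff V.smult_l_distr V.smult_assoc1)
qed

lemma linear_smult_right [simp]:
  assumes "module K V" "linear_map K X V f" "c \<in> carrier K"
  shows "linear_map K X V (\<lambda>x. c \<odot>\<^bsub>V\<^esub> f x)"
proof -
  interpret V: module K V by fact
  show ?thesis using assms(2,3)
    by (auto simp: linear_map_def Pi_iff V.smult_r_distr V.smult_assoc1[symmetric] V.R.m_comm)
qed

lemma (in cring) linear_base_mult [simp]:
  "\<lbrakk>linear_map R X (base_space R) f; c \<in> carrier R\<rbrakk> \<Longrightarrow> linear_map R X (base_space R) (\<lambda>x. f x \<otimes> c)"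
  "\<lbrakk>linear_map R X (base_space R) f; c \<in> carrier R\<rbrakk> \<Longrightarrow> linear_map R X (base_space R) (\<lambda>x. c \<otimes> f x)"
  by (auto simp: linear_map_def Pi_iff l_distr r_distr m_assoc m_lcomm)

lemma sw_smult:
  assumes M: "module K M" and "c \<in> carrier K"
    and "\<And>x y. \<lbrakk>x \<in> carrier V; y \<in> carrier W\<rbrakk> \<Longrightarrow> f x y \<in> carrier M"
  shows "sw K n V W M t (\<lambda>x y. c \<odot>\<^bsub>M\<^esub> f x y) = c \<odot>\<^bsub>M\<^esub> sw K n V W M t f"
  by (rule linear_map_sw[OF M M linear_smult_right[OF M linear_id assms(2)] assms(3), symmetric])

lemma (in cring) sw_base_mult:
  assumes "c \<in> carrier R" "\<And>x y. \<lbrakk>x \<in> carrier V; y \<in> carrier W\<rbrakk> \<Longrightarrow> f x y \<in> carrier R"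
  shows "sw R n V W (base_space R) t (\<lambda>x y. c \<otimes> f x y) = c \<otimes> sw R n V W (base_space R) t f"
  using sw_smult[OF module_base_space assms(1), of V W f n t] assms(2) by simp

lemma sw_smult_tensor:
  assumes "module K V" "module K W" "module K M" "bilinear_map K V W M f"
    and "c \<in> carrier K" "t \<in> carrier (tensor K V W)"
  shows "sw K n V W M (c \<odot>\<^bsub>tensor K V W\<^esub> t) f = c \<odot>\<^bsub>M\<^esub> sw K n V W M t f"
  by (rule linear_map_smult[OF linear_sw_tensor[OF assms(1-4)] assms(5,6)])

lemma tens_smult:
  assumes "module K V" "module K W" "c \<in> carrier K" "v \<in> carrier V" "w \<in> carrier W"
  shows "tens K V W (c \<odot>\<^bsub>V\<^esub> v) w = c \<odot>\<^bsub>tensor K V W\<^esub> tens K V W v w"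
    and "tens K V W v (c \<odot>\<^bsub>W\<^esub> w) = c \<odot>\<^bsub>tensor K V W\<^esub> tens K V W v w"
  using linear_map_smult[OF linear_tens_left[OF assms(1,2) linear_id assms(5)] assms(3,4)]
    linear_map_smult[OF linear_tens_right[OF assms(1,2) linear_id assms(4)] assms(3,5)] by auto

lemmas smult_out = sw_smult sw_smult_tensor tens_smult

subsection \<open>Algebras and coalgebras\<close>

context assoc_algebra
begin

lemma module_A [simp]: "module K A" by (rule A.module_axioms)

lemma linear_mult [simp]:
  "\<lbrakk>linear_map K X A f; y \<in> carrier A\<rbrakk> \<Longrightarrow> linear_map K X A (\<lambda>x. f x \<otimes>\<^bsub>A\<^esub> y)"
  "\<lbrakk>linear_map K X A f; y \<in> carrier A\<rbrakk> \<Longrightarrow> linear_map K X A (\<lambda>x. y \<otimes>\<^bsub>A\<^esub> f x)"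
  by (auto simp: linear_map_def Pi_iff A.l_distr A.r_distr smult_mult_left smult_mult_right)

end

context coalgebra
begin

lemma module_C [simp]: "module K C" by (rule C.module_axioms)

lemma comult_closed [simp]: "c \<in> carrier C \<Longrightarrow> comult C c \<in> carrier (tensor K C C)"
  by (rule linear_map_closed[OF comult_linear])

lemma counit_closed [simp]: "c \<in> carrier C \<Longrightarrow> counit C c \<in> carrier K"
  using linear_map_closed[OF counit_linear] by simp

lemma linear_comult [simp]: "linear_map K X C f \<Longrightarrow> linear_map K X (tensor K C C) (\<lambda>x. comult C (f x))"
  by (rule linear_map_comp[OF comult_linear])

lemma linear_counit [simp]: "linear_map K X C f \<Longrightarrow> linear_map K X (base_space K) (\<lambda>x. counit C (f x))"
  by (rule linear_map_comp[OF counit_linear])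

lemma sweedler_comult:
  assumes "module K M" "c \<in> carrier C" "\<And>x y. \<lbrakk>x \<in> carrier C; y \<in> carrier C\<rbrakk> \<Longrightarrow> f x y \<in> carrier M"
  shows "sweedler K M (comult C c) f = sw K 0 C C M (comult C c) f"
  by (rule sweedler_eq_sw) (simp_all add: assms)

text \<open>F induces a linear map \<open>?ev\<close> on the triple tensor product; applying it to
  both sides of the axiom gives the claim. The other axioms that are identities of tensors, for
  coactions and Yetter-Drinfeld modules, are put into this form in the same way.\<close>

lemma coassoc_sw:
  assumes F: "trilinear_map K C C C M F" and M [simp]: "module K M" and c [simp]: "c \<in> carrier C"
  shows "sw K 0 C C M (comult C c) (\<lambda>x y. sw K 0 C C M (comult C x) (\<lambda>x1 x2. F x1 x2 y))
    = sw K 0 C C M (comult C c) (\<lambda>x y. sw K 0 C C M (comult C y) (\<lambda>y1 y2. F x y1 y2))"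
proof -
  note [simp] = trilinear_rules[OF F]
  let ?ev = "\<lambda>T. sw K 0 C (tensor K C C) M T (\<lambda>x s. sw K 0 C C M s (\<lambda>y z. F x y z))"
  from arg_cong[where f = ?ev, OF coassoc[OF c]] show ?thesis
    by (simp add: sweedler_comult)
qed

text \<open>The counit law with an arbitrary linear f applied to it, which makes it usable on a leg
  deep inside another expression.\<close>

lemma counit_sw:
  assumes f [simp]: "linear_map K C M f" and M [simp]: "module K M" and c [simp]: "c \<in> carrier C"
  shows "sw K 0 C C M (comult C c) (\<lambda>x y. counit C x \<odot>\<^bsub>M\<^esub> f y) = f c"
    and "sw K 0 C C M (comult C c) (\<lambda>x y. counit C y \<odot>\<^bsub>M\<^esub> f x) = f c"
proof -
  note [simp] = linear_map_smult[OF f]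
  have cl: "a \<in> carrier K \<Longrightarrow> v \<in> carrier C \<Longrightarrow> a \<odot>\<^bsub>C\<^esub> v \<in> carrier C" for a v by simp
  from counit_left[OF c] have "f (sw K 0 C C C (comult C c) (\<lambda>x y. counit C x \<odot>\<^bsub>C\<^esub> y)) = f c"
    by (simp add: sweedler_comult)
  then show "sw K 0 C C M (comult C c) (\<lambda>x y. counit C x \<odot>\<^bsub>M\<^esub> f y) = f c"
    by (subst (asm) linear_map_sw[OF _ _ f]) simp_all
  from counit_right[OF c] have "f (sw K 0 C C C (comult C c) (\<lambda>x y. counit C y \<odot>\<^bsub>C\<^esub> x)) = f c"
    by (simp add: sweedler_comult)
  then show "sw K 0 C C M (comult C c) (\<lambda>x y. counit C y \<odot>\<^bsub>M\<^esub> f x) = f c"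
    by (subst (asm) linear_map_sw[OF _ _ f]) simp_all
qed

lemma counit_base_sw:
  assumes "linear_map K C (base_space K) f" "c \<in> carrier C"
  shows "sw K 0 C C (base_space K) (comult C c) (\<lambda>x y. counit C x \<otimes> f y) = f c"
    and "sw K 0 C C (base_space K) (comult C c) (\<lambda>x y. counit C y \<otimes> f x) = f c"
  using counit_sw[OF assms(1) _ assms(2)] by simp_all

end

lemma sweedler_tens_eq_sw:
  assumes "module K V" "module K W" "module K M" "v \<in> carrier V" "w \<in> carrier W"
    "\<And>x y. \<lbrakk>x \<in> carrier V; y \<in> carrier W\<rbrakk> \<Longrightarrow> f x y \<in> carrier M"
  shows "sweedler K M (tens K V W v w) f = sw K 0 V W M (tens K V W v w) f"
  by (rule sweedler_eq_sw) (simp_all add: assms)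

lemma tensor_coalg_simps:
  "carrier (tensor_coalg K V W) = carrier (tensor K V W)"
  "zero (tensor_coalg K V W) = zero (tensor K V W)"
  "add (tensor_coalg K V W) = add (tensor K V W)"
  "smult (tensor_coalg K V W) = smult (tensor K V W)"
  "one (tensor_coalg K V W) = tens K V W \<one>\<^bsub>V\<^esub> \<one>\<^bsub>W\<^esub>"
  by (simp_all add: tensor_coalg_def Let_def)

context bialgebra
begin

abbreviation mult_H (infixl \<open>\<cdot>\<close> 70) where
  "x \<cdot> y \<equiv> x \<otimes>\<^bsub>H\<^esub> y"

lemma comult_mult_sw:
  assumes F: "bilinear_map K H H M F" and M [simp]: "module K M"
    and x [simp]: "x \<in> carrier H" and y [simp]: "y \<in> carrier H"
  shows "sw K 0 H H M (comult H (x \<cdot> y)) F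
    = sw K 0 H H M (comult H x) (\<lambda>x1 x2. sw K 0 H H M (comult H y) (\<lambda>y1 y2. F (x1 \<cdot> y1) (x2 \<cdot> y2)))"
proof -
  note [simp] = bilinear_rules[OF F]
  have "comult H (x \<cdot> y) = sw K 0 H H (tensor K H H) (comult H x) (\<lambda>x1 x2.
    sw K 0 H H (tensor K H H) (comult H y) (\<lambda>y1 y2. tens K H H (x1 \<cdot> y1) (x2 \<cdot> y2)))"
    by (simp add: comult_mult tensor_coalg_def Let_def sweedler_comult)
  then show ?thesis by simp
qed

lemma comult_one_sw:
  assumes F [simp]: "bilinear_map K H H M F" and M [simp]: "module K M"
  shows "sw K 0 H H M (comult H \<one>\<^bsub>H\<^esub>) F = F \<one>\<^bsub>H\<^esub> \<one>\<^bsub>H\<^esub>"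
  by (simp add: comult_one tensor_coalg_simps)

end

lemma sweedler_sw_eq_sw:
  assumes "module K P" "module K Q" "module K M"
    "\<And>x y. \<lbrakk>x \<in> carrier P; y \<in> carrier Q\<rbrakk> \<Longrightarrow> f x y \<in> carrier M"
  shows "sweedler K M (sw K n V W (tensor K P Q) t g) f = sw K 0 P Q M (sw K n V W (tensor K P Q) t g) f"
  by (rule sweedler_eq_sw) (simp_all add: assms)

subsection \<open>Modules and comodules\<close>

context left_module
begin

lemma module_V [simp]: "module K V" by (rule V.module_axioms)

lemma act_closed [simp]: "\<lbrakk>h \<in> carrier H; v \<in> carrier V\<rbrakk> \<Longrightarrow> act h v \<in> carrier V"
  by (rule bilinear_map_closed[OF act_bilinear])

lemmas linear_act [simp] = bilinear_rules(2,3)[OF act_bilinear]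

end

context right_module
begin

lemma module_V [simp]: "module K V" by (rule V.module_axioms)

lemma act_closed [simp]: "\<lbrakk>h \<in> carrier H; v \<in> carrier V\<rbrakk> \<Longrightarrow> act v h \<in> carrier V"
  by (rule bilinear_map_closed[OF act_bilinear])

lemmas linear_act [simp] = bilinear_rules(2,3)[OF act_bilinear]

end

context left_comodule
begin

lemma module_V [simp]: "module K V" by (rule V.module_axioms)

lemma coact_closed [simp]: "v \<in> carrier V \<Longrightarrow> coact v \<in> carrier (tensor K H V)"
  by (rule linear_map_closed[OF coact_linear])

lemma linear_coact [simp]: "linear_map K X V f \<Longrightarrow> linear_map K X (tensor K H V) (\<lambda>x. coact (f x))"
  by (rule linear_map_comp[OF coact_linear])

lemma sweedler_coact:
  assumes "module K M" "v \<in> carrier V" "\<And>x y. \<lbrakk>x \<in> carrier H; y \<in> carrier V\<rbrakk> \<Longrightarrow> f x y \<in> carrier M"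
  shows "sweedler K M (coact v) f = sw K 0 H V M (coact v) f"
  by (rule sweedler_eq_sw) (simp_all add: assms)

lemma coact_coassoc_sw:
  assumes F: "trilinear_map K H H V M F" and M [simp]: "module K M" and v [simp]: "v \<in> carrier V"
  shows "sw K 0 H V M (coact v) (\<lambda>h v'. sw K 0 H H M (comult H h) (\<lambda>h1 h2. F h1 h2 v'))
    = sw K 0 H V M (coact v) (\<lambda>h v'. sw K 0 H V M (coact v') (\<lambda>g v''. F h g v''))"
proof -
  note [simp] = trilinear_rules[OF F]
  let ?ev = "\<lambda>T. sw K 0 H (tensor K H V) M T (\<lambda>x s. sw K 0 H V M s (\<lambda>y z. F x y z))"
  from arg_cong[where f = ?ev, OF coact_coassoc[OF v]] show ?thesis
    by (simp add: sweedler_comult sweedler_coact)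
qed

lemma coact_counit_sw:
  assumes f [simp]: "linear_map K V M f" and M [simp]: "module K M" and v [simp]: "v \<in> carrier V"
  shows "sw K 0 H V M (coact v) (\<lambda>h v'. counit H h \<odot>\<^bsub>M\<^esub> f v') = f v"
proof -
  note [simp] = linear_map_smult[OF f]
  from coact_counit[OF v] have "f (sw K 0 H V V (coact v) (\<lambda>h v'. counit H h \<odot>\<^bsub>V\<^esub> v')) = f v"
    by (simp add: sweedler_coact)
  then show ?thesis
    by (subst (asm) linear_map_sw[OF _ _ f]) simp_all
qed

end

context right_comodule
begin

lemma module_V [simp]: "module K V" by (rule V.module_axioms)

lemma coact_closed [simp]: "v \<in> carrier V \<Longrightarrow> coact v \<in> carrier (tensor K V H)"
  by (rule linear_map_closed[OF coact_linear])

lemma linear_coact [simp]: "linear_map K X V f \<Longrightarrow> linear_map K X (tensor K V H) (\<lambda>x. coact (f x))"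
  by (rule linear_map_comp[OF coact_linear])

lemma sweedler_coact:
  assumes "module K M" "v \<in> carrier V" "\<And>x y. \<lbrakk>x \<in> carrier V; y \<in> carrier H\<rbrakk> \<Longrightarrow> f x y \<in> carrier M"
  shows "sweedler K M (coact v) f = sw K 0 V H M (coact v) f"
  by (rule sweedler_eq_sw) (simp_all add: assms)

lemma coact_coassoc_sw:
  assumes F: "trilinear_map K V H H M F" and M [simp]: "module K M" and v [simp]: "v \<in> carrier V"
  shows "sw K 0 V H M (coact v) (\<lambda>v' h. sw K 0 V H M (coact v') (\<lambda>v'' g. F v'' g h))
    = sw K 0 V H M (coact v) (\<lambda>v' h. sw K 0 H H M (comult H h) (\<lambda>h1 h2. F v' h1 h2))"
proof -
  note [simp] = trilinear_rules[OF F]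
  let ?ev = "\<lambda>T. sw K 0 V (tensor K H H) M T (\<lambda>x s. sw K 0 H H M s (\<lambda>y z. F x y z))"
  from arg_cong[where f = ?ev, OF coact_coassoc[OF v]] show ?thesis
    by (simp add: sweedler_comult sweedler_coact)
qed

lemma coact_counit_sw:
  assumes f [simp]: "linear_map K V M f" and M [simp]: "module K M" and v [simp]: "v \<in> carrier V"
  shows "sw K 0 V H M (coact v) (\<lambda>v' h. counit H h \<odot>\<^bsub>M\<^esub> f v') = f v"
proof -
  note [simp] = linear_map_smult[OF f]
  from coact_counit[OF v] have "f (sw K 0 V H V (coact v) (\<lambda>v' h. counit H h \<odot>\<^bsub>V\<^esub> v')) = f v"
    by (simp add: sweedler_coact)
  then show ?thesis
    by (subst (asm) linear_map_sw[OF _ _ f]) simp_all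
qed

end

subsection \<open>Bialgebras in Yetter-Drinfeld categories\<close>

lemma (in ll_yd_module) yd_sw:
  assumes F: "bilinear_map K H V M F" and M [simp]: "module K M"
    and h [simp]: "h \<in> carrier H" and v [simp]: "v \<in> carrier V"
  shows "sw K 0 H H M (comult H h) (\<lambda>h1 h2. sw K 0 H V M (coact (act h1 v)) (\<lambda>g v'. F (g \<cdot> h2) v'))
    = sw K 0 H H M (comult H h) (\<lambda>h1 h2. sw K 0 H V M (coact v) (\<lambda>g v'. F (h1 \<cdot> g) (act h2 v')))"
proof -
  note [simp] = bilinear_rules[OF F]
  let ?ev = "\<lambda>T. sw K 0 H V M T (\<lambda>x y. F x y)"
  from arg_cong[where f = ?ev, OF yd_condition[OF h v]] show ?thesis
    by (simp add: sweedler_comult sweedler_coact)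
qed

lemma (in rr_yd_module) yd_sw:
  assumes F: "bilinear_map K V H M F" and M [simp]: "module K M"
    and h [simp]: "h \<in> carrier H" and v [simp]: "v \<in> carrier V"
  shows "sw K 0 H H M (comult H h) (\<lambda>h1 h2. sw K 0 V H M (coact (act v h2)) (\<lambda>v' g. F v' (h1 \<cdot> g)))
    = sw K 0 H H M (comult H h) (\<lambda>h1 h2. sw K 0 V H M (coact v) (\<lambda>v' g. F (act v' h1) (g \<cdot> h2)))"
proof -
  note [simp] = bilinear_rules[OF F]
  let ?ev = "\<lambda>T. sw K 0 V H M T (\<lambda>x y. F x y)"
  from arg_cong[where f = ?ev, OF yd_condition[OF h v]] show ?thesis
    by (simp add: sweedler_comult sweedler_coact)
qed

section \<open>Laws of a left-left Yetter-Drinfeld bialgebra in evaluated form\<close>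

context ll_yd_bialgebra
begin

lemmas to_sw = sweedler_comult A.sweedler_comult sweedler_coact sweedler_tens_eq_sw sweedler_sw_eq_sw

text \<open>H-linearity of the multiplication, read at the pure tensor of a and b. The lemmas below
  extract the remaining module and comodule laws from the morphism conditions on multiplication,
  unit, comultiplication and counit.\<close>

lemma act_prod:
  assumes [simp]: "h \<in> carrier H" "a \<in> carrier A" "b \<in> carrier A"
  shows "act h (a \<otimes>\<^bsub>A\<^esub> b) = sw K 0 H H A (comult H h) (\<lambda>h1 h2. act h1 a \<otimes>\<^bsub>A\<^esub> act h2 b)"
proof -
  have "(\<Oplus>[K, A] a \<otimes> b \<in> ll_tensor_act K H A act A act h (tens K A A a b). a \<otimes>\<^bsub>A\<^esub> b)
    = act h (\<Oplus>[K, A] a \<otimes> b \<in> tens K A A a b. a \<otimes>\<^bsub>A\<^esub> b)"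
    using mult_hom unfolding ll_hom_def by simp
  then show ?thesis by (simp add: ll_tensor_act_def to_sw)
qed

lemma act_unit: "h \<in> carrier H \<Longrightarrow> act h \<one>\<^bsub>A\<^esub> = counit H h \<odot>\<^bsub>A\<^esub> \<one>\<^bsub>A\<^esub>"
  using unit_hom unfolding ll_hom_def ll_unit_act_def by (auto dest!: bspec[of _ _ h] bspec[of _ _ "\<one>\<^bsub>K\<^esub>"])

lemma coact_prod_sw:
  assumes F: "bilinear_map K H A M F" and M [simp]: "module K M"
    and [simp]: "a \<in> carrier A" "b \<in> carrier A"
  shows "sw K 0 H A M (coact (a \<otimes>\<^bsub>A\<^esub> b)) F = sw K 0 H A M (coact a) (\<lambda>g a'.
    sw K 0 H A M (coact b) (\<lambda>h b'. F (g \<cdot> h) (a' \<otimes>\<^bsub>A\<^esub> b')))"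
proof -
  note [simp] = bilinear_rules[OF F]
  have "coact (\<Oplus>[K, A] a \<otimes> b \<in> tens K A A a b. a \<otimes>\<^bsub>A\<^esub> b) =
    (\<Oplus>[K, tensor K H A] h \<otimes> v' \<in> ll_tensor_coact K H A coact A coact (tens K A A a b).
      tens K H A h (\<Oplus>[K, A] a \<otimes> b \<in> v'. a \<otimes>\<^bsub>A\<^esub> b))"
    using mult_hom unfolding ll_hom_def by simp
  then have "coact (a \<otimes>\<^bsub>A\<^esub> b) = sw K 0 H A (tensor K H A) (coact a) (\<lambda>g a'.
    sw K 0 H A (tensor K H A) (coact b) (\<lambda>h b'. tens K H A (g \<cdot> h) (a' \<otimes>\<^bsub>A\<^esub> b')))"
    by (simp add: ll_tensor_coact_def to_sw sweedler_eq_sw[where V = A and W = A and n = 0])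
  then show ?thesis by simp
qed

text \<open>Colinearity of the unit map, read at the scalar 1, where the base field carries the
  trivial coaction.\<close>

lemma coact_one: "coact \<one>\<^bsub>A\<^esub> = tens K H A \<one>\<^bsub>H\<^esub> \<one>\<^bsub>A\<^esub>"
proof -
  have conv: "sweedler K (tensor K H A) (tens K H (base_space K) \<one>\<^bsub>H\<^esub> \<one>\<^bsub>K\<^esub>) f = f \<one>\<^bsub>H\<^esub> \<one>\<^bsub>K\<^esub>"
    if "bilinear_map K H (base_space K) (tensor K H A) f" for f
    by (subst sweedler_tens_eq_sw) (simp_all add: that bilinear_map_closed[OF that, simplified])
  have "coact \<one>\<^bsub>A\<^esub> = (\<Oplus>[K, tensor K H A] h \<otimes> c \<in> ll_unit_coact K H \<one>\<^bsub>K\<^esub>. tens K H A h (c \<odot>\<^bsub>A\<^esub> \<one>\<^bsub>A\<^esub>))"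
    using unit_hom[unfolded ll_hom_def, THEN conjunct2, THEN conjunct2, THEN bspec, of "\<one>\<^bsub>K\<^esub>"] by simp
  then show ?thesis by (simp add: ll_unit_coact_def conv)
qed

lemma comult_act_sw:
  assumes F: "bilinear_map K A A M F" and M [simp]: "module K M"
    and [simp]: "h \<in> carrier H" "a \<in> carrier A"
  shows "sw K 0 A A M (comult A (act h a)) F = sw K 0 A A M (comult A a) (\<lambda>a1 a2.
    sw K 0 H H M (comult H h) (\<lambda>h1 h2. F (act h1 a1) (act h2 a2)))"
proof -
  note [simp] = bilinear_rules[OF F]
  have "comult A (act h a) = ll_tensor_act K H A act A act h (comult A a)"
    using comult_hom unfolding ll_hom_def by simp
  then have "comult A (act h a) = sw K 0 H H (tensor K A A) (comult H h) (\<lambda>h1 h2.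
    sw K 0 A A (tensor K A A) (comult A a) (\<lambda>a1 a2. tens K A A (act h1 a1) (act h2 a2)))"
    by (simp add: ll_tensor_act_def to_sw)
  \<comment> \<open>The diagonal action sums over the legs of h first; the stated order, legs of a
    first, agrees with the right-right version.\<close>
  then show ?thesis by (subst sw_swap) simp_all
qed

lemma comult_coact_sw:
  assumes F: "trilinear_map K H A A M F" and M [simp]: "module K M" and [simp]: "a \<in> carrier A"
  shows "sw K 0 A A M (comult A a) (\<lambda>a1 a2. sw K 0 H A M (coact a1) (\<lambda>g a1'.
      sw K 0 H A M (coact a2) (\<lambda>h a2'. F (g \<cdot> h) a1' a2')))
    = sw K 0 H A M (coact a) (\<lambda>g a'. sw K 0 A A M (comult A a') (\<lambda>a1 a2. F g a1 a2))"
proof -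
  note [simp] = trilinear_rules[OF F]
  let ?T = "tensor3 K H A A"
  let ?ev = "\<lambda>T. sw K 0 H (tensor K A A) M T (\<lambda>x s. sw K 0 A A M s (\<lambda>y z. F x y z))"
  have "ll_tensor_coact K H A coact A coact (comult A a)
      = (\<Oplus>[K, ?T] h \<otimes> v' \<in> coact a. tens K H (tensor K A A) h (comult A v'))"
    using comult_hom unfolding ll_hom_def by simp
  from arg_cong[where f = ?ev, OF this] show ?thesis
    by (simp add: ll_tensor_coact_def to_sw)
qed

lemma counit_act: "\<lbrakk>h \<in> carrier H; a \<in> carrier A\<rbrakk> \<Longrightarrow> counit A (act h a) = counit H h \<otimes>\<^bsub>K\<^esub> counit A a"
  using counit_hom unfolding ll_hom_def ll_unit_act_def by auto

text \<open>Colinearity of the counit into the trivial comodule; \<open>?ev\<close> turns the leg in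
  the base field into a scalar.\<close>

lemma counit_coact_sw:
  assumes f [simp]: "linear_map K H M f" and M [simp]: "module K M" and [simp]: "a \<in> carrier A"
  shows "sw K 0 H A M (coact a) (\<lambda>g a'. counit A a' \<odot>\<^bsub>M\<^esub> f g) = counit A a \<odot>\<^bsub>M\<^esub> f \<one>\<^bsub>H\<^esub>"
proof -
  let ?ev = "\<lambda>T. sw K 0 H (base_space K) M T (\<lambda>g c. c \<odot>\<^bsub>M\<^esub> f g)"
  note [simp] = linear_map_closed[OF f] linear_map_comp[OF f]
  have "ll_unit_coact K H (counit A a) = (\<Oplus>[K, tensor K H (base_space K)] h \<otimes> v' \<in> coact a.
      tens K H (base_space K) h (counit A v'))"
    using counit_hom unfolding ll_hom_def by simp
  from arg_cong[where f = ?ev, OF this] show ?thesis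
    by (simp add: ll_unit_coact_def to_sw)
qed

text \<open>Braided multiplicativity with the braiding unfolded: the second leg of a passes the
  first leg of b by coacting on it.\<close>

lemma comult_mult_sw:
  assumes F: "bilinear_map K A A M F" and M [simp]: "module K M"
    and [simp]: "a \<in> carrier A" "b \<in> carrier A"
  shows "sw K 0 A A M (comult A (a \<otimes>\<^bsub>A\<^esub> b)) F = sw K 0 A A M (comult A a) (\<lambda>a1 a2.
    sw K 0 A A M (comult A b) (\<lambda>b1 b2. sw K 0 H A M (coact a2) (\<lambda>g a2'.
      F (a1 \<otimes>\<^bsub>A\<^esub> act g b1) (a2' \<otimes>\<^bsub>A\<^esub> b2))))"
proof -
  note [simp] = bilinear_rules[OF F]
  have "comult A (a \<otimes>\<^bsub>A\<^esub> b) = sw K 0 A A (tensor K A A) (comult A a) (\<lambda>a1 a2.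
    sw K 0 A A (tensor K A A) (comult A b) (\<lambda>b1 b2. sw K 0 H A (tensor K A A) (coact a2) (\<lambda>g a2'.
      tens K A A (a1 \<otimes>\<^bsub>A\<^esub> act g b1) (a2' \<otimes>\<^bsub>A\<^esub> b2))))"
    by (simp add: braided_comult_mult ll_braided_mult_def ll_braiding_def Let_def to_sw)
  then show ?thesis by simp
qed

lemma comult_one_sw:
  assumes F [simp]: "bilinear_map K A A M F" and M [simp]: "module K M"
  shows "sw K 0 A A M (comult A \<one>\<^bsub>A\<^esub>) F = F \<one>\<^bsub>A\<^esub> \<one>\<^bsub>A\<^esub>"
  by (simp add: braided_comult_one)

lemma coact_one_sw:
  assumes F [simp]: "bilinear_map K H A M F" and M [simp]: "module K M"
  shows "sw K 0 H A M (coact \<one>\<^bsub>A\<^esub>) F = F \<one>\<^bsub>H\<^esub> \<one>\<^bsub>A\<^esub>"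
  by (simp add: coact_one)

end

section \<open>Laws of a right-right Yetter-Drinfeld bialgebra in evaluated form\<close>

context rr_yd_bialgebra
begin

lemmas to_sw = sweedler_comult B.sweedler_comult sweedler_coact sweedler_tens_eq_sw sweedler_sw_eq_sw

lemma act_prod:
  assumes [simp]: "h \<in> carrier H" "a \<in> carrier B" "b \<in> carrier B"
  shows "act (a \<otimes>\<^bsub>B\<^esub> b) h = sw K 0 H H B (comult H h) (\<lambda>h1 h2. act a h1 \<otimes>\<^bsub>B\<^esub> act b h2)"
proof -
  have "(\<Oplus>[K, B] a \<otimes> b \<in> rr_tensor_act K H B act B act (tens K B B a b) h. a \<otimes>\<^bsub>B\<^esub> b)
    = act (\<Oplus>[K, B] a \<otimes> b \<in> tens K B B a b. a \<otimes>\<^bsub>B\<^esub> b) h"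
    using mult_hom unfolding rr_hom_def by simp
  then show ?thesis by (simp add: rr_tensor_act_def to_sw)
qed

lemma act_unit: "h \<in> carrier H \<Longrightarrow> act \<one>\<^bsub>B\<^esub> h = counit H h \<odot>\<^bsub>B\<^esub> \<one>\<^bsub>B\<^esub>"
  using unit_hom unfolding rr_hom_def rr_unit_act_def by (auto dest!: bspec[of _ _ h] bspec[of _ _ "\<one>\<^bsub>K\<^esub>"])

lemma coact_prod_sw:
  assumes F: "bilinear_map K B H M F" and M [simp]: "module K M"
    and [simp]: "a \<in> carrier B" "b \<in> carrier B"
  shows "sw K 0 B H M (coact (a \<otimes>\<^bsub>B\<^esub> b)) F = sw K 0 B H M (coact a) (\<lambda>a' g.
    sw K 0 B H M (coact b) (\<lambda>b' h. F (a' \<otimes>\<^bsub>B\<^esub> b') (g \<cdot> h)))"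
proof -
  note [simp] = bilinear_rules[OF F]
  have "coact (\<Oplus>[K, B] a \<otimes> b \<in> tens K B B a b. a \<otimes>\<^bsub>B\<^esub> b) =
    (\<Oplus>[K, tensor K B H] v' \<otimes> h \<in> rr_tensor_coact K H B coact B coact (tens K B B a b).
      tens K B H (\<Oplus>[K, B] a \<otimes> b \<in> v'. a \<otimes>\<^bsub>B\<^esub> b) h)"
    using mult_hom unfolding rr_hom_def by simp
  then have "coact (a \<otimes>\<^bsub>B\<^esub> b) = sw K 0 B H (tensor K B H) (coact a) (\<lambda>a' g.
    sw K 0 B H (tensor K B H) (coact b) (\<lambda>b' h. tens K B H (a' \<otimes>\<^bsub>B\<^esub> b') (g \<cdot> h)))"
    by (simp add: rr_tensor_coact_def Let_def to_sw sweedler_eq_sw[where V = B and W = B and n = 0])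
  then show ?thesis by simp
qed

lemma coact_one: "coact \<one>\<^bsub>B\<^esub> = tens K B H \<one>\<^bsub>B\<^esub> \<one>\<^bsub>H\<^esub>"
proof -
  have conv: "sweedler K (tensor K B H) (tens K (base_space K) H \<one>\<^bsub>K\<^esub> \<one>\<^bsub>H\<^esub>) f = f \<one>\<^bsub>K\<^esub> \<one>\<^bsub>H\<^esub>"
    if "bilinear_map K (base_space K) H (tensor K B H) f" for f
    by (subst sweedler_tens_eq_sw) (simp_all add: that bilinear_map_closed[OF that, simplified])
  have "coact \<one>\<^bsub>B\<^esub> = (\<Oplus>[K, tensor K B H] c \<otimes> h \<in> rr_unit_coact K H \<one>\<^bsub>K\<^esub>. tens K B H (c \<odot>\<^bsub>B\<^esub> \<one>\<^bsub>B\<^esub>) h)"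
    using unit_hom[unfolded rr_hom_def, THEN conjunct2, THEN conjunct2, THEN bspec, of "\<one>\<^bsub>K\<^esub>"] by simp
  then show ?thesis by (simp add: rr_unit_coact_def conv)
qed

lemma comult_act_sw:
  assumes F: "bilinear_map K B B M F" and M [simp]: "module K M"
    and [simp]: "h \<in> carrier H" "a \<in> carrier B"
  shows "sw K 0 B B M (comult B (act a h)) F = sw K 0 B B M (comult B a) (\<lambda>a1 a2.
    sw K 0 H H M (comult H h) (\<lambda>h1 h2. F (act a1 h1) (act a2 h2)))"
proof -
  note [simp] = bilinear_rules[OF F]
  have "comult B (act a h) = rr_tensor_act K H B act B act (comult B a) h"
    using comult_hom unfolding rr_hom_def by simp
  then have "comult B (act a h) = sw K 0 B B (tensor K B B) (comult B a) (\<lambda>a1 a2.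
    sw K 0 H H (tensor K B B) (comult H h) (\<lambda>h1 h2. tens K B B (act a1 h1) (act a2 h2)))"
    by (simp add: rr_tensor_act_def to_sw)
  then show ?thesis by simp
qed

lemma comult_coact_sw:
  assumes F: "trilinear_map K B B H M F" and M [simp]: "module K M" and [simp]: "a \<in> carrier B"
  shows "sw K 0 B B M (comult B a) (\<lambda>a1 a2. sw K 0 B H M (coact a1) (\<lambda>a1' g.
      sw K 0 B H M (coact a2) (\<lambda>a2' h. F a1' a2' (g \<cdot> h))))
    = sw K 0 B H M (coact a) (\<lambda>a' g. sw K 0 B B M (comult B a') (\<lambda>a1 a2. F a1 a2 g))"
proof -
  note [simp] = trilinear_rules[OF F]
  let ?T = "tensor K (tensor K B B) H"
  let ?ev = "\<lambda>T. sw K 0 (tensor K B B) H M T (\<lambda>s z. sw K 0 B B M s (\<lambda>x y. F x y z))"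
  have "rr_tensor_coact K H B coact B coact (comult B a)
      = (\<Oplus>[K, ?T] v' \<otimes> h \<in> coact a. tens K (tensor K B B) H (comult B v') h)"
    using comult_hom unfolding rr_hom_def by simp
  from arg_cong[where f = ?ev, OF this] show ?thesis
    by (simp add: rr_tensor_coact_def Let_def to_sw)
qed

lemma counit_act: "\<lbrakk>h \<in> carrier H; a \<in> carrier B\<rbrakk> \<Longrightarrow> counit B (act a h) = counit B a \<otimes>\<^bsub>K\<^esub> counit H h"
  using counit_hom unfolding rr_hom_def rr_unit_act_def by auto

lemma counit_coact_sw:
  assumes f [simp]: "linear_map K H M f" and M [simp]: "module K M" and [simp]: "a \<in> carrier B"
  shows "sw K 0 B H M (coact a) (\<lambda>a' g. counit B a' \<odot>\<^bsub>M\<^esub> f g) = counit B a \<odot>\<^bsub>M\<^esub> f \<one>\<^bsub>H\<^esub>"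
proof -
  let ?ev = "\<lambda>T. sw K 0 (base_space K) H M T (\<lambda>c g. c \<odot>\<^bsub>M\<^esub> f g)"
  note [simp] = linear_map_closed[OF f] linear_map_comp[OF f]
  have "rr_unit_coact K H (counit B a) = (\<Oplus>[K, tensor K (base_space K) H] v' \<otimes> h \<in> coact a.
      tens K (base_space K) H (counit B v') h)"
    using counit_hom unfolding rr_hom_def by simp
  from arg_cong[where f = ?ev, OF this] show ?thesis
    by (simp add: rr_unit_coact_def to_sw)
qed

lemma comult_mult_sw:
  assumes F: "bilinear_map K B B M F" and M [simp]: "module K M"
    and [simp]: "a \<in> carrier B" "b \<in> carrier B"
  shows "sw K 0 B B M (comult B (a \<otimes>\<^bsub>B\<^esub> b)) F = sw K 0 B B M (comult B a) (\<lambda>a1 a2.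
    sw K 0 B B M (comult B b) (\<lambda>b1 b2. sw K 0 B H M (coact b1) (\<lambda>b1' g.
      F (a1 \<otimes>\<^bsub>B\<^esub> b1') (act a2 g \<otimes>\<^bsub>B\<^esub> b2))))"
proof -
  note [simp] = bilinear_rules[OF F]
  have "comult B (a \<otimes>\<^bsub>B\<^esub> b) = sw K 0 B B (tensor K B B) (comult B a) (\<lambda>a1 a2.
    sw K 0 B B (tensor K B B) (comult B b) (\<lambda>b1 b2. sw K 0 B H (tensor K B B) (coact b1) (\<lambda>b1' g.
      tens K B B (a1 \<otimes>\<^bsub>B\<^esub> b1') (act a2 g \<otimes>\<^bsub>B\<^esub> b2))))"
    by (simp add: braided_comult_mult rr_braided_mult_def rr_braiding_def Let_def to_sw)
  then show ?thesis by simp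
qed

lemma comult_one_sw:
  assumes F [simp]: "bilinear_map K B B M F" and M [simp]: "module K M"
  shows "sw K 0 B B M (comult B \<one>\<^bsub>B\<^esub>) F = F \<one>\<^bsub>B\<^esub> \<one>\<^bsub>B\<^esub>"
  by (simp add: braided_comult_one)

lemma coact_one_sw:
  assumes F [simp]: "bilinear_map K B H M F" and M [simp]: "module K M"
  shows "sw K 0 B H M (coact \<one>\<^bsub>B\<^esub>) F = F \<one>\<^bsub>B\<^esub> \<one>\<^bsub>H\<^esub>"
  by (simp add: coact_one)

end

section \<open>The contribution of A and H to the axioms of the double biproduct\<close>

context ll_yd_bialgebra
begin

text \<open>The Yetter-Drinfeld condition on the two middle ones of four legs of h. Coassociativity
  regroups the legs until the second and third come from a single comultiplication, where
  \<open>yd_sw\<close> applies, and then regroups them back.\<close>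

lemma coact_act_sw:
  assumes G: "quadrilinear_map K H H A H M G" and [simp]: "module K M"
    and [simp]: "h \<in> carrier H" "c \<in> carrier A"
  shows "sw K 0 H H M (comult H h) (\<lambda>k l. sw K 0 H H M (comult H l) (\<lambda>l1 l2.
      sw K 0 H H M (comult H k) (\<lambda>k1 k2. sw K 0 H A M (coact (act k2 c)) (\<lambda>u v. G k1 (u \<cdot> l1) v l2))))
    = sw K 0 H H M (comult H h) (\<lambda>k l. sw K 0 H H M (comult H k) (\<lambda>k1 k2.
      sw K 0 H H M (comult H l) (\<lambda>l1 l2. sw K 0 H A M (coact c) (\<lambda>u v. G k1 (k2 \<cdot> u) (act l1 v) l2))))"
    (is "?L = ?R")
proof -
  note [simp] = quadrilinear_rules[OF G]
  have "?L = sw K 0 H H M (comult H h) (\<lambda>k l. sw K 0 H H M (comult H k) (\<lambda>k1 k2.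
      sw K 0 H H M (comult H l) (\<lambda>l1 l2. sw K 0 H A M (coact (act k2 c)) (\<lambda>u v. G k1 (u \<cdot> l1) v l2))))"
    by (intro sw_cong refl sw_swap) simp_all
  also have "\<dots> = sw K 0 H H M (comult H h) (\<lambda>k1 m. sw K 0 H H M (comult H m) (\<lambda>k2 l.
      sw K 0 H H M (comult H l) (\<lambda>l1 l2. sw K 0 H A M (coact (act k2 c)) (\<lambda>u v. G k1 (u \<cdot> l1) v l2))))"
    by (rule coassoc_sw) simp_all
  also have "\<dots> = sw K 0 H H M (comult H h) (\<lambda>k1 m. sw K 0 H H M (comult H m) (\<lambda>n l2.
      sw K 0 H H M (comult H n) (\<lambda>k2 l1. sw K 0 H A M (coact (act k2 c)) (\<lambda>u v. G k1 (u \<cdot> l1) v l2))))"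
    by (intro sw_cong refl coassoc_sw[symmetric]) simp_all
  also have "\<dots> = sw K 0 H H M (comult H h) (\<lambda>k1 m. sw K 0 H H M (comult H m) (\<lambda>n l2.
      sw K 0 H H M (comult H n) (\<lambda>k2 l1. sw K 0 H A M (coact c) (\<lambda>u v. G k1 (k2 \<cdot> u) (act l1 v) l2))))"
    by (intro sw_cong refl yd_sw) simp_all
  also have "\<dots> = sw K 0 H H M (comult H h) (\<lambda>k1 m. sw K 0 H H M (comult H m) (\<lambda>k2 l.
      sw K 0 H H M (comult H l) (\<lambda>l1 l2. sw K 0 H A M (coact c) (\<lambda>u v. G k1 (k2 \<cdot> u) (act l1 v) l2))))"
    by (intro sw_cong refl coassoc_sw) simp_all
  also have "\<dots> = ?R"
    by (rule coassoc_sw[symmetric]) simp_all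
  finally show ?thesis .
qed

text \<open>
  The contribution of \<open>A\<close> to \<open>\<Delta> (x y) = \<Delta> x \<Delta> y\<close> in the double biproduct; the last argument of \<open>F\<close>
  receives the leg of \<open>h\<close> that moves on towards \<open>B\<close>.
\<close>

lemma comult_coact_prod_act_sw:
  assumes F: "quadrilinear_map K A H A H M F" and [simp]: "module K M"
    and [simp]: "h \<in> carrier H" "a \<in> carrier A" "c \<in> carrier A"
  shows "sw K 0 H H M (comult H h) (\<lambda>k l. sw K 0 H H M (comult H l) (\<lambda>l1 l2.
      sw K 0 A A M (comult A (a \<otimes>\<^bsub>A\<^esub> act k c)) (\<lambda>p q. sw K 0 H A M (coact q) (\<lambda>u v.
        F p (u \<cdot> l1) v l2))))
    = sw K 0 A A M (comult A a) (\<lambda>a1 a2. sw K 0 H A M (coact a2) (\<lambda>g a3.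
      sw K 0 A A M (comult A c) (\<lambda>c1 c2. sw K 0 H A M (coact c2) (\<lambda>g' c3.
      sw K 0 H H M (comult H h) (\<lambda>k l. sw K 0 H H M (comult H (g \<cdot> k)) (\<lambda>x y.
      sw K 0 H H M (comult H l) (\<lambda>l1 l2.
        F (a1 \<otimes>\<^bsub>A\<^esub> act x c1) (y \<cdot> g') (a3 \<otimes>\<^bsub>A\<^esub> act l1 c3) l2)))))))"
    (is "?L = ?R")
proof -
  note [simp] = quadrilinear_rules[OF F]
  \<comment> \<open>Keys 1 to 4 are given to sums over a and c, keys 10 to 13 to sums over h and to
    the coaction of the translate of c2. Sorting makes the latter the innermost block, in the order
    required by \<open>coact_act_sw\<close>.\<close>
  have "?L = sw K 10 H H M (comult H h) (\<lambda>k l. sw K 11 H H M (comult H l) (\<lambda>l1 l2.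
      sw K 1 A A M (comult A a) (\<lambda>a1 a2. sw K 4 A A M (comult A c) (\<lambda>c1 c2. sw K 12 H H M (comult H k) (\<lambda>k1 k2.
       sw K 2 H A M (coact a2) (\<lambda>g a3. sw K 3 H A M (coact a3) (\<lambda>u v.
       sw K 13 H A M (coact (act k2 c2)) (\<lambda>u' v'.
        F (a1 \<otimes>\<^bsub>A\<^esub> act g (act k1 c1)) (u \<cdot> (u' \<cdot> l1)) (v \<otimes>\<^bsub>A\<^esub> v') l2))))))))"
    by (simp add: sw_relabel0 comult_mult_sw comult_act_sw coact_prod_sw H.A.m_assoc)
  also have "\<dots> = sw K 1 A A M (comult A a) (\<lambda>a1 a2.
       sw K 2 H A M (coact a2) (\<lambda>g a3. sw K 3 H A M (coact a3) (\<lambda>u v.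
       sw K 4 A A M (comult A c) (\<lambda>c1 c2.
       sw K 10 H H M (comult H h) (\<lambda>k l. sw K 11 H H M (comult H l) (\<lambda>l1 l2.
       sw K 12 H H M (comult H k) (\<lambda>k1 k2.
       sw K 13 H A M (coact (act k2 c2)) (\<lambda>u' v'.
        F (a1 \<otimes>\<^bsub>A\<^esub> act g (act k1 c1)) (u \<cdot> (u' \<cdot> l1)) (v \<otimes>\<^bsub>A\<^esub> v') l2))))))))"
    by (simp add: sw_sort)
  \<comment> \<open>Coassociativity of the coaction replaces the second coaction, on a3, by a
    comultiplication of g.\<close>
  also have "\<dots> = sw K 0 A A M (comult A a) (\<lambda>a1 a2.
       sw K 0 H A M (coact a2) (\<lambda>g a3. sw K 0 H H M (comult H g) (\<lambda>g1 g2.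
       sw K 0 A A M (comult A c) (\<lambda>c1 c2.
       sw K 0 H H M (comult H h) (\<lambda>k l. sw K 0 H H M (comult H l) (\<lambda>l1 l2.
       sw K 0 H H M (comult H k) (\<lambda>k1 k2.
       sw K 0 H A M (coact (act k2 c2)) (\<lambda>u' v'.
        F (a1 \<otimes>\<^bsub>A\<^esub> act g1 (act k1 c1)) (g2 \<cdot> (u' \<cdot> l1)) (a3 \<otimes>\<^bsub>A\<^esub> v') l2))))))))"
    unfolding sw_relabel0[OF zero_less_numeral] sw_relabel0[OF zero_less_one]
    by (intro sw_cong refl coact_coassoc_sw[symmetric]) simp_all
  also have "\<dots> = sw K 0 A A M (comult A a) (\<lambda>a1 a2.
       sw K 0 H A M (coact a2) (\<lambda>g a3. sw K 0 H H M (comult H g) (\<lambda>g1 g2.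
       sw K 0 A A M (comult A c) (\<lambda>c1 c2.
       sw K 0 H H M (comult H h) (\<lambda>k l. sw K 0 H H M (comult H k) (\<lambda>k1 k2.
       sw K 0 H H M (comult H l) (\<lambda>l1 l2.
       sw K 0 H A M (coact c2) (\<lambda>g' c3.
        F (a1 \<otimes>\<^bsub>A\<^esub> act g1 (act k1 c1)) (g2 \<cdot> (k2 \<cdot> g')) (a3 \<otimes>\<^bsub>A\<^esub> act l1 c3) l2))))))))"
    by (intro sw_cong refl coact_act_sw) simp_all
  also have "\<dots> = sw K 1 A A M (comult A a) (\<lambda>a1 a2.
       sw K 2 H A M (coact a2) (\<lambda>g a3. sw K 6 H H M (comult H g) (\<lambda>g1 g2.
       sw K 3 A A M (comult A c) (\<lambda>c1 c2.
       sw K 5 H H M (comult H h) (\<lambda>k l. sw K 7 H H M (comult H k) (\<lambda>k1 k2.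
       sw K 8 H H M (comult H l) (\<lambda>l1 l2.
       sw K 4 H A M (coact c2) (\<lambda>g' c3.
        F (a1 \<otimes>\<^bsub>A\<^esub> act g1 (act k1 c1)) (g2 \<cdot> (k2 \<cdot> g')) (a3 \<otimes>\<^bsub>A\<^esub> act l1 c3) l2))))))))"
    by (simp add: sw_relabel0)
  \<comment> \<open>The products of g1, k1 and of g2, k2 are the legs of
    \<open>comult H (g \<cdot> k)\<close>, since \<Delta> is multiplicative on H.\<close>
  also have "\<dots> = ?R"
    by (simp add: sw_sort)
      (simp add: sw_relabel0 H.comult_mult_sw act_mult H.A.m_assoc)
  finally show ?thesis .
qed

text \<open>The A-strand of coassociativity. Coassociativity of the coaction trades the
  comultiplication of g for a second coaction; coassociativity of A then puts the two coacted
  elements into one comultiplication, and colinearity of that comultiplication merges the product of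
  their H-legs into a single coaction.\<close>

lemma comult_coact_coassoc_sw:
  assumes F: "quinquelinear_map K A H A H A M F" and [simp]: "module K M" and [simp]: "a \<in> carrier A"
  shows "sw K 0 A A M (comult A a) (\<lambda>a1 a2. sw K 0 H A M (coact a2) (\<lambda>g w.
      sw K 0 A A M (comult A a1) (\<lambda>p q. sw K 0 H A M (coact q) (\<lambda>u v.
      sw K 0 H H M (comult H g) (\<lambda>g1 g2. F p (u \<cdot> g1) v g2 w)))))
    = sw K 0 A A M (comult A a) (\<lambda>a1 a2. sw K 0 H A M (coact a2) (\<lambda>g w.
      sw K 0 A A M (comult A w) (\<lambda>p q. sw K 0 H A M (coact q) (\<lambda>u v. F a1 g p u v))))"
    (is "?L = ?R")
proof -
  note [simp] = quinquelinear_rules[OF F]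
  have "?L = sw K 1 A A M (comult A a) (\<lambda>a1 a2. sw K 4 H A M (coact a2) (\<lambda>g w.
      sw K 2 A A M (comult A a1) (\<lambda>p q. sw K 3 H A M (coact q) (\<lambda>u v.
      sw K 5 H H M (comult H g) (\<lambda>g1 g2. F p (u \<cdot> g1) v g2 w)))))"
    by (simp add: sw_relabel0)
  also have "\<dots> = sw K 0 A A M (comult A a) (\<lambda>a1 a2. sw K 0 A A M (comult A a1) (\<lambda>p q.
      sw K 0 H A M (coact q) (\<lambda>u v. sw K 0 H A M (coact a2) (\<lambda>g w.
      sw K 0 H H M (comult H g) (\<lambda>g1 g2. F p (u \<cdot> g1) v g2 w)))))"
    by (simp add: sw_sort) (simp add: sw_relabel0)
  also have "\<dots> = sw K 0 A A M (comult A a) (\<lambda>a1 a2. sw K 0 A A M (comult A a1) (\<lambda>p q.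
      sw K 0 H A M (coact q) (\<lambda>u v. sw K 0 H A M (coact a2) (\<lambda>g1 w.
      sw K 0 H A M (coact w) (\<lambda>g2 w'. F p (u \<cdot> g1) v g2 w')))))"
    by (intro sw_cong refl coact_coassoc_sw) simp_all
  also have "\<dots> = sw K 0 A A M (comult A a) (\<lambda>p r. sw K 0 A A M (comult A r) (\<lambda>q a2.
      sw K 0 H A M (coact q) (\<lambda>u v. sw K 0 H A M (coact a2) (\<lambda>g1 w.
      sw K 0 H A M (coact w) (\<lambda>g2 w'. F p (u \<cdot> g1) v g2 w')))))"
    by (rule A.coassoc_sw) simp_all
  also have "\<dots> = ?R"
    by (intro sw_cong refl comult_coact_sw) simp_all
  finally show ?thesis .
qed

end

section \<open>The contribution of B and H to the axioms of the double biproduct\<close>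

context rr_yd_bialgebra
begin

text \<open>Mirror image of the lemma for A: again the two middle ones of four legs of h are brought
  under one comultiplication, where the right-right Yetter-Drinfeld condition applies.\<close>

lemma coact_act_sw:
  assumes G: "quadrilinear_map K H B H H M G" and [simp]: "module K M"
    and [simp]: "h \<in> carrier H" "c \<in> carrier B"
  shows "sw K 0 H H M (comult H h) (\<lambda>k l. sw K 0 H H M (comult H k) (\<lambda>k1 k2.
      sw K 0 H H M (comult H l) (\<lambda>l1 l2. sw K 0 B H M (coact (act c l1)) (\<lambda>u v. G k1 u (k2 \<cdot> v) l2))))
    = sw K 0 H H M (comult H h) (\<lambda>k l. sw K 0 H H M (comult H k) (\<lambda>k1 k2.
      sw K 0 H H M (comult H l) (\<lambda>l1 l2. sw K 0 B H M (coact c) (\<lambda>u v. G k1 (act u k2) (v \<cdot> l1) l2))))"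
    (is "?L = ?R")
proof -
  note [simp] = quadrilinear_rules[OF G]
  have "?L = sw K 0 H H M (comult H h) (\<lambda>k1 m. sw K 0 H H M (comult H m) (\<lambda>k2 l.
      sw K 0 H H M (comult H l) (\<lambda>l1 l2. sw K 0 B H M (coact (act c l1)) (\<lambda>u v. G k1 u (k2 \<cdot> v) l2))))"
    by (rule coassoc_sw) simp_all
  also have "\<dots> = sw K 0 H H M (comult H h) (\<lambda>k1 m. sw K 0 H H M (comult H m) (\<lambda>n l2.
      sw K 0 H H M (comult H n) (\<lambda>k2 l1. sw K 0 B H M (coact (act c l1)) (\<lambda>u v. G k1 u (k2 \<cdot> v) l2))))"
    by (intro sw_cong refl coassoc_sw[symmetric]) simp_all
  also have "\<dots> = sw K 0 H H M (comult H h) (\<lambda>k1 m. sw K 0 H H M (comult H m) (\<lambda>n l2.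
      sw K 0 H H M (comult H n) (\<lambda>k2 l1. sw K 0 B H M (coact c) (\<lambda>u v. G k1 (act u k2) (v \<cdot> l1) l2))))"
    by (intro sw_cong refl yd_sw) simp_all
  also have "\<dots> = sw K 0 H H M (comult H h) (\<lambda>k1 m. sw K 0 H H M (comult H m) (\<lambda>k2 l.
      sw K 0 H H M (comult H l) (\<lambda>l1 l2. sw K 0 B H M (coact c) (\<lambda>u v. G k1 (act u k2) (v \<cdot> l1) l2))))"
    by (intro sw_cong refl coassoc_sw) simp_all
  also have "\<dots> = ?R"
    by (rule coassoc_sw[symmetric]) simp_all
  finally show ?thesis .
qed

text \<open>Mirror image of the contribution of A: here the first argument of F receives the leg of
  h that moves on towards A.\<close>

lemma comult_coact_prod_act_sw:
  assumes F: "quadrilinear_map K H B H B M F" and [simp]: "module K M"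
    and [simp]: "h \<in> carrier H" "b \<in> carrier B" "c \<in> carrier B"
  shows "sw K 0 H H M (comult H h) (\<lambda>k l. sw K 0 H H M (comult H k) (\<lambda>k1 k2.
      sw K 0 B B M (comult B (act b l \<otimes>\<^bsub>B\<^esub> c)) (\<lambda>p q. sw K 0 B H M (coact p) (\<lambda>u v.
        F k1 u (k2 \<cdot> v) q))))
    = sw K 0 B B M (comult B b) (\<lambda>b1 b2. sw K 0 B H M (coact b1) (\<lambda>b11 b12.
      sw K 0 B B M (comult B c) (\<lambda>c1 c2. sw K 0 B H M (coact c1) (\<lambda>c11 c12.
      sw K 0 H H M (comult H h) (\<lambda>k l. sw K 0 H H M (comult H k) (\<lambda>k1 k2.
      sw K 0 H H M (comult H (l \<cdot> c12)) (\<lambda>r s.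
        F k1 (act b11 k2 \<otimes>\<^bsub>B\<^esub> c11) (b12 \<cdot> r) (act b2 s \<otimes>\<^bsub>B\<^esub> c2))))))))"
    (is "?L = ?R")
proof -
  note [simp] = quadrilinear_rules[OF F]
  \<comment> \<open>Again the sums over h and the coaction of the translate of b1 get the keys from
    10 on, to become the innermost block.\<close>
  have "?L = sw K 10 H H M (comult H h) (\<lambda>k l. sw K 11 H H M (comult H k) (\<lambda>k1 k2.
      sw K 1 B B M (comult B b) (\<lambda>b1 b2. sw K 12 H H M (comult H l) (\<lambda>l1 l2.
      sw K 2 B B M (comult B c) (\<lambda>c1 c2. sw K 3 B H M (coact c1) (\<lambda>c11 g.
       sw K 13 B H M (coact (act b1 l1)) (\<lambda>w1 z1. sw K 4 B H M (coact c11) (\<lambda>w2 z2.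
        F k1 (w1 \<otimes>\<^bsub>B\<^esub> w2) ((k2 \<cdot> z1) \<cdot> z2) (act (act b2 l2) g \<otimes>\<^bsub>B\<^esub> c2)))))))))"
    by (simp add: sw_relabel0 comult_mult_sw comult_act_sw coact_prod_sw H.A.m_assoc)
  also have "\<dots> = sw K 0 B B M (comult B b) (\<lambda>b1 b2. sw K 0 B B M (comult B c) (\<lambda>c1 c2.
      sw K 0 B H M (coact c1) (\<lambda>c11 g. sw K 0 B H M (coact c11) (\<lambda>w2 z2.
      sw K 0 H H M (comult H h) (\<lambda>k l. sw K 0 H H M (comult H k) (\<lambda>k1 k2.
      sw K 0 H H M (comult H l) (\<lambda>l1 l2. sw K 0 B H M (coact (act b1 l1)) (\<lambda>w1 z1.
        F k1 (w1 \<otimes>\<^bsub>B\<^esub> w2) ((k2 \<cdot> z1) \<cdot> z2) (act (act b2 l2) g \<otimes>\<^bsub>B\<^esub> c2)))))))))"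
    by (simp add: sw_sort) (simp add: sw_relabel0)
  also have "\<dots> = sw K 0 B B M (comult B b) (\<lambda>b1 b2. sw K 0 B B M (comult B c) (\<lambda>c1 c2.
      sw K 0 B H M (coact c1) (\<lambda>c11 g. sw K 0 H H M (comult H g) (\<lambda>g1 g2.
      sw K 0 H H M (comult H h) (\<lambda>k l. sw K 0 H H M (comult H k) (\<lambda>k1 k2.
      sw K 0 H H M (comult H l) (\<lambda>l1 l2. sw K 0 B H M (coact (act b1 l1)) (\<lambda>w1 z1.
        F k1 (w1 \<otimes>\<^bsub>B\<^esub> c11) ((k2 \<cdot> z1) \<cdot> g1) (act (act b2 l2) g2 \<otimes>\<^bsub>B\<^esub> c2)))))))))"
    by (intro sw_cong refl coact_coassoc_sw) simp_all
  also have "\<dots> = sw K 0 B B M (comult B b) (\<lambda>b1 b2. sw K 0 B B M (comult B c) (\<lambda>c1 c2.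
      sw K 0 B H M (coact c1) (\<lambda>c11 g. sw K 0 H H M (comult H g) (\<lambda>g1 g2.
      sw K 0 H H M (comult H h) (\<lambda>k l. sw K 0 H H M (comult H k) (\<lambda>k1 k2.
      sw K 0 H H M (comult H l) (\<lambda>l1 l2. sw K 0 B H M (coact b1) (\<lambda>b11 b12.
        F k1 (act b11 k2 \<otimes>\<^bsub>B\<^esub> c11) ((b12 \<cdot> l1) \<cdot> g1) (act (act b2 l2) g2 \<otimes>\<^bsub>B\<^esub> c2)))))))))"
    by (intro sw_cong refl coact_act_sw) simp_all
  also have "\<dots> = sw K 1 B B M (comult B b) (\<lambda>b1 b2. sw K 3 B B M (comult B c) (\<lambda>c1 c2.
      sw K 4 B H M (coact c1) (\<lambda>c11 g. sw K 8 H H M (comult H g) (\<lambda>g1 g2.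
      sw K 5 H H M (comult H h) (\<lambda>k l. sw K 6 H H M (comult H k) (\<lambda>k1 k2.
      sw K 7 H H M (comult H l) (\<lambda>l1 l2. sw K 2 B H M (coact b1) (\<lambda>b11 b12.
        F k1 (act b11 k2 \<otimes>\<^bsub>B\<^esub> c11) ((b12 \<cdot> l1) \<cdot> g1) (act (act b2 l2) g2 \<otimes>\<^bsub>B\<^esub> c2)))))))))"
    by (simp add: sw_relabel0)
  also have "\<dots> = ?R"
    by (simp add: sw_sort)
      (simp add: sw_relabel0 H.comult_mult_sw act_mult H.A.m_assoc)
  finally show ?thesis .
qed

text \<open>The B-strand of coassociativity, by the same three laws as for A. The calculation starts
  from the right-hand side, which is where the comultiplication of an H-leg sits in the mirror
  image.\<close>

lemma comult_coact_coassoc_sw: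
  assumes F: "quinquelinear_map K B H B H B M F" and [simp]: "module K M" and [simp]: "b \<in> carrier B"
  shows "sw K 0 B B M (comult B b) (\<lambda>b1 b2. sw K 0 B H M (coact b1) (\<lambda>b11 b12.
      sw K 0 B B M (comult B b11) (\<lambda>m n. sw K 0 B H M (coact m) (\<lambda>r s. F r s n b12 b2))))
    = sw K 0 B B M (comult B b) (\<lambda>b1 b2. sw K 0 B H M (coact b1) (\<lambda>b11 b12.
      sw K 0 B B M (comult B b2) (\<lambda>m n. sw K 0 B H M (coact m) (\<lambda>r s.
      sw K 0 H H M (comult H b12) (\<lambda>c1 c2. F b11 c1 r (c2 \<cdot> s) n)))))"
    (is "?L = ?R")
proof -
  note [simp] = quinquelinear_rules[OF F]
  have "?R = sw K 1 B B M (comult B b) (\<lambda>b1 b2. sw K 3 B H M (coact b1) (\<lambda>b11 b12.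
      sw K 2 B B M (comult B b2) (\<lambda>m n. sw K 5 B H M (coact m) (\<lambda>r s.
      sw K 4 H H M (comult H b12) (\<lambda>c1 c2. F b11 c1 r (c2 \<cdot> s) n)))))"
    by (simp add: sw_relabel0)
  also have "\<dots> = sw K 0 B B M (comult B b) (\<lambda>b1 b2. sw K 0 B B M (comult B b2) (\<lambda>m n.
      sw K 0 B H M (coact b1) (\<lambda>b11 b12. sw K 0 H H M (comult H b12) (\<lambda>c1 c2.
      sw K 0 B H M (coact m) (\<lambda>r s. F b11 c1 r (c2 \<cdot> s) n)))))"
    by (simp add: sw_sort) (simp add: sw_relabel0)
  also have "\<dots> = sw K 0 B B M (comult B b) (\<lambda>b1 b2. sw K 0 B B M (comult B b2) (\<lambda>m n.
      sw K 0 B H M (coact b1) (\<lambda>w c2. sw K 0 B H M (coact w) (\<lambda>b11 c1.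
      sw K 0 B H M (coact m) (\<lambda>r s. F b11 c1 r (c2 \<cdot> s) n)))))"
    by (intro sw_cong refl coact_coassoc_sw[symmetric]) simp_all
  also have "\<dots> = sw K 0 B B M (comult B b) (\<lambda>x n. sw K 0 B B M (comult B x) (\<lambda>b1 m.
      sw K 0 B H M (coact b1) (\<lambda>w c2. sw K 0 B H M (coact w) (\<lambda>b11 c1.
      sw K 0 B H M (coact m) (\<lambda>r s. F b11 c1 r (c2 \<cdot> s) n)))))"
    by (rule B.coassoc_sw[symmetric]) simp_all
  also have "\<dots> = sw K 0 B B M (comult B b) (\<lambda>x n. sw K 0 B B M (comult B x) (\<lambda>b1 m.
      sw K 0 B H M (coact b1) (\<lambda>w c2. sw K 0 B H M (coact m) (\<lambda>r s.
      sw K 0 B H M (coact w) (\<lambda>b11 c1. F b11 c1 r (c2 \<cdot> s) n)))))"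
    by (intro sw_cong refl sw_swap) simp_all
  also have "\<dots> = ?L"
    by (intro sw_cong refl comult_coact_sw) simp_all
  finally show ?thesis ..
qed

end

subsection \<open>Modules with the same underlying space\<close>

text \<open>The biproducts and \<open>tensor_coalg\<close> are records that carry a tensor product
  together with further operations. Tensor products, linearity and \<open>sweedler\<close> depend on
  the module fields only, so each such record may be replaced by its underlying tensor product,
  where the simp rules of the calculus match.\<close>

definition same_space ::
  "('k, 'v, 'm1) module_scheme \<Rightarrow> ('k, 'v, 'm2) module_scheme \<Rightarrow> bool" where
  "same_space N M \<longleftrightarrow> carrier N = carrier M \<and> zero N = zero M \<and> add N = add M \<and> smult N = smult M"

context
  fixes N :: "('k, 'v, 'm1) module_scheme" and M :: "('k, 'v, 'm2) module_scheme"
    and K :: "('k, 'm) ring_scheme"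
  assumes NM: "same_space N M"
begin

lemma same_space_simps:
  "carrier N = carrier M" "zero N = zero M" "add N = add M" "smult N = smult M"
  using NM by (simp_all add: same_space_def)

lemma same_space_finsum: "finsum N = finsum M"
  by (intro ext) (simp add: finsum_def finprod_def same_space_simps)

lemma same_space_module: "module K M \<Longrightarrow> module K N"
proof -
  assume "module K M"
  then interpret M: module K M .
  show "module K N"
  proof (rule moduleI)
    show "abelian_group N"
      by (rule abelian_groupI)
        (auto simp: same_space_simps M.M.a_ac M.M.l_neg intro: bexI[of _ "\<ominus>\<^bsub>M\<^esub> x" for x])
  qed (auto simp: same_space_simps M.smult_l_distr M.smult_r_distr M.smult_assoc1 M.R.is_cring)
qed

lemma same_space_linear_map:
  "linear_map K N W f \<longleftrightarrow> linear_map K M W f" "linear_map K V N g \<longleftrightarrow> linear_map K V M g"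
  by (simp_all add: linear_map_def same_space_simps)

lemma same_space_bilinear_map:
  "bilinear_map K N W X f \<longleftrightarrow> bilinear_map K M W X f"
  "bilinear_map K V N X g \<longleftrightarrow> bilinear_map K V M X g"
  "bilinear_map K V W N h \<longleftrightarrow> bilinear_map K V W M h"
  by (simp_all add: bilinear_map_def same_space_simps same_space_linear_map)

lemma same_space_tensor:
  "tensor K N W = tensor K M W" "tensor K V N = tensor K V M"
  "tens K N W = tens K M W" "tens K V N = tens K V M"
proof -
  have 1: "tensor_rels K N W = tensor_rels K M W" "tensor_rels K V N = tensor_rels K V M" for V W
    by (simp_all add: tensor_rels_def same_space_simps)
  have 2: "tensor_null K N W = tensor_null K M W" "tensor_null K V N = tensor_null K V M" for V W
    by (simp_all add: tensor_null_def 1 same_space_simps)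
  show "tensor K N W = tensor K M W" "tensor K V N = tensor K V M"
    "tens K N W = tens K M W" "tens K V N = tens K V M"
    by (simp_all add: tensor_def tens_def 2 same_space_simps fun_eq_iff)
qed

lemma same_space_sweedler: "sweedler K N = sweedler K M"
  by (intro ext) (simp add: sweedler_def same_space_finsum same_space_simps)

lemmas same_space = same_space_simps same_space_linear_map same_space_bilinear_map
  same_space_tensor same_space_sweedler

end

lemma same_space_tensor_coalg: "same_space (tensor_coalg K V W) (tensor K V W)"
  by (simp add: same_space_def tensor_coalg_def Let_def)

subsection \<open>Moving sums outwards\<close>

text \<open>The structure maps of the constructed algebras and coalgebras have
  \<open>sw\<close>-formulas on the carrier only. Their linearity is obtained by replacing the map
  by its formula there.\<close>

lemma linear_map_cong:
  assumes "module K V" "\<And>x. x \<in> carrier V \<Longrightarrow> f x = g x" "linear_map K V W g"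
  shows "linear_map K V W f"
proof -
  interpret V: module K V by fact
  show ?thesis using assms(2,3) by (auto simp: linear_map_def Pi_iff)
qed

lemma tens_sw:
  assumes "module K V" "module K W"
  shows "\<lbrakk>\<And>x y. \<lbrakk>x \<in> carrier P; y \<in> carrier Q\<rbrakk> \<Longrightarrow> f x y \<in> carrier V; w \<in> carrier W\<rbrakk> \<Longrightarrow>
      tens K V W (sw K n P Q V t f) w = sw K n P Q (tensor K V W) t (\<lambda>x y. tens K V W (f x y) w)"
    and "\<lbrakk>\<And>x y. \<lbrakk>x \<in> carrier P; y \<in> carrier Q\<rbrakk> \<Longrightarrow> g x y \<in> carrier W; v \<in> carrier V\<rbrakk> \<Longrightarrow>
      tens K V W v (sw K n P Q W t g) = sw K n P Q (tensor K V W) t (\<lambda>x y. tens K V W v (g x y))"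
proof -
  note T = module_tensor'[OF assms]
  show "tens K V W (sw K n P Q V t f) w = sw K n P Q (tensor K V W) t (\<lambda>x y. tens K V W (f x y) w)"
    if "\<And>x y. \<lbrakk>x \<in> carrier P; y \<in> carrier Q\<rbrakk> \<Longrightarrow> f x y \<in> carrier V" "w \<in> carrier W"
    using that(1) by (rule linear_map_sw[OF assms(1) T linear_tens_left[OF assms linear_id that(2)]])
  show "tens K V W v (sw K n P Q W t g) = sw K n P Q (tensor K V W) t (\<lambda>x y. tens K V W v (g x y))"
    if "\<And>x y. \<lbrakk>x \<in> carrier P; y \<in> carrier Q\<rbrakk> \<Longrightarrow> g x y \<in> carrier W" "v \<in> carrier V"
    using that(1) by (rule linear_map_sw[OF assms(2) T linear_tens_right[OF assms linear_id that(2)]])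
qed

lemma (in assoc_algebra) mult_sw:
  shows "\<lbrakk>\<And>x y. \<lbrakk>x \<in> carrier P; y \<in> carrier Q\<rbrakk> \<Longrightarrow> f x y \<in> carrier A; w \<in> carrier A\<rbrakk> \<Longrightarrow>
      sw K n P Q A t f \<otimes>\<^bsub>A\<^esub> w = sw K n P Q A t (\<lambda>x y. f x y \<otimes>\<^bsub>A\<^esub> w)"
    and "\<lbrakk>\<And>x y. \<lbrakk>x \<in> carrier P; y \<in> carrier Q\<rbrakk> \<Longrightarrow> f x y \<in> carrier A; w \<in> carrier A\<rbrakk> \<Longrightarrow>
      w \<otimes>\<^bsub>A\<^esub> sw K n P Q A t f = sw K n P Q A t (\<lambda>x y. w \<otimes>\<^bsub>A\<^esub> f x y)"
  using linear_map_sw[OF module_A module_A linear_mult(1)[OF linear_id], of w P Q f n t]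
    linear_map_sw[OF module_A module_A linear_mult(2)[OF linear_id], of w P Q f n t] by auto

lemma tensor3_ext:
  assumes U: "module K U" and V: "module K V" and W: "module K W" and M: "module K M"
    and f: "linear_map K (tensor3 K U V W) M f" and g: "linear_map K (tensor3 K U V W) M g"
    and eq: "\<And>u v w. \<lbrakk>u \<in> carrier U; v \<in> carrier V; w \<in> carrier W\<rbrakk>
      \<Longrightarrow> f (tens3 K U V W u v w) = g (tens3 K U V W u v w)"
    and t: "t \<in> carrier (tensor3 K U V W)"
  shows "f t = g t"
proof (rule tensor_ext[OF U _ M f g _ t])
  show VW: "module K (tensor K V W)" using V W by simp
  fix u s assume u: "u \<in> carrier U" and s: "s \<in> carrier (tensor K V W)"
  have lin: "linear_map K (tensor K V W) M (\<lambda>s. h (tens K U (tensor K V W) u s))"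
    if "linear_map K (tensor3 K U V W) M h" for h
    by (rule linear_map_comp[OF that]) (simp add: U VW u)
  show "f (tens K U (tensor K V W) u s) = g (tens K U (tensor K V W) u s)"
    by (rule tensor_ext[OF V W M lin[OF f] lin[OF g] _ s]) (rule eq[OF u])
qed

lemma sweedler_comult_sw:
  fixes C :: "('k, 'c, 'm1) coalg_scheme" and S :: "('k, 'c, 'm2) module_scheme"
  assumes "module K S" "linear_map K S (tensor K S S) (comult C)"
    and "module K M" "c \<in> carrier S" "\<And>x y. \<lbrakk>x \<in> carrier S; y \<in> carrier S\<rbrakk> \<Longrightarrow> f x y \<in> carrier M"
  shows "sweedler K M (comult C c) f = sw K 0 S S M (comult C c) f"
  by (rule sweedler_eq_sw) (use assms in \<open>auto dest: linear_map_closed\<close>)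

text \<open>The axioms are demanded over the underlying space S and in terms of \<open>sw\<close>.
  This is the form in which they are verified for each of the three coalgebras constructed
  below.\<close>

lemma coalgebraI:
  fixes C :: "('k, 'c, 'm1) coalg_scheme" and S :: "('k, 'c, 'm2) module_scheme"
  assumes CS: "same_space C S" and K: "field K" and S: "module K S"
    and comult [simp]: "linear_map K S (tensor K S S) (comult C)"
    and counit: "linear_map K S (base_space K) (counit C)"
    and coassoc: "\<And>c. c \<in> carrier S \<Longrightarrow>
      sw K 0 S S (tensor3 K S S S) (comult C c) (\<lambda>x y.
        sw K 0 S S (tensor3 K S S S) (comult C x) (\<lambda>x1 x2. tens3 K S S S x1 x2 y))
      = sw K 0 S S (tensor3 K S S S) (comult C c) (\<lambda>x y.
        sw K 0 S S (tensor3 K S S S) (comult C y) (\<lambda>y1 y2. tens3 K S S S x y1 y2))"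
    and counits: "\<And>c. c \<in> carrier S \<Longrightarrow> sw K 0 S S S (comult C c) (\<lambda>x y. counit C x \<odot>\<^bsub>S\<^esub> y) = c"
      "\<And>c. c \<in> carrier S \<Longrightarrow> sw K 0 S S S (comult C c) (\<lambda>x y. counit C y \<odot>\<^bsub>S\<^esub> x) = c"
  shows "coalgebra K C"
proof (intro coalgebra.intro coalgebra_axioms.intro K same_space_module[OF CS S],
    unfold same_space[OF CS])
  have [simp]: "x \<in> carrier S \<Longrightarrow> counit C x \<in> carrier K" for x
    using linear_map_closed[OF counit] by simp
  note [simp] = S linear_map_comp[OF comult] module.smult_closed[OF S]
  note conv = sweedler_comult_sw[OF S comult]
  fix c assume [simp]: "c \<in> carrier S"
  show "(\<Oplus>[K, tensor3 K S S S] x \<otimes> y \<in> comult C c.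
        \<Oplus>[K, tensor3 K S S S] x1 \<otimes> x2 \<in> comult C x. tens3 K S S S x1 x2 y)
      = (\<Oplus>[K, tensor3 K S S S] x \<otimes> y \<in> comult C c.
        \<Oplus>[K, tensor3 K S S S] y1 \<otimes> y2 \<in> comult C y. tens3 K S S S x y1 y2)"
    by (simp add: conv coassoc)
  show "(\<Oplus>[K, S] x \<otimes> y \<in> comult C c. counit C x \<odot>\<^bsub>S\<^esub> y) = c"
    "(\<Oplus>[K, S] x \<otimes> y \<in> comult C c. counit C y \<odot>\<^bsub>S\<^esub> x) = c"
    by (simp_all add: conv counits)
qed (rule comult counit)+

lemma assoc_algebraI:
  assumes AS: "same_space A S" and K: "field K" and S: "module K S"
    and left: "\<And>y. y \<in> carrier S \<Longrightarrow> linear_map K S S (\<lambda>x. x \<otimes>\<^bsub>A\<^esub> y)"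
    and right: "\<And>x. x \<in> carrier S \<Longrightarrow> linear_map K S S (\<lambda>y. x \<otimes>\<^bsub>A\<^esub> y)"
    and one: "\<one>\<^bsub>A\<^esub> \<in> carrier S"
    and assoc: "\<And>x y z. \<lbrakk>x \<in> carrier S; y \<in> carrier S; z \<in> carrier S\<rbrakk>
      \<Longrightarrow> (x \<otimes>\<^bsub>A\<^esub> y) \<otimes>\<^bsub>A\<^esub> z = x \<otimes>\<^bsub>A\<^esub> (y \<otimes>\<^bsub>A\<^esub> z)"
    and unit: "\<And>x. x \<in> carrier S \<Longrightarrow> \<one>\<^bsub>A\<^esub> \<otimes>\<^bsub>A\<^esub> x = x" "\<And>x. x \<in> carrier S \<Longrightarrow> x \<otimes>\<^bsub>A\<^esub> \<one>\<^bsub>A\<^esub> = x"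
  shows "assoc_algebra K A"
proof -
  interpret A: module K A by (rule same_space_module[OF AS S])
  note sp = same_space_simps[OF AS]
  have "monoid A"
    by (rule monoidI) (simp_all add: sp one assoc unit linear_map_closed[OF left])
  then show ?thesis
    by (intro assoc_algebra.intro assoc_algebra_axioms.intro K A.module_axioms ringI
        A.M.abelian_group_axioms)
      (use linear_mapD(2,3)[OF left] linear_mapD(2,3)[OF right] in \<open>simp_all add: sp\<close>)
qed

section \<open>The double biproduct\<close>

locale double_biproduct_data =
  H?: bialgebra K H + A: ll_yd_bialgebra K H A actA coactA + B: rr_yd_bialgebra K H B actB coactB
  for K (structure) and H :: "('k, 'h) coalg" (structure) and A :: "('k, 'a) coalg"
    and actA and coactA and B :: "('k, 'b) coalg" and actB and coactB +
  assumes exchange: "\<lbrakk>a \<in> carrier A; b \<in> carrier B\<rbrakk> \<Longrightarrow>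
      (\<Oplus>[K, tensor K A B] a1 \<otimes> a2 \<in> coactA a. \<Oplus>[K, tensor K A B] b1 \<otimes> b2 \<in> coactB b.
        tens K A B (actA b2 a2) (actB b1 a1)) = tens K A B a b"
begin

lemma exchange_sw:
  assumes F: "bilinear_map K A B M F" and M [simp]: "module K M"
    and [simp]: "a \<in> carrier A" "b \<in> carrier B"
  shows "sw K 0 H A M (coactA a) (\<lambda>a1 a2. sw K 0 B H M (coactB b) (\<lambda>b1 b2.
    F (actA b2 a2) (actB b1 a1))) = F a b"
proof -
  note [simp] = bilinear_rules[OF F]
  from arg_cong[where f = "\<lambda>t. sw K 0 A B M t F", OF exchange[OF assms(3,4)]] show ?thesis
    by (simp add: A.sweedler_coact B.sweedler_coact)
qed

section \<open>Structure maps of A # H # B\<close>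

abbreviation "HB \<equiv> tensor K H B"
abbreviation "T \<equiv> tensor3 K A H B"
abbreviation "Y \<equiv> double_biproduct K H A actA coactA B actB coactB"

lemmas to_sw = sweedler_comult A.A.sweedler_comult B.B.sweedler_comult A.sweedler_coact B.sweedler_coact
  sweedler_tens_eq_sw sweedler_sw_eq_sw
  sweedler_eq_sw[where V = A and W = HB and n = 0] sweedler_eq_sw[where V = H and W = B and n = 0]

lemma same_space_Y: "same_space Y T"
  by (simp add: same_space_def double_biproduct_def Let_def)

lemma mult_Y:
  assumes "s \<in> carrier T" "t \<in> carrier T"
  shows "s \<otimes>\<^bsub>Y\<^esub> t = sw K 0 A HB T s (\<lambda>a u. sw K 0 H B T u (\<lambda>h b.
    sw K 0 A HB T t (\<lambda>a' u'. sw K 0 H B T u' (\<lambda>h' b'.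
    sw K 0 H H T (comult H h) (\<lambda>h1 h2. sw K 0 H H T (comult H h') (\<lambda>h1' h2'.
      tens3 K A H B (a \<otimes>\<^bsub>A\<^esub> actA h1 a') (h2 \<cdot> h1') (actB b h2' \<otimes>\<^bsub>B\<^esub> b')))))))"
  using assms by (simp add: double_biproduct_def Let_def to_sw)

lemma comult_Y:
  assumes "t \<in> carrier T"
  shows "comult Y t = sw K 0 A HB (tensor K T T) t (\<lambda>a u. sw K 0 H B (tensor K T T) u (\<lambda>h b.
    sw K 0 A A (tensor K T T) (comult A a) (\<lambda>a1 a2. sw K 0 H H (tensor K T T) (comult H h) (\<lambda>h1 h2.
    sw K 0 B B (tensor K T T) (comult B b) (\<lambda>b1 b2.
    sw K 0 H A (tensor K T T) (coactA a2) (\<lambda>a21 a22. sw K 0 B H (tensor K T T) (coactB b1) (\<lambda>b11 b12.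
      tens K T T (tens3 K A H B a1 (a21 \<cdot> h1) b11)
        (tens3 K A H B a22 (h2 \<cdot> b12) b2))))))))"
  using assms by (simp add: double_biproduct_def Let_def to_sw)

lemma counit_Y:
  assumes "t \<in> carrier T"
  shows "counit Y t = sw K 0 A HB (base_space K) t (\<lambda>a u. sw K 0 H B (base_space K) u (\<lambda>h b.
    counit A a \<otimes> counit H h \<otimes> counit B b))"
  using assms by (simp add: double_biproduct_def Let_def to_sw)

lemma one_Y: "\<one>\<^bsub>Y\<^esub> = tens3 K A H B \<one>\<^bsub>A\<^esub> \<one>\<^bsub>H\<^esub> \<one>\<^bsub>B\<^esub>"
  by (simp add: double_biproduct_def Let_def)

lemma mult_Y_closed [simp]: "\<lbrakk>s \<in> carrier T; t \<in> carrier T\<rbrakk> \<Longrightarrow> s \<otimes>\<^bsub>Y\<^esub> t \<in> carrier T"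
  by (simp add: mult_Y)

lemma linear_mult_Y [simp]:
  "\<lbrakk>linear_map K V T f; t \<in> carrier T\<rbrakk> \<Longrightarrow> linear_map K V T (\<lambda>x. f x \<otimes>\<^bsub>Y\<^esub> t)"
  "\<lbrakk>linear_map K V T f; t \<in> carrier T\<rbrakk> \<Longrightarrow> linear_map K V T (\<lambda>x. t \<otimes>\<^bsub>Y\<^esub> f x)"
  by (rule linear_map_comp[where f = f, OF linear_map_cong[OF _ mult_Y]]; simp)+

lemma comult_Y_closed [simp]: "t \<in> carrier T \<Longrightarrow> comult Y t \<in> carrier (tensor K T T)"
  by (simp add: comult_Y)

lemma linear_comult_Y [simp]:
  "linear_map K X T f \<Longrightarrow> linear_map K X (tensor K T T) (\<lambda>x. comult Y (f x))"
  by (rule linear_map_comp[OF linear_map_cong[OF _ comult_Y]]) simp_all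

lemma counit_Y_closed [simp]: "t \<in> carrier T \<Longrightarrow> counit Y t \<in> carrier K"
  by (simp add: counit_Y)

lemma linear_counit_Y [simp]:
  "linear_map K X T f \<Longrightarrow> linear_map K X (base_space K) (\<lambda>x. counit Y (f x))"
  by (rule linear_map_comp[OF linear_map_cong[OF _ counit_Y]]) simp_all

lemma mult_Y_tens:
  assumes [simp]: "a \<in> carrier A" "h \<in> carrier H" "b \<in> carrier B"
    "a' \<in> carrier A" "h' \<in> carrier H" "b' \<in> carrier B"
  shows "tens3 K A H B a h b \<otimes>\<^bsub>Y\<^esub> tens3 K A H B a' h' b' =
    sw K 0 H H T (comult H h) (\<lambda>h1 h2. sw K 0 H H T (comult H h') (\<lambda>h1' h2'.
      tens3 K A H B (a \<otimes>\<^bsub>A\<^esub> actA h1 a') (h2 \<cdot> h1') (actB b h2' \<otimes>\<^bsub>B\<^esub> b')))"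
  by (simp add: mult_Y)

lemma comult_Y_tens:
  assumes [simp]: "a \<in> carrier A" "h \<in> carrier H" "b \<in> carrier B"
  shows "comult Y (tens3 K A H B a h b) =
    sw K 0 A A (tensor K T T) (comult A a) (\<lambda>a1 a2. sw K 0 H H (tensor K T T) (comult H h) (\<lambda>h1 h2.
    sw K 0 B B (tensor K T T) (comult B b) (\<lambda>b1 b2.
    sw K 0 H A (tensor K T T) (coactA a2) (\<lambda>a21 a22. sw K 0 B H (tensor K T T) (coactB b1) (\<lambda>b11 b12.
      tens K T T (tens3 K A H B a1 (a21 \<cdot> h1) b11)
        (tens3 K A H B a22 (h2 \<cdot> b12) b2))))))"
  by (simp add: comult_Y)

lemma counit_Y_tens:
  assumes [simp]: "a \<in> carrier A" "h \<in> carrier H" "b \<in> carrier B"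
  shows "counit Y (tens3 K A H B a h b) = counit A a \<otimes> counit H h \<otimes> counit B b"
  by (simp add: counit_Y)

section \<open>Sums inside the structure maps; associativity and unit of A # H # B\<close>

lemma Y_sw:
  assumes f: "\<And>x y. \<lbrakk>x \<in> carrier P; y \<in> carrier Q\<rbrakk> \<Longrightarrow> f x y \<in> carrier T"
  shows "s \<in> carrier T \<Longrightarrow> sw K n P Q T t f \<otimes>\<^bsub>Y\<^esub> s = sw K n P Q T t (\<lambda>x y. f x y \<otimes>\<^bsub>Y\<^esub> s)"
    and "s \<in> carrier T \<Longrightarrow> s \<otimes>\<^bsub>Y\<^esub> sw K n P Q T t f = sw K n P Q T t (\<lambda>x y. s \<otimes>\<^bsub>Y\<^esub> f x y)"
    and "comult Y (sw K n P Q T t f) = sw K n P Q (tensor K T T) t (\<lambda>x y. comult Y (f x y))"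
    and "counit Y (sw K n P Q T t f) = sw K n P Q (base_space K) t (\<lambda>x y. counit Y (f x y))"
  using linear_map_sw[OF _ _ linear_mult_Y(1)[OF linear_id], of s P Q f n t]
    linear_map_sw[OF _ _ linear_mult_Y(2)[OF linear_id], of s P Q f n t]
    linear_map_sw[OF _ _ linear_comult_Y[OF linear_id], of P Q f n t]
    linear_map_sw[OF _ _ linear_counit_Y[OF linear_id], of P Q f n t] f by simp_all

lemma act_sw:
  "\<lbrakk>\<And>x y. \<lbrakk>x \<in> carrier P; y \<in> carrier Q\<rbrakk> \<Longrightarrow> f x y \<in> carrier A; h \<in> carrier H\<rbrakk> \<Longrightarrow>
    actA h (sw K n P Q A t f) = sw K n P Q A t (\<lambda>x y. actA h (f x y))"
  "\<lbrakk>\<And>x y. \<lbrakk>x \<in> carrier P; y \<in> carrier Q\<rbrakk> \<Longrightarrow> g x y \<in> carrier B; h \<in> carrier H\<rbrakk> \<Longrightarrow>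
    actB (sw K n P Q B t g) h = sw K n P Q B t (\<lambda>x y. actB (g x y) h)"
  using linear_map_sw[OF _ _ A.linear_act(2)[OF linear_id], of h P Q f n t]
    linear_map_sw[OF _ _ B.linear_act(1)[OF linear_id], of h P Q g n t] by simp_all

lemmas sw_out = tens_sw A.A.mult_sw B.B.mult_sw Y_sw act_sw

text \<open>The module algebra laws of A and B and multiplicativity of \<Delta> on H bring both
  sides to six sums. The keys 1 and 2, 3 and 4, 5 and 6 belong to h, h' and h''; after sorting, the
  sides differ only by coassociativity of H in each of the three pairs.\<close>

lemma assoc_Y_tens:
  assumes [simp]: "a \<in> carrier A" "h \<in> carrier H" "b \<in> carrier B"
    "a' \<in> carrier A" "h' \<in> carrier H" "b' \<in> carrier B"
    "a'' \<in> carrier A" "h'' \<in> carrier H" "b'' \<in> carrier B"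
  shows "(tens3 K A H B a h b \<otimes>\<^bsub>Y\<^esub> tens3 K A H B a' h' b') \<otimes>\<^bsub>Y\<^esub> tens3 K A H B a'' h'' b''
    = tens3 K A H B a h b \<otimes>\<^bsub>Y\<^esub> (tens3 K A H B a' h' b' \<otimes>\<^bsub>Y\<^esub> tens3 K A H B a'' h'' b'')"
    (is "?L = ?R")
proof -
  note expand = mult_Y_tens sw_out comult_mult_sw A.act_prod B.act_prod
    A.act_mult[symmetric] B.act_mult[symmetric] A.A.A.m_assoc B.B.A.m_assoc H.A.m_assoc
  have L: "?L = sw K 1 H H T (comult H h) (\<lambda>h1 h2. sw K 3 H H T (comult H h') (\<lambda>k1 k2.
      sw K 2 H H T (comult H h2) (\<lambda>x1 x2. sw K 4 H H T (comult H k1) (\<lambda>y1 y2.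
      sw K 5 H H T (comult H h'') (\<lambda>l1 l2. sw K 6 H H T (comult H l2) (\<lambda>z1 z2.
        tens3 K A H B (a \<otimes>\<^bsub>A\<^esub> (actA h1 a' \<otimes>\<^bsub>A\<^esub> actA (x1 \<cdot> y1) a''))
          (x2 \<cdot> (y2 \<cdot> l1))
          (actB b (k2 \<cdot> z1) \<otimes>\<^bsub>B\<^esub> (actB b' z2 \<otimes>\<^bsub>B\<^esub> b''))))))))"
    by (simp add: expand sw_relabel0)
  have R: "?R = sw K 3 H H T (comult H h') (\<lambda>k1 k2. sw K 5 H H T (comult H h'') (\<lambda>l1 l2.
      sw K 1 H H T (comult H h) (\<lambda>h1 h2. sw K 4 H H T (comult H k2) (\<lambda>y1 y2.
      sw K 6 H H T (comult H l1) (\<lambda>z1 z2. sw K 2 H H T (comult H h1) (\<lambda>x1 x2.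
        tens3 K A H B (a \<otimes>\<^bsub>A\<^esub> (actA x1 a' \<otimes>\<^bsub>A\<^esub> actA (x2 \<cdot> k1) a''))
          (h2 \<cdot> (y1 \<cdot> z1))
          (actB b (y2 \<cdot> z2) \<otimes>\<^bsub>B\<^esub> (actB b' l2 \<otimes>\<^bsub>B\<^esub> b''))))))))"
    by (simp add: expand sw_relabel0)
  show ?thesis
    unfolding L R by (simp add: sw_sort) (simp add: sw_relabel0 coassoc_sw)
qed

lemma assoc_Y:
  assumes s: "s \<in> carrier T" and t: "t \<in> carrier T" and u: "u \<in> carrier T"
  shows "(s \<otimes>\<^bsub>Y\<^esub> t) \<otimes>\<^bsub>Y\<^esub> u = s \<otimes>\<^bsub>Y\<^esub> (t \<otimes>\<^bsub>Y\<^esub> u)"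
proof -
  note [simp] = s t u
  note ext = tensor3_ext[where K = K and U = A and V = H and W = B and M = T]
  \<comment> \<open>The identity is extended from pure tensors one factor at a time, from right to
    left, because the extension principle is for a single linear variable.\<close>
  have 1: "(tens3 K A H B a h b \<otimes>\<^bsub>Y\<^esub> tens3 K A H B a' h' b') \<otimes>\<^bsub>Y\<^esub> u
      = tens3 K A H B a h b \<otimes>\<^bsub>Y\<^esub> (tens3 K A H B a' h' b' \<otimes>\<^bsub>Y\<^esub> u)"
    if [simp]: "a \<in> carrier A" "h \<in> carrier H" "b \<in> carrier B"
      "a' \<in> carrier A" "h' \<in> carrier H" "b' \<in> carrier B" for a h b a' h' b'
    by (rule ext[OF _ _ _ _ _ _ _ u]) (simp_all add: assoc_Y_tens)
  have 2: "(tens3 K A H B a h b \<otimes>\<^bsub>Y\<^esub> t) \<otimes>\<^bsub>Y\<^esub> u = tens3 K A H B a h b \<otimes>\<^bsub>Y\<^esub> (t \<otimes>\<^bsub>Y\<^esub> u)"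
    if [simp]: "a \<in> carrier A" "h \<in> carrier H" "b \<in> carrier B" for a h b
    by (rule ext[OF _ _ _ _ _ _ _ t]) (simp_all add: 1)
  show ?thesis
    by (rule ext[OF _ _ _ _ _ _ _ s]) (simp_all add: 2)
qed

lemma unit_Y:
  assumes s: "s \<in> carrier T"
  shows "\<one>\<^bsub>Y\<^esub> \<otimes>\<^bsub>Y\<^esub> s = s" and "s \<otimes>\<^bsub>Y\<^esub> \<one>\<^bsub>Y\<^esub> = s"
proof -
  note ext = tensor3_ext[where K = K and U = A and V = H and W = B and M = T]
  note unit = one_Y mult_Y_tens comult_one_sw A.act_unit B.act_unit A.act_one B.act_one
    smult_out A.A.smult_mult_left A.A.smult_mult_right B.B.smult_mult_left B.B.smult_mult_right
    counit_sw
  show "\<one>\<^bsub>Y\<^esub> \<otimes>\<^bsub>Y\<^esub> s = s"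
    by (rule ext[OF _ _ _ _ _ _ _ s]) (simp_all add: unit)
  show "s \<otimes>\<^bsub>Y\<^esub> \<one>\<^bsub>Y\<^esub> = s"
    by (rule ext[OF _ _ _ _ _ _ _ s]) (simp_all add: unit)
qed

section \<open>Counit laws and coassociativity of A # H # B\<close>

lemmas sweedler_comult_Y = sweedler_comult_sw[OF _ linear_comult_Y[OF linear_id]]

text \<open>On pure tensors the scalars are moved out of the tensors. Multiplicativity of \<epsilon>
  on H separates the factors, the counit laws of the coactions and colinearity of the counits of A
  and B remove the coactions, and the counit laws of A, H and B do the rest.\<close>

lemma counit_Y_sw:
  assumes s: "s \<in> carrier T"
  shows "sw K 0 T T T (comult Y s) (\<lambda>x y. counit Y x \<odot>\<^bsub>T\<^esub> y) = s"
    and "sw K 0 T T T (comult Y s) (\<lambda>x y. counit Y y \<odot>\<^bsub>T\<^esub> x) = s"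
proof -
  have T: "module K T" by simp
  note ext = tensor3_ext[where K = K and U = A and V = H and W = B and M = T]
  note counit = comult_Y_tens counit_Y_tens counit_mult
    module.smult_assoc1[OF T] module.smult_closed[OF T] smult_out
    A.coact_counit_sw B.coact_counit_sw A.counit_coact_sw B.counit_coact_sw
    counit_sw A.A.counit_sw B.B.counit_sw
  show "sw K 0 T T T (comult Y s) (\<lambda>x y. counit Y x \<odot>\<^bsub>T\<^esub> y) = s"
    by (rule ext[OF _ _ _ _ _ _ _ s]) (simp_all, simp_all add: counit)
  show "sw K 0 T T T (comult Y s) (\<lambda>x y. counit Y y \<odot>\<^bsub>T\<^esub> x) = s"
    by (rule ext[OF _ _ _ _ _ _ _ s]) (simp_all, simp_all add: counit)
qed

lemma coassoc_Y_tens: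
  assumes F: "trilinear_map K T T T M F" and [simp]: "module K M"
    and [simp]: "a \<in> carrier A" "h \<in> carrier H" "b \<in> carrier B"
  shows "sw K 0 T T M (comult Y (tens3 K A H B a h b)) (\<lambda>x y.
      sw K 0 T T M (comult Y x) (\<lambda>x1 x2. F x1 x2 y))
    = sw K 0 T T M (comult Y (tens3 K A H B a h b)) (\<lambda>x y.
      sw K 0 T T M (comult Y y) (\<lambda>y1 y2. F x y1 y2))"
    (is "?L = ?R")
proof -
  note [simp] = trilinear_rules[OF F]
  \<comment> \<open>The ranges of keys 1 to 2, 3 to 7 and 8 to 11 separate the strands of h, a and
    b, so that each strand becomes a contiguous block.\<close>
  have "?L = sw K 3 A A M (comult A a) (\<lambda>a1 a2. sw K 1 H H M (comult H h) (\<lambda>h1 h2.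
      sw K 8 B B M (comult B b) (\<lambda>b1 b2. sw K 4 H A M (coactA a2) (\<lambda>g w.
      sw K 9 B H M (coactB b1) (\<lambda>b11 b12. sw K 5 A A M (comult A a1) (\<lambda>p q.
      sw K 7 H H M (comult H g) (\<lambda>g1 g2. sw K 2 H H M (comult H h1) (\<lambda>k1 k2.
      sw K 10 B B M (comult B b11) (\<lambda>m n. sw K 6 H A M (coactA q) (\<lambda>u v.
      sw K 11 B H M (coactB m) (\<lambda>r s.
        F (tens3 K A H B p ((u \<cdot> g1) \<cdot> k1) r)
          (tens3 K A H B v (g2 \<cdot> (k2 \<cdot> s)) n)
          (tens3 K A H B w (h2 \<cdot> b12) b2))))))))))))"
    by (simp add: comult_Y_tens comult_mult_sw H.A.m_assoc sw_relabel0)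
  also have "\<dots> = sw K 0 H H M (comult H h) (\<lambda>h1 h2. sw K 0 H H M (comult H h1) (\<lambda>k1 k2.
      sw K 0 A A M (comult A a) (\<lambda>a1 a2. sw K 0 H A M (coactA a2) (\<lambda>g w.
      sw K 0 A A M (comult A a1) (\<lambda>p q. sw K 0 H A M (coactA q) (\<lambda>u v.
      sw K 0 H H M (comult H g) (\<lambda>g1 g2. sw K 0 B B M (comult B b) (\<lambda>b1 b2.
      sw K 0 B H M (coactB b1) (\<lambda>b11 b12. sw K 0 B B M (comult B b11) (\<lambda>m n.
      sw K 0 B H M (coactB m) (\<lambda>r s.
        F (tens3 K A H B p ((u \<cdot> g1) \<cdot> k1) r)
          (tens3 K A H B v (g2 \<cdot> (k2 \<cdot> s)) n)
          (tens3 K A H B w (h2 \<cdot> b12) b2))))))))))))"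
    by (simp add: sw_sort) (simp add: sw_relabel0)
  also have "\<dots> = sw K 0 H H M (comult H h) (\<lambda>h1 h2. sw K 0 H H M (comult H h1) (\<lambda>k1 k2.
      sw K 0 A A M (comult A a) (\<lambda>a1 a2. sw K 0 H A M (coactA a2) (\<lambda>g w.
      sw K 0 A A M (comult A w) (\<lambda>p q. sw K 0 H A M (coactA q) (\<lambda>u v.
      sw K 0 B B M (comult B b) (\<lambda>b1 b2.
      sw K 0 B H M (coactB b1) (\<lambda>b11 b12. sw K 0 B B M (comult B b11) (\<lambda>m n.
      sw K 0 B H M (coactB m) (\<lambda>r s.
        F (tens3 K A H B a1 (g \<cdot> k1) r)
          (tens3 K A H B p (u \<cdot> (k2 \<cdot> s)) n)
          (tens3 K A H B v (h2 \<cdot> b12) b2)))))))))))"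
    \<comment> \<open>The whole B-strand is part of the F that this lemma is applied to.\<close>
    by (intro sw_cong refl A.comult_coact_coassoc_sw) simp_all
  also have "\<dots> = sw K 0 H H M (comult H h) (\<lambda>h1 h2. sw K 0 H H M (comult H h1) (\<lambda>k1 k2.
      sw K 0 A A M (comult A a) (\<lambda>a1 a2. sw K 0 H A M (coactA a2) (\<lambda>g w.
      sw K 0 A A M (comult A w) (\<lambda>p q. sw K 0 H A M (coactA q) (\<lambda>u v.
      sw K 0 B B M (comult B b) (\<lambda>b1 b2.
      sw K 0 B H M (coactB b1) (\<lambda>b11 b12. sw K 0 B B M (comult B b2) (\<lambda>m n.
      sw K 0 B H M (coactB m) (\<lambda>r s. sw K 0 H H M (comult H b12) (\<lambda>c1 c2.
        F (tens3 K A H B a1 (g \<cdot> k1) b11)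
          (tens3 K A H B p (u \<cdot> (k2 \<cdot> c1)) r)
          (tens3 K A H B v (h2 \<cdot> (c2 \<cdot> s)) n))))))))))))"
    by (intro sw_cong refl B.comult_coact_coassoc_sw) simp_all
  finally have L: "?L = \<dots>" .
  have R: "?R = sw K 3 A A M (comult A a) (\<lambda>a1 a2. sw K 1 H H M (comult H h) (\<lambda>k l.
      sw K 7 B B M (comult B b) (\<lambda>b1 b2. sw K 4 H A M (coactA a2) (\<lambda>g w.
      sw K 8 B H M (coactB b1) (\<lambda>b11 b12. sw K 5 A A M (comult A w) (\<lambda>p q.
      sw K 2 H H M (comult H l) (\<lambda>l1 l2. sw K 11 H H M (comult H b12) (\<lambda>c1 c2.
      sw K 9 B B M (comult B b2) (\<lambda>m n. sw K 6 H A M (coactA q) (\<lambda>u v.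
      sw K 10 B H M (coactB m) (\<lambda>r s.
        F (tens3 K A H B a1 (g \<cdot> k) b11)
          (tens3 K A H B p (u \<cdot> (l1 \<cdot> c1)) r)
          (tens3 K A H B v (l2 \<cdot> (c2 \<cdot> s)) n))))))))))))"
    by (simp add: comult_Y_tens comult_mult_sw H.A.m_assoc sw_relabel0)
  \<comment> \<open>The strands of a and b now agree; what remains is coassociativity of H for the
    legs of h.\<close>
  show ?thesis unfolding L R by (simp add: sw_sort) (simp add: sw_relabel0 coassoc_sw)
qed

text \<open>Coassociativity of the coactions isolates \<open>b\<^sup>1 \<triangleleft> a\<^sup>1 \<otimes> b\<^sup>2 \<triangleright> a\<^sup>2\<close>, which the pairing condition removes.\<close>

lemma exchange_comult_sw:
  assumes G: "quadrilinear_map K H B A H M G" and [simp]: "module K M"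
    and [simp]: "k \<in> carrier H" "l \<in> carrier H" "a \<in> carrier A" "b \<in> carrier B"
  shows "sw K 0 H A M (coactA a) (\<lambda>g c. sw K 0 B H M (coactB b) (\<lambda>d z.
      sw K 0 H H M (comult H (g \<cdot> k)) (\<lambda>y1 y2. sw K 0 H H M (comult H (l \<cdot> z)) (\<lambda>x1 x2.
        G y1 (actB d y2) (actA x1 c) x2))))
    = sw K 0 H A M (coactA a) (\<lambda>g c. sw K 0 B H M (coactB b) (\<lambda>d z.
      sw K 0 H H M (comult H k) (\<lambda>k1 k2. sw K 0 H H M (comult H l) (\<lambda>l1 l2.
        G (g \<cdot> k1) (actB d k2) (actA l1 c) (l2 \<cdot> z)))))"
    (is "?L = ?R")
proof -
  note [simp] = quadrilinear_rules[OF G]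
  have "?L = sw K 3 H A M (coactA a) (\<lambda>g c. sw K 5 B H M (coactB b) (\<lambda>d z.
      sw K 4 H H M (comult H g) (\<lambda>g1 g2. sw K 1 H H M (comult H k) (\<lambda>k1 k2.
      sw K 2 H H M (comult H l) (\<lambda>l1 l2. sw K 6 H H M (comult H z) (\<lambda>z1 z2.
        G (g1 \<cdot> k1) (actB (actB d g2) k2) (actA l1 (actA z1 c)) (l2 \<cdot> z2)))))))"
    by (simp add: sw_relabel0 comult_mult_sw A.act_mult B.act_mult)
  also have "\<dots> = sw K 0 H H M (comult H k) (\<lambda>k1 k2. sw K 0 H H M (comult H l) (\<lambda>l1 l2.
      sw K 0 H A M (coactA a) (\<lambda>g c. sw K 0 H H M (comult H g) (\<lambda>g1 g2.
      sw K 0 B H M (coactB b) (\<lambda>d z. sw K 0 H H M (comult H z) (\<lambda>z1 z2.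
        G (g1 \<cdot> k1) (actB (actB d g2) k2) (actA l1 (actA z1 c)) (l2 \<cdot> z2)))))))"
    by (simp add: sw_sort) (simp add: sw_relabel0)
  also have "\<dots> = sw K 0 H H M (comult H k) (\<lambda>k1 k2. sw K 0 H H M (comult H l) (\<lambda>l1 l2.
      sw K 0 H A M (coactA a) (\<lambda>g1 c. sw K 0 H A M (coactA c) (\<lambda>g2 c'.
      sw K 0 B H M (coactB b) (\<lambda>d z2. sw K 0 B H M (coactB d) (\<lambda>d' z1.
        G (g1 \<cdot> k1) (actB (actB d' g2) k2) (actA l1 (actA z1 c')) (l2 \<cdot> z2)))))))"
    by (simp add: A.coact_coassoc_sw B.coact_coassoc_sw)
  \<comment> \<open>The coactions on c and on d, which form the instance of the pairing condition,
    are made adjacent.\<close>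
  also have "\<dots> = sw K 0 H H M (comult H k) (\<lambda>k1 k2. sw K 0 H H M (comult H l) (\<lambda>l1 l2.
      sw K 0 H A M (coactA a) (\<lambda>g1 c. sw K 0 B H M (coactB b) (\<lambda>d z2.
      sw K 0 H A M (coactA c) (\<lambda>g2 c'. sw K 0 B H M (coactB d) (\<lambda>d' z1.
        G (g1 \<cdot> k1) (actB (actB d' g2) k2) (actA l1 (actA z1 c')) (l2 \<cdot> z2)))))))"
    by (intro sw_cong refl sw_swap) simp
  also have "\<dots> = sw K 3 H H M (comult H k) (\<lambda>k1 k2. sw K 4 H H M (comult H l) (\<lambda>l1 l2.
      sw K 1 H A M (coactA a) (\<lambda>g c. sw K 2 B H M (coactB b) (\<lambda>d z.
        G (g \<cdot> k1) (actB d k2) (actA l1 c) (l2 \<cdot> z)))))"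
    unfolding sw_relabel0[OF zero_less_numeral] sw_relabel0[OF zero_less_one]
    by (intro sw_cong refl exchange_sw) simp_all
  also have "\<dots> = ?R"
    by (simp add: sw_sort) (simp add: sw_relabel0)
  finally show ?thesis .
qed

text \<open>The obstacle is crossed actions: on the right-hand side c3 is acted on by a leg of the
  product of l with b12, and b11 by a leg of the product of g' with k', whereas on the left only
  legs of l and of k' act. \<open>exchange_comult_sw\<close> removes exactly the actions coming from
  b12 and g'.\<close>

lemma comult_mult_Y_tens:
  assumes F: "bilinear_map K T T M F" and [simp]: "module K M"
    and [simp]: "a \<in> carrier A" "h \<in> carrier H" "b \<in> carrier B"
      "a' \<in> carrier A" "h' \<in> carrier H" "b' \<in> carrier B"
  shows "sw K 0 T T M (comult Y (tens3 K A H B a h b \<otimes>\<^bsub>Y\<^esub> tens3 K A H B a' h' b')) F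
    = sw K 0 T T M (comult Y (tens3 K A H B a h b)) (\<lambda>x1 x2.
      sw K 0 T T M (comult Y (tens3 K A H B a' h' b')) (\<lambda>y1 y2. F (x1 \<otimes>\<^bsub>Y\<^esub> y1) (x2 \<otimes>\<^bsub>Y\<^esub> y2)))"
    (is "?L = ?R")
proof -
  note [simp] = bilinear_rules[OF F]
  \<comment> \<open>Products of pure tensors in A # H # B are sums; linearity of F in either
    argument takes these sums out of F.\<close>
  note F_out = linear_map_sw[OF module_tensor' _ bilinear_rules(2)[OF F linear_id]]
    linear_map_sw[OF module_tensor' _ bilinear_rules(3)[OF F linear_id]]
  \<comment> \<open>Keys 1 to 4 collect the block for the A-lemma, keys 5 to 8 the block for the
    B-lemma.\<close>
  have "?L = sw K 1 H H M (comult H h) (\<lambda>h1 h2. sw K 5 H H M (comult H h') (\<lambda>k1 k2.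
      sw K 3 A A M (comult A (a \<otimes>\<^bsub>A\<^esub> actA h1 a')) (\<lambda>p q. sw K 2 H H M (comult H h2) (\<lambda>l1 l2.
      sw K 6 H H M (comult H k1) (\<lambda>j1 j2. sw K 7 B B M (comult B (actB b k2 \<otimes>\<^bsub>B\<^esub> b')) (\<lambda>m n.
      sw K 4 H A M (coactA q) (\<lambda>u v. sw K 8 B H M (coactB m) (\<lambda>w z.
        F (tens3 K A H B p ((u \<cdot> l1) \<cdot> j1) w)
          (tens3 K A H B v (l2 \<cdot> (j2 \<cdot> z)) n)))))))))"
    by (simp add: comult_Y_tens mult_Y_tens sw_out sw_relabel0 comult_mult_sw H.A.m_assoc)
  also have "\<dots> = sw K 0 H H M (comult H h) (\<lambda>h1 h2. sw K 0 H H M (comult H h2) (\<lambda>l1 l2.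
      sw K 0 A A M (comult A (a \<otimes>\<^bsub>A\<^esub> actA h1 a')) (\<lambda>p q. sw K 0 H A M (coactA q) (\<lambda>u v.
      sw K 0 H H M (comult H h') (\<lambda>k1 k2. sw K 0 H H M (comult H k1) (\<lambda>j1 j2.
      sw K 0 B B M (comult B (actB b k2 \<otimes>\<^bsub>B\<^esub> b')) (\<lambda>m n. sw K 0 B H M (coactB m) (\<lambda>w z.
        F (tens3 K A H B p ((u \<cdot> l1) \<cdot> j1) w)
          (tens3 K A H B v (l2 \<cdot> (j2 \<cdot> z)) n)))))))))"
    by (simp add: sw_sort) (simp add: sw_relabel0)
  \<comment> \<open>All sums over h' and B count as part of the F of the A-lemma.\<close>
  also have "\<dots> = sw K 0 A A M (comult A a) (\<lambda>a1 a2. sw K 0 H A M (coactA a2) (\<lambda>g a3.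
      sw K 0 A A M (comult A a') (\<lambda>c1 c2. sw K 0 H A M (coactA c2) (\<lambda>g' c3.
      sw K 0 H H M (comult H h) (\<lambda>k l. sw K 0 H H M (comult H (g \<cdot> k)) (\<lambda>x y.
      sw K 0 H H M (comult H l) (\<lambda>l1 l2.
      sw K 0 H H M (comult H h') (\<lambda>k1 k2. sw K 0 H H M (comult H k1) (\<lambda>j1 j2.
      sw K 0 B B M (comult B (actB b k2 \<otimes>\<^bsub>B\<^esub> b')) (\<lambda>m n. sw K 0 B H M (coactB m) (\<lambda>w z.
        F (tens3 K A H B (a1 \<otimes>\<^bsub>A\<^esub> actA x c1) ((y \<cdot> g') \<cdot> j1) w)
          (tens3 K A H B (a3 \<otimes>\<^bsub>A\<^esub> actA l1 c3) (l2 \<cdot> (j2 \<cdot> z)) n))))))))))))"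
    by (rule A.comult_coact_prod_act_sw) simp_all
  \<comment> \<open>The B-lemma is applied under the sums of A. The keys agree with those chosen for
    \<open>?R\<close> below, so that both sides sort into the same order.\<close>
  also have "\<dots> = sw K 1 A A M (comult A a) (\<lambda>a1 a2. sw K 2 H A M (coactA a2) (\<lambda>g a3.
      sw K 3 A A M (comult A a') (\<lambda>c1 c2. sw K 11 H A M (coactA c2) (\<lambda>g' c3.
      sw K 4 H H M (comult H h) (\<lambda>k l. sw K 5 H H M (comult H (g \<cdot> k)) (\<lambda>x y.
      sw K 14 H H M (comult H l) (\<lambda>l1 l2.
      sw K 6 B B M (comult B b) (\<lambda>b1 b2. sw K 12 B H M (coactB b1) (\<lambda>b11 b12.
      sw K 7 B B M (comult B b') (\<lambda>d1 d2. sw K 8 B H M (coactB d1) (\<lambda>d11 d12.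
      sw K 9 H H M (comult H h') (\<lambda>k' l'. sw K 13 H H M (comult H k') (\<lambda>j1 j2.
      sw K 10 H H M (comult H (l' \<cdot> d12)) (\<lambda>r s.
        F (tens3 K A H B (a1 \<otimes>\<^bsub>A\<^esub> actA x c1) ((y \<cdot> g') \<cdot> j1) (actB b11 j2 \<otimes>\<^bsub>B\<^esub> d11))
          (tens3 K A H B (a3 \<otimes>\<^bsub>A\<^esub> actA l1 c3) (l2 \<cdot> (b12 \<cdot> r))
            (actB b2 s \<otimes>\<^bsub>B\<^esub> d2))))))))))))))))"
    unfolding sw_relabel0[OF zero_less_numeral] sw_relabel0[OF zero_less_one]
    by (intro sw_cong refl B.comult_coact_prod_act_sw)
      simp_all
  finally have L: "?L = \<dots>" .
  have "?R = sw K 1 A A M (comult A a) (\<lambda>a1 a2. sw K 4 H H M (comult H h) (\<lambda>k l.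
      sw K 6 B B M (comult B b) (\<lambda>b1 b2. sw K 2 H A M (coactA a2) (\<lambda>g a3.
      sw K 12 B H M (coactB b1) (\<lambda>b11 b12. sw K 3 A A M (comult A a') (\<lambda>c1 c2.
      sw K 9 H H M (comult H h') (\<lambda>k' l'. sw K 7 B B M (comult B b') (\<lambda>d1 d2.
      sw K 11 H A M (coactA c2) (\<lambda>g' c3. sw K 8 B H M (coactB d1) (\<lambda>d11 d12.
      sw K 14 H H M (comult H (l \<cdot> b12)) (\<lambda>x1 x2. sw K 10 H H M (comult H (l' \<cdot> d12)) (\<lambda>r s.
      sw K 5 H H M (comult H (g \<cdot> k)) (\<lambda>x y. sw K 13 H H M (comult H (g' \<cdot> k')) (\<lambda>y1 y2.
        F (tens3 K A H B (a1 \<otimes>\<^bsub>A\<^esub> actA x c1) (y \<cdot> y1) (actB b11 y2 \<otimes>\<^bsub>B\<^esub> d11))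
          (tens3 K A H B (a3 \<otimes>\<^bsub>A\<^esub> actA x1 c3) (x2 \<cdot> r) (actB b2 s \<otimes>\<^bsub>B\<^esub> d2))))))))))))))))"
    by (simp add: comult_Y_tens mult_Y_tens sw_out F_out sw_relabel0)
  \<comment> \<open>Keys 11 to 14 have left innermost the block for
    \<open>exchange_comult_sw\<close>: the coactions on c2 and b1, and the comultiplications of the
    two products that act across.\<close>
  also have "\<dots> = sw K 0 A A M (comult A a) (\<lambda>a1 a2. sw K 0 H A M (coactA a2) (\<lambda>g a3.
      sw K 0 A A M (comult A a') (\<lambda>c1 c2.
      sw K 0 H H M (comult H h) (\<lambda>k l. sw K 0 H H M (comult H (g \<cdot> k)) (\<lambda>x y.
      sw K 0 B B M (comult B b) (\<lambda>b1 b2. sw K 0 B B M (comult B b') (\<lambda>d1 d2.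
      sw K 0 B H M (coactB d1) (\<lambda>d11 d12.
      sw K 0 H H M (comult H h') (\<lambda>k' l'. sw K 0 H H M (comult H (l' \<cdot> d12)) (\<lambda>r s.
      sw K 0 H A M (coactA c2) (\<lambda>g' c3. sw K 0 B H M (coactB b1) (\<lambda>b11 b12.
      sw K 0 H H M (comult H (g' \<cdot> k')) (\<lambda>y1 y2. sw K 0 H H M (comult H (l \<cdot> b12)) (\<lambda>x1 x2.
        F (tens3 K A H B (a1 \<otimes>\<^bsub>A\<^esub> actA x c1) (y \<cdot> y1) (actB b11 y2 \<otimes>\<^bsub>B\<^esub> d11))
          (tens3 K A H B (a3 \<otimes>\<^bsub>A\<^esub> actA x1 c3) (x2 \<cdot> r) (actB b2 s \<otimes>\<^bsub>B\<^esub> d2))))))))))))))))"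
    by (simp add: sw_sort) (simp add: sw_relabel0)
  also have "\<dots> = sw K 0 A A M (comult A a) (\<lambda>a1 a2. sw K 0 H A M (coactA a2) (\<lambda>g a3.
      sw K 0 A A M (comult A a') (\<lambda>c1 c2.
      sw K 0 H H M (comult H h) (\<lambda>k l. sw K 0 H H M (comult H (g \<cdot> k)) (\<lambda>x y.
      sw K 0 B B M (comult B b) (\<lambda>b1 b2. sw K 0 B B M (comult B b') (\<lambda>d1 d2.
      sw K 0 B H M (coactB d1) (\<lambda>d11 d12.
      sw K 0 H H M (comult H h') (\<lambda>k' l'. sw K 0 H H M (comult H (l' \<cdot> d12)) (\<lambda>r s.
      sw K 0 H A M (coactA c2) (\<lambda>g' c3. sw K 0 B H M (coactB b1) (\<lambda>b11 b12.
      sw K 0 H H M (comult H k') (\<lambda>j1 j2. sw K 0 H H M (comult H l) (\<lambda>l1 l2.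
        F (tens3 K A H B (a1 \<otimes>\<^bsub>A\<^esub> actA x c1) (y \<cdot> (g' \<cdot> j1)) (actB b11 j2 \<otimes>\<^bsub>B\<^esub> d11))
          (tens3 K A H B (a3 \<otimes>\<^bsub>A\<^esub> actA l1 c3) ((l2 \<cdot> b12) \<cdot> r)
            (actB b2 s \<otimes>\<^bsub>B\<^esub> d2))))))))))))))))"
    by (intro sw_cong refl exchange_comult_sw)
      simp_all
  finally have R: "?R = \<dots>" .
  show ?thesis unfolding L R
    by (simp add: sw_sort) (simp add: sw_relabel0 H.A.m_assoc)
qed

section \<open>From pure tensors to the bialgebra A # H # B\<close>

lemma assoc_algebra_Y: "assoc_algebra K Y"
  by (rule assoc_algebraI[OF same_space_Y])
    (simp_all add: H.K.field_axioms one_Y[symmetric] assoc_Y unit_Y, simp add: one_Y)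

lemma coassoc_Y:
  assumes s: "s \<in> carrier T" and F: "trilinear_map K T T T M F" and [simp]: "module K M"
  shows "sw K 0 T T M (comult Y s) (\<lambda>x y. sw K 0 T T M (comult Y x) (\<lambda>x1 x2. F x1 x2 y))
    = sw K 0 T T M (comult Y s) (\<lambda>x y. sw K 0 T T M (comult Y y) (\<lambda>y1 y2. F x y1 y2))"
proof -
  note [simp] = trilinear_rules[OF F]
  show ?thesis
    by (rule tensor3_ext[where K = K and U = A and V = H and W = B and M = M, OF _ _ _ _ _ _ _ s])
      (simp_all add: coassoc_Y_tens[OF F])
qed

lemma comult_mult_Y:
  assumes s: "s \<in> carrier T" and t: "t \<in> carrier T"
    and F: "bilinear_map K T T M F" and [simp]: "module K M"
  shows "sw K 0 T T M (comult Y (s \<otimes>\<^bsub>Y\<^esub> t)) F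
    = sw K 0 T T M (comult Y s) (\<lambda>x1 x2. sw K 0 T T M (comult Y t) (\<lambda>y1 y2.
        F (x1 \<otimes>\<^bsub>Y\<^esub> y1) (x2 \<otimes>\<^bsub>Y\<^esub> y2)))"
proof -
  note [simp] = bilinear_rules[OF F] s t
  note ext = tensor3_ext[where K = K and U = A and V = H and W = B and M = M]
  have 1: "sw K 0 T T M (comult Y (tens3 K A H B a h b \<otimes>\<^bsub>Y\<^esub> t)) F
    = sw K 0 T T M (comult Y (tens3 K A H B a h b)) (\<lambda>x1 x2. sw K 0 T T M (comult Y t) (\<lambda>y1 y2.
        F (x1 \<otimes>\<^bsub>Y\<^esub> y1) (x2 \<otimes>\<^bsub>Y\<^esub> y2)))"
    if [simp]: "a \<in> carrier A" "h \<in> carrier H" "b \<in> carrier B" for a h b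
    by (rule ext[OF _ _ _ _ _ _ _ t]) (simp_all add: comult_mult_Y_tens[OF F])
  show ?thesis
    by (rule ext[OF _ _ _ _ _ _ _ s]) (simp_all add: 1)
qed

lemma counit_mult_Y:
  assumes s: "s \<in> carrier T" and t: "t \<in> carrier T"
  shows "counit Y (s \<otimes>\<^bsub>Y\<^esub> t) = counit Y s \<otimes> counit Y t"
proof -
  note [simp] = s t
  note ext = tensor3_ext[where K = K and U = A and V = H and W = B and M = "base_space K"]
  have 0: "counit Y (tens3 K A H B a h b \<otimes>\<^bsub>Y\<^esub> tens3 K A H B a' h' b')
    = counit Y (tens3 K A H B a h b) \<otimes> counit Y (tens3 K A H B a' h' b')"
    if [simp]: "a \<in> carrier A" "h \<in> carrier H" "b \<in> carrier B"
      "a' \<in> carrier A" "h' \<in> carrier H" "b' \<in> carrier B" for a h b a' h' b'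
  proof -
    \<comment> \<open>The factors free of legs of h and h'. With these in front, each remaining sum
      is an instance of the counit law of H.\<close>
    let ?c = "counit A a \<otimes> counit A a' \<otimes> counit B b \<otimes> counit B b'"
    have "counit Y (tens3 K A H B a h b \<otimes>\<^bsub>Y\<^esub> tens3 K A H B a' h' b')
      = sw K 0 H H (base_space K) (comult H h) (\<lambda>h1 h2. sw K 0 H H (base_space K) (comult H h') (\<lambda>k1 k2.
          ?c \<otimes> (counit H h1 \<otimes> (counit H h2 \<otimes> (counit H k1 \<otimes> counit H k2)))))"
      by (simp add: mult_Y_tens counit_Y_tens Y_sw A.braided_counit_mult B.braided_counit_mult
          A.counit_act B.counit_act counit_mult H.K.m_ac)
    also have "\<dots> = counit Y (tens3 K A H B a h b) \<otimes> counit Y (tens3 K A H B a' h' b')"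
      by (simp add: H.K.sw_base_mult counit_base_sw counit_Y_tens) (simp add: H.K.m_ac)
    finally show ?thesis .
  qed
  have 1: "counit Y (tens3 K A H B a h b \<otimes>\<^bsub>Y\<^esub> t) = counit Y (tens3 K A H B a h b) \<otimes> counit Y t"
    if [simp]: "a \<in> carrier A" "h \<in> carrier H" "b \<in> carrier B" for a h b
    by (rule ext[OF _ _ _ _ _ _ _ t]) (simp_all add: 0)
  show ?thesis
    by (rule ext[OF _ _ _ _ _ _ _ s]) (simp_all add: 1)
qed

lemma coalgebra_Y: "coalgebra K Y"
  by (rule coalgebraI[OF same_space_Y]) (simp_all add: H.K.field_axioms coassoc_Y counit_Y_sw)

lemma bialgebra_Y: "bialgebra K Y"
proof (intro bialgebra.intro bialgebra_axioms.intro assoc_algebra_Y coalgebra_Y)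
  note Y = same_space[OF same_space_Y]
  show "comult Y \<one>\<^bsub>Y\<^esub> = \<one>\<^bsub>tensor_coalg K Y Y\<^esub>"
    by (simp add: tensor_coalg_simps Y one_Y comult_Y_tens comult_one_sw A.comult_one_sw B.comult_one_sw
        A.coact_one_sw B.coact_one_sw)
  show "counit Y \<one>\<^bsub>Y\<^esub> = \<one>\<^bsub>K\<^esub>"
    by (simp add: one_Y counit_Y_tens counit_one A.braided_counit_one B.braided_counit_one)
  fix x y assume "x \<in> carrier Y" "y \<in> carrier Y"
  then have [simp]: "x \<in> carrier T" "y \<in> carrier T" by (simp_all add: Y)
  show "counit Y (x \<otimes>\<^bsub>Y\<^esub> y) = counit Y x \<otimes>\<^bsub>K\<^esub> counit Y y" by (simp add: counit_mult_Y)
  \<comment> \<open>Choosing \<open>tens\<close> for F recovers the identity of tensors from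
    \<open>comult_mult_Y\<close>.\<close>
  have "comult Y (x \<otimes>\<^bsub>Y\<^esub> y) = sw K 0 T T (tensor K T T) (comult Y (x \<otimes>\<^bsub>Y\<^esub> y)) (tens K T T)"
    by (simp add: sw_tens_id)
  also have "\<dots> = sw K 0 T T (tensor K T T) (comult Y x) (\<lambda>x1 x2.
      sw K 0 T T (tensor K T T) (comult Y y) (\<lambda>y1 y2. tens K T T (x1 \<otimes>\<^bsub>Y\<^esub> y1) (x2 \<otimes>\<^bsub>Y\<^esub> y2)))"
    by (rule comult_mult_Y) simp_all
  also have "\<dots> = comult Y x \<otimes>\<^bsub>tensor_coalg K Y Y\<^esub> comult Y y"
    by (simp add: tensor_coalg_def Let_def Y sweedler_comult_Y)
  finally show "comult Y (x \<otimes>\<^bsub>Y\<^esub> y) = comult Y x \<otimes>\<^bsub>tensor_coalg K Y Y\<^esub> comult Y y" .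
qed

end

section \<open>The tensor product algebra and coalgebra\<close>

lemma tensor_bilinear_ext:
  assumes U: "module K U" and V: "module K V" and W: "module K W" and X: "module K X" and M: "module K M"
    and s: "s \<in> carrier (tensor K U V)" and t: "t \<in> carrier (tensor K W X)"
    and f: "bilinear_map K (tensor K U V) (tensor K W X) M f"
    and g: "bilinear_map K (tensor K U V) (tensor K W X) M g"
    and eq: "\<And>u v w x. \<lbrakk>u \<in> carrier U; v \<in> carrier V; w \<in> carrier W; x \<in> carrier X\<rbrakk>
      \<Longrightarrow> f (tens K U V u v) (tens K W X w x) = g (tens K U V u v) (tens K W X w x)"
  shows "f s t = g s t"
proof (rule tensor_ext[OF U V M _ _ _ s])
  show "linear_map K (tensor K U V) M (\<lambda>s. f s t)" "linear_map K (tensor K U V) M (\<lambda>s. g s t)"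
    using f g t by (simp_all add: bilinear_map_def)
  fix u v assume uv: "u \<in> carrier U" "v \<in> carrier V"
  show "f (tens K U V u v) t = g (tens K U V u v) t"
    by (rule tensor_ext[OF W X M _ _ _ t])
      (use f g uv U V in \<open>auto simp: bilinear_map_def eq\<close>)
qed

text \<open>Only the algebra and the coalgebra structure of the tensor product are treated in this
  locale. For D their compatibility is the twisted one of an L-R-admissible pair and is proved among
  those axioms.\<close>

locale tensor_coalg_pair =
  V: assoc_algebra K V + VC: coalgebra K V + W: assoc_algebra K W + WC: coalgebra K W
  for K (structure) and V :: "('k, 'v) coalg" (structure) and W :: "('k, 'w) coalg" (structure)
begin

abbreviation "S \<equiv> tensor K V W"
abbreviation "D \<equiv> tensor_coalg K V W"

lemmas to_sw_D = VC.sweedler_comult WC.sweedler_comult sweedler_tens_eq_sw sweedler_sw_eq_sw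
  sweedler_eq_sw[where V = V and W = W and n = 0]

lemma mult_D:
  assumes "s \<in> carrier S" "t \<in> carrier S"
  shows "s \<otimes>\<^bsub>D\<^esub> t = sw K 0 V W S s (\<lambda>v w. sw K 0 V W S t (\<lambda>v' w'.
    tens K V W (v \<otimes>\<^bsub>V\<^esub> v') (w \<otimes>\<^bsub>W\<^esub> w')))"
  using assms by (simp add: tensor_coalg_def Let_def to_sw_D)

lemma comult_D:
  assumes "t \<in> carrier S"
  shows "comult D t = sw K 0 V W (tensor K S S) t (\<lambda>v w. sw K 0 V V (tensor K S S) (comult V v) (\<lambda>v1 v2.
    sw K 0 W W (tensor K S S) (comult W w) (\<lambda>w1 w2. tens K S S (tens K V W v1 w1) (tens K V W v2 w2))))"
  using assms by (simp add: tensor_coalg_def Let_def to_sw_D)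

lemma counit_D:
  assumes "t \<in> carrier S"
  shows "counit D t = sw K 0 V W (base_space K) t (\<lambda>v w. counit V v \<otimes>\<^bsub>K\<^esub> counit W w)"
  using assms by (simp add: tensor_coalg_def Let_def to_sw_D)

lemma one_D: "\<one>\<^bsub>D\<^esub> = tens K V W \<one>\<^bsub>V\<^esub> \<one>\<^bsub>W\<^esub>"
  by (simp add: tensor_coalg_simps)

lemma D_closed [simp]:
  "\<lbrakk>s \<in> carrier S; t \<in> carrier S\<rbrakk> \<Longrightarrow> s \<otimes>\<^bsub>D\<^esub> t \<in> carrier S"
  "t \<in> carrier S \<Longrightarrow> comult D t \<in> carrier (tensor K S S)"
  "t \<in> carrier S \<Longrightarrow> counit D t \<in> carrier K"
  by (simp_all add: mult_D comult_D counit_D)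

lemma linear_D [simp]:
  "\<lbrakk>linear_map K X S f; t \<in> carrier S\<rbrakk> \<Longrightarrow> linear_map K X S (\<lambda>x. f x \<otimes>\<^bsub>D\<^esub> t)"
  "\<lbrakk>linear_map K X S f; t \<in> carrier S\<rbrakk> \<Longrightarrow> linear_map K X S (\<lambda>x. t \<otimes>\<^bsub>D\<^esub> f x)"
  "linear_map K X S f \<Longrightarrow> linear_map K X (tensor K S S) (\<lambda>x. comult D (f x))"
  "linear_map K X S f \<Longrightarrow> linear_map K X (base_space K) (\<lambda>x. counit D (f x))"
  by (rule linear_map_comp[where f = f, OF linear_map_cong[OF _ mult_D]]
      linear_map_comp[where f = f, OF linear_map_cong[OF _ comult_D]]
      linear_map_comp[where f = f, OF linear_map_cong[OF _ counit_D]]; simp)+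

lemma D_tens:
  assumes [simp]: "v \<in> carrier V" "w \<in> carrier W"
  shows mult_D_tens: "\<lbrakk>v' \<in> carrier V; w' \<in> carrier W\<rbrakk> \<Longrightarrow>
      tens K V W v w \<otimes>\<^bsub>D\<^esub> tens K V W v' w' = tens K V W (v \<otimes>\<^bsub>V\<^esub> v') (w \<otimes>\<^bsub>W\<^esub> w')"
    and comult_D_tens: "comult D (tens K V W v w) = sw K 0 V V (tensor K S S) (comult V v) (\<lambda>v1 v2.
      sw K 0 W W (tensor K S S) (comult W w) (\<lambda>w1 w2. tens K S S (tens K V W v1 w1) (tens K V W v2 w2)))"
    and counit_D_tens: "counit D (tens K V W v w) = counit V v \<otimes>\<^bsub>K\<^esub> counit W w"
  by (simp_all add: mult_D comult_D counit_D)

lemmas sweedler_comult_D = sweedler_comult_sw[OF _ linear_D(3)[OF linear_id]]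

lemma module_D: "module K D"
  by (rule same_space_module[OF same_space_tensor_coalg]) simp

lemma assoc_algebra_D: "assoc_algebra K D"
proof (rule assoc_algebraI[OF same_space_tensor_coalg])
  show "(x \<otimes>\<^bsub>D\<^esub> y) \<otimes>\<^bsub>D\<^esub> z = x \<otimes>\<^bsub>D\<^esub> (y \<otimes>\<^bsub>D\<^esub> z)"
    if x [simp]: "x \<in> carrier S" and y [simp]: "y \<in> carrier S" and z [simp]: "z \<in> carrier S" for x y z
  proof (rule tensor_bilinear_ext[where M = S, OF _ _ _ _ _ x y])
    fix a b a' b' assume [simp]: "a \<in> carrier V" "b \<in> carrier W" "a' \<in> carrier V" "b' \<in> carrier W"
    show "(tens K V W a b \<otimes>\<^bsub>D\<^esub> tens K V W a' b') \<otimes>\<^bsub>D\<^esub> z = tens K V W a b \<otimes>\<^bsub>D\<^esub> (tens K V W a' b' \<otimes>\<^bsub>D\<^esub> z)"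
      by (rule tensor_ext[where M = S, OF _ _ _ _ _ _ z]) (simp_all add: D_tens V.A.m_assoc W.A.m_assoc)
  qed simp_all
  show "\<one>\<^bsub>D\<^esub> \<otimes>\<^bsub>D\<^esub> x = x" "x \<otimes>\<^bsub>D\<^esub> \<one>\<^bsub>D\<^esub> = x" if x: "x \<in> carrier S" for x
    by (rule tensor_ext[where M = S, OF _ _ _ _ _ _ x]; simp add: one_D D_tens)+
qed (simp_all add: V.K.field_axioms one_D)

lemma coassoc_D:
  assumes c: "c \<in> carrier S" and F: "trilinear_map K S S S M F" and [simp]: "module K M"
  shows "sw K 0 S S M (comult D c) (\<lambda>x y. sw K 0 S S M (comult D x) (\<lambda>x1 x2. F x1 x2 y))
    = sw K 0 S S M (comult D c) (\<lambda>x y. sw K 0 S S M (comult D y) (\<lambda>y1 y2. F x y1 y2))"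
    (is "?L c = ?R c")
proof (rule tensor_ext[where M = M, OF _ _ _ _ _ _ c])
  note [simp] = trilinear_rules[OF F]
  fix v w assume [simp]: "v \<in> carrier V" "w \<in> carrier W"
  \<comment> \<open>Keys 1 and 2 belong to v, keys 3 and 4 to w; once separated, the two strands are
    coassociative on their own.\<close>
  have L: "?L (tens K V W v w)
    = sw K 1 V V M (comult V v) (\<lambda>v1 v2. sw K 3 W W M (comult W w) (\<lambda>w1 w2.
      sw K 2 V V M (comult V v1) (\<lambda>x1 x2. sw K 4 W W M (comult W w1) (\<lambda>y1 y2.
        F (tens K V W x1 y1) (tens K V W x2 y2) (tens K V W v2 w2)))))"
    by (simp add: comult_D_tens sw_relabel0)
  have R: "?R (tens K V W v w)
    = sw K 1 V V M (comult V v) (\<lambda>v1 v2. sw K 3 W W M (comult W w) (\<lambda>w1 w2.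
      sw K 2 V V M (comult V v2) (\<lambda>x1 x2. sw K 4 W W M (comult W w2) (\<lambda>y1 y2.
        F (tens K V W v1 w1) (tens K V W x1 y1) (tens K V W x2 y2)))))"
    by (simp add: comult_D_tens sw_relabel0)
  show "?L (tens K V W v w) = ?R (tens K V W v w)"
    unfolding L R by (simp add: sw_sort) (simp add: sw_relabel0 VC.coassoc_sw WC.coassoc_sw)
qed (simp_all add: trilinear_rules[OF F])

lemma coalgebra_D: "coalgebra K D"
proof (rule coalgebraI[OF same_space_tensor_coalg])
  have S: "module K S" by simp
  note counit = D_tens module.smult_assoc1[OF S] module.smult_closed[OF S] smult_out
    VC.counit_sw WC.counit_sw
  fix c assume c [simp]: "c \<in> carrier S"
  show "sw K 0 S S S (comult D c) (\<lambda>x y. counit D x \<odot>\<^bsub>S\<^esub> y) = c"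
    by (rule tensor_ext[where M = S, OF _ _ _ _ _ _ c]) (simp_all, simp_all add: counit)
  show "sw K 0 S S S (comult D c) (\<lambda>x y. counit D y \<odot>\<^bsub>S\<^esub> x) = c"
    by (rule tensor_ext[where M = S, OF _ _ _ _ _ _ c]) (simp_all, simp_all add: counit)
qed (simp_all add: V.K.field_axioms coassoc_D)

end

section \<open>The L-R-admissible pair\<close>

context double_biproduct_data
begin

sublocale AB: tensor_coalg_pair K A B
  by (intro tensor_coalg_pair.intro A.A.assoc_algebra_axioms A.A.coalgebra_axioms
      B.B.assoc_algebra_axioms B.B.coalgebra_axioms)

section \<open>Actions and coactions on the tensor product of A and B\<close>

abbreviation "S \<equiv> tensor K A B"
abbreviation "D \<equiv> tensor_coalg K A B"
abbreviation "lact \<equiv> prod_lact K A actA B"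
abbreviation "ract \<equiv> prod_ract K A B actB"
abbreviation "lcoact \<equiv> prod_lcoact K H A coactA B"
abbreviation "rcoact \<equiv> prod_rcoact K H A B coactB"

lemmas same_D = same_space[OF same_space_tensor_coalg[where K = K and V = A and W = B]]

lemma lact:
  assumes "d \<in> carrier S" "h \<in> carrier H"
  shows "lact h d = sw K 0 A B S d (\<lambda>a b. tens K A B (actA h a) b)"
  using assms by (simp add: prod_lact_def AB.to_sw_D)

lemma ract:
  assumes "d \<in> carrier S" "h \<in> carrier H"
  shows "ract d h = sw K 0 A B S d (\<lambda>a b. tens K A B a (actB b h))"
  using assms by (simp add: prod_ract_def AB.to_sw_D)

lemma lcoact:
  assumes "d \<in> carrier S"
  shows "lcoact d = sw K 0 A B (tensor K H S) d (\<lambda>a b. sw K 0 H A (tensor K H S) (coactA a) (\<lambda>h a'.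
    tens K H S h (tens K A B a' b)))"
  using assms by (simp add: prod_lcoact_def Let_def AB.to_sw_D A.sweedler_coact)

lemma rcoact:
  assumes "d \<in> carrier S"
  shows "rcoact d = sw K 0 A B (tensor K S H) d (\<lambda>a b. sw K 0 B H (tensor K S H) (coactB b) (\<lambda>b' h.
    tens K S H (tens K A B a b') h))"
  using assms by (simp add: prod_rcoact_def Let_def AB.to_sw_D B.sweedler_coact)

lemma lr_closed [simp]:
  "\<lbrakk>h \<in> carrier H; d \<in> carrier S\<rbrakk> \<Longrightarrow> lact h d \<in> carrier S"
  "\<lbrakk>h \<in> carrier H; d \<in> carrier S\<rbrakk> \<Longrightarrow> ract d h \<in> carrier S"
  "d \<in> carrier S \<Longrightarrow> lcoact d \<in> carrier (tensor K H S)"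
  "d \<in> carrier S \<Longrightarrow> rcoact d \<in> carrier (tensor K S H)"
  by (simp_all add: lact ract lcoact rcoact)

lemma linear_lr [simp]:
  "\<lbrakk>linear_map K X S f; h \<in> carrier H\<rbrakk> \<Longrightarrow> linear_map K X S (\<lambda>x. lact h (f x))"
  "\<lbrakk>linear_map K X S f; h \<in> carrier H\<rbrakk> \<Longrightarrow> linear_map K X S (\<lambda>x. ract (f x) h)"
  "\<lbrakk>linear_map K W H g; d \<in> carrier S\<rbrakk> \<Longrightarrow> linear_map K W S (\<lambda>x. lact (g x) d)"
  "\<lbrakk>linear_map K W H g; d \<in> carrier S\<rbrakk> \<Longrightarrow> linear_map K W S (\<lambda>x. ract d (g x))"
  "linear_map K X S f \<Longrightarrow> linear_map K X (tensor K H S) (\<lambda>x. lcoact (f x))"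
  "linear_map K X S f \<Longrightarrow> linear_map K X (tensor K S H) (\<lambda>x. rcoact (f x))"
  \<comment> \<open>The trailing \<open>fail\<close> rejects a rule whose premises are left open, so
    that backtracking reaches the composition in the intended argument.\<close>
  by (rule linear_map_comp[where f = f, OF linear_map_cong[OF _ lact]]
      linear_map_comp[where f = f, OF linear_map_cong[OF _ ract]]
      linear_map_comp[where f = g, OF linear_map_cong[OF _ lact]]
      linear_map_comp[where f = g, OF linear_map_cong[OF _ ract]]
      linear_map_comp[where f = f, OF linear_map_cong[OF _ lcoact]]
      linear_map_comp[where f = f, OF linear_map_cong[OF _ rcoact]]; simp; fail)+

lemma lr_tens:
  assumes [simp]: "a \<in> carrier A" "b \<in> carrier B"
  shows "h \<in> carrier H \<Longrightarrow> lact h (tens K A B a b) = tens K A B (actA h a) b"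
    and "h \<in> carrier H \<Longrightarrow> ract (tens K A B a b) h = tens K A B a (actB b h)"
    and "lcoact (tens K A B a b) = sw K 0 H A (tensor K H S) (coactA a) (\<lambda>h a'. tens K H S h (tens K A B a' b))"
    and "rcoact (tens K A B a b) = sw K 0 B H (tensor K S H) (coactB b) (\<lambda>b' h. tens K S H (tens K A B a b') h)"
  by (simp_all add: lact ract lcoact rcoact)

lemma sweedler_lcoact:
  assumes "module K M" "c \<in> carrier S" "\<And>x y. \<lbrakk>x \<in> carrier H; y \<in> carrier S\<rbrakk> \<Longrightarrow> f x y \<in> carrier M"
  shows "sweedler K M (lcoact c) f = sw K 0 H S M (lcoact c) f"
  by (rule sweedler_eq_sw) (simp_all add: assms)

lemma sweedler_rcoact:
  assumes "module K M" "c \<in> carrier S" "\<And>x y. \<lbrakk>x \<in> carrier S; y \<in> carrier H\<rbrakk> \<Longrightarrow> f x y \<in> carrier M"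
  shows "sweedler K M (rcoact c) f = sw K 0 S H M (rcoact c) f"
  by (rule sweedler_eq_sw) (simp_all add: assms)

lemmas to_sw_lr = sweedler_lcoact sweedler_rcoact sweedler_comult AB.sweedler_comult_D

section \<open>Module and comodule axioms, then the compatibility axioms, for D\<close>

lemma left_module_D: "left_module K H D lact"
proof (intro left_module.intro left_module_axioms.intro H.bialgebra_axioms AB.module_D)
  note ext = tensor_ext[where K = K and V = A and W = B and M = S]
  show "bilinear_map K H D D lact" unfolding same_D by simp
  fix d assume "d \<in> carrier D"
  then have d: "d \<in> carrier S" by (simp add: same_D)
  show "lact \<one>\<^bsub>H\<^esub> d = d"
    by (rule ext[OF _ _ _ _ _ _ d]) (simp_all add: lr_tens A.act_one)
  fix g h assume [simp]: "g \<in> carrier H" "h \<in> carrier H"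
  show "lact (g \<cdot> h) d = lact g (lact h d)"
    by (rule ext[OF _ _ _ _ _ _ d]) (simp_all add: lr_tens A.act_mult)
qed

lemma right_module_D: "right_module K H D ract"
proof (intro right_module.intro right_module_axioms.intro H.bialgebra_axioms AB.module_D)
  note ext = tensor_ext[where K = K and V = A and W = B and M = S]
  show "bilinear_map K D H D ract" unfolding same_D by simp
  fix d assume "d \<in> carrier D"
  then have d: "d \<in> carrier S" by (simp add: same_D)
  show "ract d \<one>\<^bsub>H\<^esub> = d"
    by (rule ext[OF _ _ _ _ _ _ d]) (simp_all add: lr_tens B.act_one)
  fix g h assume [simp]: "g \<in> carrier H" "h \<in> carrier H"
  show "ract d (g \<cdot> h) = ract (ract d g) h"
    by (rule ext[OF _ _ _ _ _ _ d]) (simp_all add: lr_tens B.act_mult)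
qed

lemma left_comodule_D: "left_comodule K H D lcoact"
proof (intro left_comodule.intro left_comodule_axioms.intro H.bialgebra_axioms AB.module_D)
  note ext = tensor_ext[where K = K and V = A and W = B]
  have S: "module K S" by simp
  show "linear_map K D (tensor K H D) lcoact" unfolding same_D by simp
  fix d assume "d \<in> carrier D"
  then have d [simp]: "d \<in> carrier S" by (simp add: same_D)
  show "(\<Oplus>[K, tensor3 K H H D] h \<otimes> v' \<in> lcoact d.
        \<Oplus>[K, tensor3 K H H D] h1 \<otimes> h2 \<in> comult H h. tens3 K H H D h1 h2 v')
      = (\<Oplus>[K, tensor3 K H H D] h \<otimes> v' \<in> lcoact d.
        \<Oplus>[K, tensor3 K H H D] g \<otimes> v'' \<in> lcoact v'. tens3 K H H D h g v'')"
    unfolding same_D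
    by (simp add: to_sw_lr, rule ext[where M = "tensor3 K H H S", OF _ _ _ _ _ _ d])
      (simp_all add: lr_tens A.coact_coassoc_sw)
  have "sw K 0 H S S (lcoact d) (\<lambda>h v'. counit H h \<odot>\<^bsub>S\<^esub> v') = d"
    by (rule ext[where M = S, OF _ _ _ _ _ _ d])
      (simp_all add: lr_tens A.coact_counit_sw)
  then show "(\<Oplus>[K, D] h \<otimes> v' \<in> lcoact d. counit H h \<odot>\<^bsub>D\<^esub> v') = d"
    unfolding same_D by (simp add: to_sw_lr module.smult_closed[OF S])
qed

lemma right_comodule_D: "right_comodule K H D rcoact"
proof (intro right_comodule.intro right_comodule_axioms.intro H.bialgebra_axioms AB.module_D)
  note ext = tensor_ext[where K = K and V = A and W = B]
  have S: "module K S" by simp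
  show "linear_map K D (tensor K D H) rcoact" unfolding same_D by simp
  fix d assume "d \<in> carrier D"
  then have d [simp]: "d \<in> carrier S" by (simp add: same_D)
  show "(\<Oplus>[K, tensor3 K D H H] v' \<otimes> h \<in> rcoact d.
        \<Oplus>[K, tensor3 K D H H] v'' \<otimes> g \<in> rcoact v'. tens3 K D H H v'' g h)
      = (\<Oplus>[K, tensor3 K D H H] v' \<otimes> h \<in> rcoact d.
        \<Oplus>[K, tensor3 K D H H] h1 \<otimes> h2 \<in> comult H h. tens3 K D H H v' h1 h2)"
    unfolding same_D
    by (simp add: to_sw_lr, rule ext[where M = "tensor3 K S H H", OF _ _ _ _ _ _ d])
      (simp_all add: lr_tens B.coact_coassoc_sw)
  have "sw K 0 S H S (rcoact d) (\<lambda>v' h. counit H h \<odot>\<^bsub>S\<^esub> v') = d"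
    by (rule ext[where M = S, OF _ _ _ _ _ _ d])
      (simp_all add: lr_tens B.coact_counit_sw)
  then show "(\<Oplus>[K, D] v' \<otimes> h \<in> rcoact d. counit H h \<odot>\<^bsub>D\<^esub> v') = d"
    unfolding same_D by (simp add: to_sw_lr module.smult_closed[OF S])
qed

lemma lr_admissible_D: "lr_admissible K H D lact ract lcoact rcoact"
proof (intro lr_admissible.intro lr_admissible_axioms.intro H.bialgebra_axioms AB.assoc_algebra_D
    AB.coalgebra_D left_module_D right_module_D left_comodule_D right_comodule_D, unfold same_D)
  note ext = tensor_ext[where K = K and V = A and W = B]
    and ext2 = tensor_bilinear_ext[where K = K and U = A and V = B and W = A and X = B]
  have S: "module K S" by simp
  note pure = lr_tens AB.D_tens AB.one_D
  \<comment> \<open>Instances that move sums over legs of b in front of sums over legs of a; fixing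
    the spaces keeps the exchange from looping.\<close>
  note B_first = sw_swap[where V = A and W = A and P = B and Q = B]
    sw_swap[where V = A and W = A and P = B and Q = H]
    sw_swap[where V = H and W = A and P = B and Q = B]
    sw_swap[where V = H and W = A and P = B and Q = H]
  { fix d assume d [simp]: "d \<in> carrier S"
    \<comment> \<open>The left coaction touches only the A-factor and the right coaction only the
      B-factor, so they commute.\<close>
    show "(\<Oplus>[K, tensor3 K H S H] d' \<otimes> h \<in> rcoact d.
        \<Oplus>[K, tensor3 K H S H] g \<otimes> d'' \<in> lcoact d'. tens3 K H S H g d'' h)
      = (\<Oplus>[K, tensor3 K H S H] g \<otimes> d' \<in> lcoact d.
        \<Oplus>[K, tensor3 K H S H] d'' \<otimes> h \<in> rcoact d'. tens3 K H S H g d'' h)"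
      by (simp add: to_sw_lr, rule ext[where M = "tensor3 K H S H", OF _ _ _ _ _ _ d])
        (simp_all add: pure, intro sw_swap, simp)
    show "(\<Oplus>[K, tensor3 K H S S] d1 \<otimes> d2 \<in> comult D d.
        \<Oplus>[K, tensor3 K H S S] g \<otimes> d1' \<in> lcoact d1. \<Oplus>[K, tensor3 K H S S] h \<otimes> d2' \<in> lcoact d2.
          tens3 K H S S (g \<cdot> h) d1' d2')
      = (\<Oplus>[K, tensor3 K H S S] h \<otimes> d' \<in> lcoact d.
        \<Oplus>[K, tensor3 K H S S] d1 \<otimes> d2 \<in> comult D d'. tens3 K H S S h d1 d2)"
      by (simp add: to_sw_lr, rule ext[where M = "tensor3 K H S S", OF _ _ _ _ _ _ d])
        (simp_all add: pure B_first
          \<comment> \<open>F is given explicitly because it carries the legs w and w' of the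
            B-factor as parameters.\<close>
          A.comult_coact_sw[where F = "\<lambda>g v v'. tens3 K H S S g (tens K A B v w) (tens K A B v' w')" for w w'])
    show "(\<Oplus>[K, H] h \<otimes> d' \<in> lcoact d. counit D d' \<odot>\<^bsub>H\<^esub> h) = counit D d \<odot>\<^bsub>H\<^esub> \<one>\<^bsub>H\<^esub>"
      by (simp add: to_sw_lr, rule ext[where M = "H", OF _ _ _ _ _ _ d])
        (simp_all add: pure module.smult_assoc1[OF H.module_A] smult_out A.counit_coact_sw B.counit_coact_sw)
    show "(\<Oplus>[K, tensor3 K S S H] d1 \<otimes> d2 \<in> comult D d.
        \<Oplus>[K, tensor3 K S S H] d1' \<otimes> g \<in> rcoact d1. \<Oplus>[K, tensor3 K S S H] d2' \<otimes> h \<in> rcoact d2.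
          tens3 K S S H d1' d2' (g \<cdot> h))
      = (\<Oplus>[K, tensor3 K S S H] d' \<otimes> h \<in> rcoact d.
        \<Oplus>[K, tensor3 K S S H] d1 \<otimes> d2 \<in> comult D d'. tens3 K S S H d1 d2 h)"
      by (simp add: to_sw_lr, rule ext[where M = "tensor3 K S S H", OF _ _ _ _ _ _ d])
        (simp_all add: pure
          B.comult_coact_sw[where F = "\<lambda>v v' g. tens3 K S S H (tens K A B w v) (tens K A B w' v') g" for w w']
          sw_swap[where V = B and W = H and P = A and Q = A])
    show "(\<Oplus>[K, H] d' \<otimes> h \<in> rcoact d. counit D d' \<odot>\<^bsub>H\<^esub> h) = counit D d \<odot>\<^bsub>H\<^esub> \<one>\<^bsub>H\<^esub>"
      by (simp add: to_sw_lr, rule ext[where M = "H", OF _ _ _ _ _ _ d])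
        (simp_all add: pure module.smult_assoc1[OF H.module_A] smult_out A.counit_coact_sw B.counit_coact_sw)
  }
  show "counit D \<one>\<^bsub>D\<^esub> = \<one>\<^bsub>K\<^esub>" "rcoact \<one>\<^bsub>D\<^esub> = tens K S H \<one>\<^bsub>D\<^esub> \<one>\<^bsub>H\<^esub>"
    "lcoact \<one>\<^bsub>D\<^esub> = tens K H S \<one>\<^bsub>H\<^esub> \<one>\<^bsub>D\<^esub>" "comult D \<one>\<^bsub>D\<^esub> = tens K S S \<one>\<^bsub>D\<^esub> \<one>\<^bsub>D\<^esub>"
    by (simp_all add: pure A.braided_counit_one B.braided_counit_one A.coact_one_sw B.coact_one_sw
        A.comult_one_sw B.comult_one_sw)
  { fix h assume h [simp]: "h \<in> carrier H"
    show "lact h \<one>\<^bsub>D\<^esub> = counit H h \<odot>\<^bsub>S\<^esub> \<one>\<^bsub>D\<^esub>" "ract \<one>\<^bsub>D\<^esub> h = counit H h \<odot>\<^bsub>S\<^esub> \<one>\<^bsub>D\<^esub>"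
      by (simp_all add: pure A.act_unit B.act_unit tens_smult)
    fix d assume d [simp]: "d \<in> carrier S"
    { fix g assume [simp]: "g \<in> carrier H"
      show "ract (lact g d) h = lact g (ract d h)"
        by (rule ext[where M = S, OF _ _ _ _ _ _ d]) (simp_all add: pure) }
    show "counit D (lact h d) = counit D d \<otimes>\<^bsub>K\<^esub> counit H h"
      "counit D (ract d h) = counit D d \<otimes>\<^bsub>K\<^esub> counit H h"
      by (rule ext[where M = "base_space K", OF _ _ _ _ _ _ d];
        simp add: pure A.counit_act B.counit_act H.K.m_ac)+
    show "comult D (lact h d)
      = (\<Oplus>[K, tensor K S S] h1 \<otimes> h2 \<in> comult H h. \<Oplus>[K, tensor K S S] d1 \<otimes> d2 \<in> comult D d.
          tens K S S (lact h1 d1) (lact h2 d2))"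
      by (simp add: to_sw_lr, rule ext[where M = "tensor K S S", OF _ _ _ _ _ _ d])
        (simp_all add: pure A.comult_act_sw sw_swap[where V = H and W = H and P = A and Q = A])
    show "comult D (ract d h)
      = (\<Oplus>[K, tensor K S S] d1 \<otimes> d2 \<in> comult D d. \<Oplus>[K, tensor K S S] h1 \<otimes> h2 \<in> comult H h.
          tens K S S (ract d1 h1) (ract d2 h2))"
      by (simp add: to_sw_lr, rule ext[where M = "tensor K S S", OF _ _ _ _ _ _ d])
        (simp_all add: pure B.comult_act_sw)
    show "(\<Oplus>[K, tensor K H S] h1 \<otimes> h2 \<in> comult H h. \<Oplus>[K, tensor K H S] g \<otimes> d' \<in> lcoact (lact h1 d).
        tens K H S (g \<cdot> h2) d')
      = (\<Oplus>[K, tensor K H S] h1 \<otimes> h2 \<in> comult H h. \<Oplus>[K, tensor K H S] g \<otimes> d' \<in> lcoact d.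
        tens K H S (h1 \<cdot> g) (lact h2 d'))"
      by (simp add: to_sw_lr, rule ext[where M = "tensor K H S", OF _ _ _ _ _ _ d])
        (simp_all add: pure A.yd_sw[where F = "\<lambda>g v. tens K H S g (tens K A B v w)" for w])
    show "rcoact (lact h d) = (\<Oplus>[K, tensor K S H] d' \<otimes> g \<in> rcoact d. tens K S H (lact h d') g)"
      by (simp add: to_sw_lr, rule ext[where M = "tensor K S H", OF _ _ _ _ _ _ d]) (simp_all add: pure)
    show "(\<Oplus>[K, tensor K S H] h1 \<otimes> h2 \<in> comult H h. \<Oplus>[K, tensor K S H] d' \<otimes> g \<in> rcoact (ract d h2).
        tens K S H d' (h1 \<cdot> g))
      = (\<Oplus>[K, tensor K S H] h1 \<otimes> h2 \<in> comult H h. \<Oplus>[K, tensor K S H] d' \<otimes> g \<in> rcoact d.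
        tens K S H (ract d' h1) (g \<cdot> h2))"
      by (simp add: to_sw_lr, rule ext[where M = "tensor K S H", OF _ _ _ _ _ _ d])
        (simp_all add: pure B.yd_sw[where F = "\<lambda>v g. tens K S H (tens K A B w v) g" for w])
    show "lcoact (ract d h) = (\<Oplus>[K, tensor K H S] g \<otimes> d' \<in> lcoact d. tens K H S g (ract d' h))"
      by (simp add: to_sw_lr, rule ext[where M = "tensor K H S", OF _ _ _ _ _ _ d]) (simp_all add: pure)
  }
  fix c d assume c [simp]: "c \<in> carrier S" and d [simp]: "d \<in> carrier S"
  { fix h assume h [simp]: "h \<in> carrier H"
    show "lact h (c \<otimes>\<^bsub>D\<^esub> d) = (\<Oplus>[K, S] h1 \<otimes> h2 \<in> comult H h. lact h1 c \<otimes>\<^bsub>D\<^esub> lact h2 d)"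
      by (simp add: to_sw_lr, rule ext2[where M = S, OF _ _ _ _ _ c d])
        (simp_all add: pure A.act_prod tens_sw)
    show "ract (c \<otimes>\<^bsub>D\<^esub> d) h = (\<Oplus>[K, S] h1 \<otimes> h2 \<in> comult H h. ract c h1 \<otimes>\<^bsub>D\<^esub> ract d h2)"
      by (simp add: to_sw_lr, rule ext2[where M = S, OF _ _ _ _ _ c d])
        (simp_all add: pure B.act_prod tens_sw) }
  show "counit D (c \<otimes>\<^bsub>D\<^esub> d) = counit D c \<otimes>\<^bsub>K\<^esub> counit D d"
    by (rule ext2[where M = "base_space K", OF _ _ _ _ _ c d])
      (simp_all add: pure A.braided_counit_mult B.braided_counit_mult H.K.m_ac)
  show "rcoact (c \<otimes>\<^bsub>D\<^esub> d)
      = (\<Oplus>[K, tensor K S H] c' \<otimes> g \<in> rcoact c. \<Oplus>[K, tensor K S H] d' \<otimes> h \<in> rcoact d.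
          tens K S H (c' \<otimes>\<^bsub>D\<^esub> d') (g \<cdot> h))"
    by (simp add: to_sw_lr, rule ext2[where M = "tensor K S H", OF _ _ _ _ _ c d])
      (simp_all add: pure B.coact_prod_sw)
  show "lcoact (c \<otimes>\<^bsub>D\<^esub> d)
      = (\<Oplus>[K, tensor K H S] g \<otimes> c' \<in> lcoact c. \<Oplus>[K, tensor K H S] h \<otimes> d' \<in> lcoact d.
          tens K H S (g \<cdot> h) (c' \<otimes>\<^bsub>D\<^esub> d'))"
    by (simp add: to_sw_lr, rule ext2[where M = "tensor K H S", OF _ _ _ _ _ c d])
      (simp_all add: pure A.coact_prod_sw)
  \<comment> \<open>The braiding of A supplies the left coaction of c2 acting on d1, the braiding of
    B the right coaction of d1 acting on c2. On pure tensors the twisted formula is therefore the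
    pair of braided multiplicativity laws.\<close>
  show "comult D (c \<otimes>\<^bsub>D\<^esub> d)
      = (\<Oplus>[K, tensor K S S] c1 \<otimes> c2 \<in> comult D c. \<Oplus>[K, tensor K S S] d1 \<otimes> d2 \<in> comult D d.
          \<Oplus>[K, tensor K S S] g \<otimes> c2' \<in> lcoact c2. \<Oplus>[K, tensor K S S] d1' \<otimes> h \<in> rcoact d1.
            tens K S S (c1 \<otimes>\<^bsub>D\<^esub> lact g d1') (ract c2' h \<otimes>\<^bsub>D\<^esub> d2))"
    by (simp add: to_sw_lr, rule ext2[where M = "tensor K S S", OF _ _ _ _ _ c d])
      (simp_all add: pure A.comult_mult_sw B.comult_mult_sw B_first)
  \<comment> \<open>Only the B-factor of c and the A-factor of d take part: the pairing condition is
    applied to these two, while the A-factor of c and the B-factor of d are parameters of F.\<close>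
  show "(\<Oplus>[K, tensor K S S] c' \<otimes> h \<in> rcoact c. \<Oplus>[K, tensor K S S] g \<otimes> d' \<in> lcoact d.
        tens K S S (ract c' g) (lact h d')) = tens K S S c d"
    by (simp add: to_sw_lr, rule ext2[where M = "tensor K S S", OF _ _ _ _ _ c d])
      (simp_all add: pure sw_swap[where V = B and W = H and P = H and Q = A]
        exchange_sw[where F = "\<lambda>x y. tens K S S (tens K A B a y) (tens K A B x b)" for a b])
qed

end

section \<open>Transport of bialgebra structures\<close>

text \<open>X is only a module with operations that \<phi> intertwines with those of Y. Together
  with the closure conditions this expresses product, unit and coproduct of X through Y and \<psi>,
  and every bialgebra axiom is pulled back from Y.\<close>

locale bialgebra_transport = X: module K X + Y: bialgebra K Y
  for K (structure) and X :: "('k, 'x) coalg" and Y :: "('k, 'y) coalg" +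
  fixes \<phi> :: "'x \<Rightarrow> 'y" and \<psi> :: "'y \<Rightarrow> 'x"
  assumes phi: "linear_map K X Y \<phi>" and psi: "linear_map K Y X \<psi>"
    and psi_phi: "x \<in> carrier X \<Longrightarrow> \<psi> (\<phi> x) = x" and phi_psi: "y \<in> carrier Y \<Longrightarrow> \<phi> (\<psi> y) = y"
    and one_closed: "\<one>\<^bsub>X\<^esub> \<in> carrier X" and phi_one: "\<phi> \<one>\<^bsub>X\<^esub> = \<one>\<^bsub>Y\<^esub>"
    and mult_closed: "\<lbrakk>x \<in> carrier X; x' \<in> carrier X\<rbrakk> \<Longrightarrow> x \<otimes>\<^bsub>X\<^esub> x' \<in> carrier X"
    and phi_mult: "\<lbrakk>x \<in> carrier X; x' \<in> carrier X\<rbrakk> \<Longrightarrow> \<phi> (x \<otimes>\<^bsub>X\<^esub> x') = \<phi> x \<otimes>\<^bsub>Y\<^esub> \<phi> x'"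
    and comult_closed: "x \<in> carrier X \<Longrightarrow> comult X x \<in> carrier (tensor K X X)"
    and comult_phi: "x \<in> carrier X \<Longrightarrow> comult Y (\<phi> x)
      = sw K 0 X X (tensor K Y Y) (comult X x) (\<lambda>x1 x2. tens K Y Y (\<phi> x1) (\<phi> x2))"
    and counit_phi: "x \<in> carrier X \<Longrightarrow> counit Y (\<phi> x) = counit X x"
begin

lemma module_X [simp]: "module K X" by (rule X.module_axioms)

lemma maps [simp]:
  "x \<in> carrier X \<Longrightarrow> \<phi> x \<in> carrier Y" "y \<in> carrier Y \<Longrightarrow> \<psi> y \<in> carrier X"
  "linear_map K V1 X f1 \<Longrightarrow> linear_map K V1 Y (\<lambda>v. \<phi> (f1 v))"
  "linear_map K V2 Y f2 \<Longrightarrow> linear_map K V2 X (\<lambda>v. \<psi> (f2 v))"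
  using linear_map_closed[OF phi] linear_map_closed[OF psi]
    linear_map_comp[OF phi] linear_map_comp[OF psi] by auto

lemmas closed [simp] = one_closed mult_closed comult_closed

lemma mult_X: "\<lbrakk>x \<in> carrier X; x' \<in> carrier X\<rbrakk> \<Longrightarrow> x \<otimes>\<^bsub>X\<^esub> x' = \<psi> (\<phi> x \<otimes>\<^bsub>Y\<^esub> \<phi> x')"
  using psi_phi[of "x \<otimes>\<^bsub>X\<^esub> x'"] by (simp add: phi_mult)

lemma one_X: "\<one>\<^bsub>X\<^esub> = \<psi> \<one>\<^bsub>Y\<^esub>"
  using psi_phi[of "\<one>\<^bsub>X\<^esub>"] by (simp add: phi_one)

lemma comult_X:
  assumes [simp]: "x \<in> carrier X"
  shows "comult X x = sw K 0 Y Y (tensor K X X) (comult Y (\<phi> x)) (\<lambda>y1 y2. tens K X X (\<psi> y1) (\<psi> y2))"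
  by (simp add: comult_phi psi_phi)

lemma comult_X_sw:
  assumes F: "bilinear_map K X X M F" and [simp]: "module K M" and [simp]: "x \<in> carrier X"
  shows "sw K 0 X X M (comult X x) F = sw K 0 Y Y M (comult Y (\<phi> x)) (\<lambda>y1 y2. F (\<psi> y1) (\<psi> y2))"
proof -
  note [simp] = bilinear_rules[OF F]
  show ?thesis by (subst comult_X) simp_all
qed

lemma linear_X [simp]:
  "\<lbrakk>linear_map K V X f; x \<in> carrier X\<rbrakk> \<Longrightarrow> linear_map K V X (\<lambda>v. f v \<otimes>\<^bsub>X\<^esub> x)"
  "\<lbrakk>linear_map K V X f; x \<in> carrier X\<rbrakk> \<Longrightarrow> linear_map K V X (\<lambda>v. x \<otimes>\<^bsub>X\<^esub> f v)"
  "linear_map K V X f \<Longrightarrow> linear_map K V (tensor K X X) (\<lambda>v. comult X (f v))"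
  "linear_map K V X f \<Longrightarrow> linear_map K V (base_space K) (\<lambda>v. counit X (f v))"
  by (rule linear_map_comp[where f = f, OF linear_map_cong[OF _ mult_X]]
      linear_map_comp[where f = f, OF linear_map_cong[OF _ comult_X]]
      linear_map_comp[where f = f, OF linear_map_cong[OF _ counit_phi[symmetric]]]; simp)+

lemmas sweedler_comult_X = sweedler_comult_sw[OF _ linear_X(3)[OF linear_id]]

lemma assoc_algebra_X: "assoc_algebra K X"
  by (rule assoc_algebraI[of X X])
    (simp_all add: same_space_def Y.K.field_axioms, simp_all add: mult_X one_X phi_psi psi_phi Y.A.m_assoc)

lemma counit_psi: "y \<in> carrier Y \<Longrightarrow> counit X (\<psi> y) = counit Y y"
  using counit_phi[of "\<psi> y"] by (simp add: phi_psi)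

lemma counit_X_closed [simp]: "x \<in> carrier X \<Longrightarrow> counit X x \<in> carrier K"
  by (simp flip: counit_phi)

lemma coalgebra_X: "coalgebra K X"
  by (rule coalgebraI[of X X])
    (simp_all add: same_space_def Y.K.field_axioms comult_X_sw phi_psi psi_phi Y.coassoc_sw
      counit_psi Y.counit_sw)

lemma bialgebra_X: "bialgebra K X"
proof (intro bialgebra.intro bialgebra_axioms.intro assoc_algebra_X coalgebra_X)
  show "comult X \<one>\<^bsub>X\<^esub> = \<one>\<^bsub>tensor_coalg K X X\<^esub>"
    by (simp add: tensor_coalg_simps comult_X phi_one Y.comult_one_sw one_X[symmetric])
  show "counit X \<one>\<^bsub>X\<^esub> = \<one>\<^bsub>K\<^esub>"
    by (simp flip: counit_phi add: phi_one Y.counit_one)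
  fix x y assume [simp]: "x \<in> carrier X" "y \<in> carrier X"
  show "counit X (x \<otimes>\<^bsub>X\<^esub> y) = counit X x \<otimes>\<^bsub>K\<^esub> counit X y"
    by (simp flip: counit_phi add: phi_mult Y.counit_mult)
  show "comult X (x \<otimes>\<^bsub>X\<^esub> y) = comult X x \<otimes>\<^bsub>tensor_coalg K X X\<^esub> comult X y"
    by (simp add: tensor_coalg_def Let_def sweedler_comult_X comult_X_sw)
      (simp add: comult_X phi_mult Y.comult_mult_sw mult_X phi_psi)
qed

lemma bialgebra_iso_phi: "bialgebra_iso K X Y \<phi>"
  unfolding bialgebra_iso_def
proof (intro conjI ballI)
  show "bij_betw \<phi> (carrier X) (carrier Y)"
    by (rule bij_betw_byWitness[of _ \<psi>]) (auto simp: psi_phi phi_psi)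
  fix x assume "x \<in> carrier X"
  then show "comult Y (\<phi> x) = (\<Oplus>[K, tensor K Y Y] x1 \<otimes> x2 \<in> comult X x. tens K Y Y (\<phi> x1) (\<phi> x2))"
    by (simp add: comult_phi sweedler_comult_X)
qed (simp_all add: bialgebra_X Y.bialgebra_axioms phi phi_one phi_mult counit_phi)

end

section \<open>The L-R-smash biproduct as a double biproduct\<close>

text \<open>The counterpart of \<open>tensor3_ext\<close> for the other bracketing, which is that of
  the space of the L-R-smash biproduct.\<close>

lemma tensor_left_ext:
  assumes U: "module K U" and V: "module K V" and W: "module K W" and M: "module K M"
    and f: "linear_map K (tensor K (tensor K U V) W) M f" and g: "linear_map K (tensor K (tensor K U V) W) M g"
    and eq: "\<And>u v w. \<lbrakk>u \<in> carrier U; v \<in> carrier V; w \<in> carrier W\<rbrakk>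
      \<Longrightarrow> f (tens K (tensor K U V) W (tens K U V u v) w) = g (tens K (tensor K U V) W (tens K U V u v) w)"
    and t: "t \<in> carrier (tensor K (tensor K U V) W)"
  shows "f t = g t"
proof (rule tensor_ext[OF _ W M f g _ t])
  show UV: "module K (tensor K U V)" using U V by simp
  fix s w assume w: "w \<in> carrier W" and s: "s \<in> carrier (tensor K U V)"
  have lin: "linear_map K (tensor K U V) M (\<lambda>s. h (tens K (tensor K U V) W s w))"
    if "linear_map K (tensor K (tensor K U V) W) M h" for h
    by (rule linear_map_comp[OF that]) (simp add: W UV w)
  show "f (tens K (tensor K U V) W s w) = g (tens K (tensor K U V) W s w)"
    by (rule tensor_ext[OF U V M lin[OF f] lin[OF g] _ s]) (rule eq[OF _ _ w])
qed

context double_biproduct_data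
begin

section \<open>Comparison of the two biproducts\<close>

abbreviation "SH \<equiv> tensor K S H"
abbreviation "X \<equiv> lr_smash_biproduct K H D lact ract lcoact rcoact"
abbreviation "phi \<equiv> smash_to_double K H A B"

text \<open>The inverse of \<open>phi\<close>. Written with \<open>sw\<close>, its linearity follows
  from the simp rules of the calculus.\<close>

definition "psi t = sw K 0 A HB SH t (\<lambda>a u. sw K 0 H B SH u (\<lambda>h b. tens K S H (tens K A B a b) h))"

lemma same_space_X: "same_space X SH"
  by (simp add: same_space_def lr_smash_biproduct_def Let_def same_D)

lemmas to_sw_X = to_sw_lr AB.to_sw_D sweedler_eq_sw[where V = S and W = H and n = 0]

lemma one_X: "\<one>\<^bsub>X\<^esub> = tens K S H (tens K A B \<one>\<^bsub>A\<^esub> \<one>\<^bsub>B\<^esub>) \<one>\<^bsub>H\<^esub>"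
  by (simp add: lr_smash_biproduct_def Let_def same_D AB.one_D)

lemma mult_X:
  assumes "s \<in> carrier SH" "t \<in> carrier SH"
  shows "s \<otimes>\<^bsub>X\<^esub> t = sw K 0 S H SH s (\<lambda>d h. sw K 0 S H SH t (\<lambda>d' h'.
    sw K 0 H H SH (comult H h) (\<lambda>h1 h2. sw K 0 H H SH (comult H h') (\<lambda>h1' h2'.
      tens K S H (ract d h2' \<otimes>\<^bsub>D\<^esub> lact h1 d') (h2 \<cdot> h1')))))"
  using assms by (simp add: lr_smash_biproduct_def Let_def same_D to_sw_X)

lemma comult_X:
  assumes "t \<in> carrier SH"
  shows "comult X t = sw K 0 S H (tensor K SH SH) t (\<lambda>d h.
    sw K 0 S S (tensor K SH SH) (comult D d) (\<lambda>d1 d2. sw K 0 H H (tensor K SH SH) (comult H h) (\<lambda>h1 h2.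
    sw K 0 S H (tensor K SH SH) (rcoact d1) (\<lambda>d1' g. sw K 0 H S (tensor K SH SH) (lcoact d2) (\<lambda>g' d2'.
      tens K SH SH (tens K S H d1' (g' \<cdot> h1)) (tens K S H d2' (h2 \<cdot> g)))))))"
  using assms by (simp add: lr_smash_biproduct_def Let_def same_D to_sw_X)

lemma counit_X:
  assumes "t \<in> carrier SH"
  shows "counit X t = sw K 0 S H (base_space K) t (\<lambda>d h. counit D d \<otimes> counit H h)"
  using assms by (simp add: lr_smash_biproduct_def Let_def same_D to_sw_X)

lemma phi:
  assumes "t \<in> carrier SH"
  shows "phi t = sw K 0 S H T t (\<lambda>d h. sw K 0 A B T d (\<lambda>a b. tens3 K A H B a h b))"
  using assms by (simp add: smash_to_double_def to_sw_X)

lemma phi_psi_linear: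
  "linear_map K SH T phi" "linear_map K T SH psi"
proof -
  show "linear_map K SH T phi"
    by (rule linear_map_cong[OF _ phi]) simp_all
  show "linear_map K T SH psi"
    unfolding psi_def[abs_def] by simp
qed

lemma phi_maps [simp]:
  "t \<in> carrier SH \<Longrightarrow> phi t \<in> carrier T"
  "linear_map K V SH f \<Longrightarrow> linear_map K V T (\<lambda>x. phi (f x))"
  "s \<in> carrier T \<Longrightarrow> psi s \<in> carrier SH"
  "linear_map K W T g \<Longrightarrow> linear_map K W SH (\<lambda>x. psi (g x))"
  using linear_map_closed[OF phi_psi_linear(1)] linear_map_closed[OF phi_psi_linear(2)]
    linear_map_comp[OF phi_psi_linear(1)] linear_map_comp[OF phi_psi_linear(2)] by auto

lemma X_closed [simp]:
  "\<lbrakk>s \<in> carrier SH; t \<in> carrier SH\<rbrakk> \<Longrightarrow> s \<otimes>\<^bsub>X\<^esub> t \<in> carrier SH"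
  "t \<in> carrier SH \<Longrightarrow> comult X t \<in> carrier (tensor K SH SH)"
  by (simp_all add: mult_X comult_X)

lemma linear_X [simp]:
  "\<lbrakk>linear_map K V SH f; t \<in> carrier SH\<rbrakk> \<Longrightarrow> linear_map K V SH (\<lambda>x. f x \<otimes>\<^bsub>X\<^esub> t)"
  "\<lbrakk>linear_map K V SH f; t \<in> carrier SH\<rbrakk> \<Longrightarrow> linear_map K V SH (\<lambda>x. t \<otimes>\<^bsub>X\<^esub> f x)"
  "linear_map K V SH f \<Longrightarrow> linear_map K V (tensor K SH SH) (\<lambda>x. comult X (f x))"
  "linear_map K V SH f \<Longrightarrow> linear_map K V (base_space K) (\<lambda>x. counit X (f x))"
  by (rule linear_map_comp[where f = f, OF linear_map_cong[OF _ mult_X]]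
      linear_map_comp[where f = f, OF linear_map_cong[OF _ comult_X]]
      linear_map_comp[where f = f, OF linear_map_cong[OF _ counit_X]]; simp)+

lemma phi_tens:
  assumes [simp]: "a \<in> carrier A" "b \<in> carrier B" "h \<in> carrier H"
  shows "phi (tens K S H (tens K A B a b) h) = tens3 K A H B a h b"
    and "psi (tens3 K A H B a h b) = tens K S H (tens K A B a b) h"
  by (simp_all add: phi psi_def)

lemma phi_sw:
  assumes f: "\<And>x y. \<lbrakk>x \<in> carrier P; y \<in> carrier Q\<rbrakk> \<Longrightarrow> f x y \<in> carrier SH"
  shows "phi (sw K n P Q SH t f) = sw K n P Q T t (\<lambda>x y. phi (f x y))"
  using f by (intro linear_map_sw[OF _ _ phi_psi_linear(1)]) simp_all

lemma bialgebra_transport_phi: "bialgebra_transport K X Y phi psi"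
proof (intro bialgebra_transport.intro bialgebra_transport_axioms.intro bialgebra_Y)
  note XY = same_space[OF same_space_X] same_space[OF same_space_Y]
  note extX = tensor_left_ext[where K = K and U = A and V = B and W = H]
    and extY = tensor3_ext[where K = K and U = A and V = H and W = B]
  show "module K X" by (rule same_space_module[OF same_space_X]) simp
  show "linear_map K X Y phi" "linear_map K Y X psi"
    unfolding XY by (rule phi_psi_linear)+
  show "\<one>\<^bsub>X\<^esub> \<in> carrier X" "phi \<one>\<^bsub>X\<^esub> = \<one>\<^bsub>Y\<^esub>"
    unfolding XY by (simp_all add: one_X one_Y phi_tens)
  { fix y assume "y \<in> carrier Y"
    then have y: "y \<in> carrier T" by (simp add: XY)
    show "phi (psi y) = y"
      by (rule extY[where M = T, OF _ _ _ _ _ _ _ y]) (simp_all add: phi_tens) }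
  fix x assume "x \<in> carrier X"
  then have x [simp]: "x \<in> carrier SH" by (simp add: XY)
  show "psi (phi x) = x"
    by (rule extX[where M = SH, OF _ _ _ _ _ _ _ x]) (simp_all add: phi_tens)
  show "comult X x \<in> carrier (tensor K X X)"
    unfolding XY by simp
  show "counit Y (phi x) = counit X x"
    by (rule extX[where M = "base_space K", OF _ _ _ _ _ _ _ x])
      (simp_all add: phi_tens counit_X counit_Y_tens AB.D_tens H.K.m_ac)
  have "comult Y (phi x) = sw K 0 SH SH (tensor K T T) (comult X x) (\<lambda>x1 x2. tens K T T (phi x1) (phi x2))"
    \<comment> \<open>On pure tensors the two coproducts have the same terms; the two instances of
      \<open>sw_swap\<close> reconcile the orders in which the legs of b and h and the coactions are
      summed.\<close>
    by (rule extX[where M = "tensor K T T", OF _ _ _ _ _ _ _ x])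
      (simp_all add: phi_tens comult_X comult_Y_tens AB.D_tens lr_tens
        sw_swap[where V = B and W = B and P = H and Q = H] sw_swap[where V = B and W = H and P = H and Q = A])
  then show "comult Y (phi x) = sw K 0 X X (tensor K Y Y) (comult X x) (\<lambda>x1 x2. tens K Y Y (phi x1) (phi x2))"
    \<comment> \<open>\<open>sw\<close> takes the spaces as arguments, so the passage from the
      tensor products to the records X and Y goes through its definition.\<close>
    unfolding sw_def XY by (simp add: same_space_module[OF same_space_X])
  fix y assume "y \<in> carrier X"
  then have y [simp]: "y \<in> carrier SH" by (simp add: XY)
  show "x \<otimes>\<^bsub>X\<^esub> y \<in> carrier X" unfolding XY by simp
  have 1: "phi (tens K S H (tens K A B a b) h \<otimes>\<^bsub>X\<^esub> y) = tens3 K A H B a h b \<otimes>\<^bsub>Y\<^esub> phi y"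
    if [simp]: "a \<in> carrier A" "b \<in> carrier B" "h \<in> carrier H" for a b h
    by (rule extX[where M = T, OF _ _ _ _ _ _ _ y])
      (simp_all add: mult_X phi_sw phi_tens mult_Y_tens lr_tens AB.D_tens)
  show "phi (x \<otimes>\<^bsub>X\<^esub> y) = phi x \<otimes>\<^bsub>Y\<^esub> phi y"
    by (rule extX[where M = T, OF _ _ _ _ _ _ _ x]) (simp_all add: 1 phi_tens)
qed

end

text \<open>\<open>smash_to_double\<close> is defined through chosen representatives; the last
  conjunct confirms its intended values on pure tensors, which determine a linear map.\<close>

theorem proposition1p4:
  fixes K :: "('k, 'm) ring_scheme"
    and H :: "('k, 'h) coalg"
    and A :: "('k, 'a) coalg" and actA :: "'h \<Rightarrow> 'a \<Rightarrow> 'a" and coactA :: "'a \<Rightarrow> ('h, 'a, 'k) tensor"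
    and B :: "('k, 'b) coalg" and actB :: "'b \<Rightarrow> 'h \<Rightarrow> 'b" and coactB :: "'b \<Rightarrow> ('b, 'h, 'k) tensor"
  assumes "field K" and "bialgebra K H"
    and "ll_yd_bialgebra K H A actA coactA"
    and "rr_yd_bialgebra K H B actB coactB"
    and "\<And>a b. \<lbrakk>a \<in> carrier A; b \<in> carrier B\<rbrakk> \<Longrightarrow>
      (\<Oplus>[K, tensor K A B] a1 \<otimes> a2 \<in> coactA a. \<Oplus>[K, tensor K A B] b1 \<otimes> b2 \<in> coactB b.
        tens K A B (actA b2 a2) (actB b1 a1)) = tens K A B a b"
  defines "D \<equiv> tensor_coalg K A B"
    and "lact \<equiv> prod_lact K A actA B" and "ract \<equiv> prod_ract K A B actB"
    and "lcoact \<equiv> prod_lcoact K H A coactA B" and "rcoact \<equiv> prod_rcoact K H A B coactB"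
    and "\<phi> \<equiv> smash_to_double K H A B"
  shows "lr_admissible K H D lact ract lcoact rcoact
    \<and> bialgebra_iso K (lr_smash_biproduct K H D lact ract lcoact rcoact)
        (double_biproduct K H A actA coactA B actB coactB) \<phi>
    \<and> (\<forall>a\<in>carrier A. \<forall>b\<in>carrier B. \<forall>h\<in>carrier H.
        \<phi> (tens K D H (tens K A B a b) h) = tens3 K A H B a h b)"
proof -
  interpret double_biproduct_data K H A actA coactA B actB coactB
    by (intro double_biproduct_data.intro double_biproduct_data_axioms.intro assms(2-5))
  interpret bialgebra_transport K X Y phi psi by (rule bialgebra_transport_phi)
  show ?thesis
    unfolding D_def lact_def ract_def lcoact_def rcoact_def \<phi>_def
    by (intro conjI ballI lr_admissible_D bialgebra_iso_phi) (simp add: same_D phi_tens)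
qed

end
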